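(* Let $G$ be a finite group having at most $5$ irrational conjugacy classes. Then $|\mathrm{cl}_{\mathbb{Q}}(G)| = |\mathrm{Irr}_{\mathbb{Q}}(G)|$.
   Context: For a finite group $G$, a conjugacy class $K$ of $G$ is called rational if $\chi(K) \in \mathbb{Q}$ for every $\chi \in \mathrm{Irr}(G)$ (the set of complex irreducible characters of $G$), and irrational otherwise. $\mathrm{cl}_{\mathbb{Q}}(G)$ denotes the set of rational conjugacy classes of $G$. An irreducible character $\chi$ is rational if $\mathbb{Q}(\chi) = \mathbb{Q}$, where $\mathbb{Q}(\chi)$ is the field generated over $\mathbb{Q}$ by the values $\chi(g)$, $g \in G$; $\mathrm{Irr}_{\mathbb{Q}}(G)$ denotes the set of rational irreducible characters of $G$. *)

theory Defs
  imports "HOL-Algebra.Group" "Jordan_Normal_Form.Matrix"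
begin

definition conj_classes :: "('a, 'b) monoid_scheme \<Rightarrow> 'a set set" where
  "conj_classes G = (\<lambda>g. {inv\<^bsub>G\<^esub> h \<otimes>\<^bsub>G\<^esub> g \<otimes>\<^bsub>G\<^esub> h | h. h \<in> carrier G}) ` carrier G"

definition is_rep :: "('a, 'b) monoid_scheme \<Rightarrow> nat \<Rightarrow> ('a \<Rightarrow> complex mat) \<Rightarrow> bool" where
  "is_rep G n \<rho> \<longleftrightarrow>
     (\<forall>g \<in> carrier G. \<rho> g \<in> carrier_mat n n) \<and>
     \<rho> \<one>\<^bsub>G\<^esub> = 1\<^sub>m n \<and>
     (\<forall>g \<in> carrier G. \<forall>h \<in> carrier G. \<rho> (g \<otimes>\<^bsub>G\<^esub> h) = \<rho> g * \<rho> h)"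

definition invariant_subspace :: "('a, 'b) monoid_scheme \<Rightarrow> nat \<Rightarrow> ('a \<Rightarrow> complex mat) \<Rightarrow> complex vec set \<Rightarrow> bool" where
  "invariant_subspace G n \<rho> W \<longleftrightarrow>
     W \<subseteq> carrier_vec n \<and> 0\<^sub>v n \<in> W \<and>
     (\<forall>v \<in> W. \<forall>w \<in> W. v + w \<in> W) \<and>
     (\<forall>c. \<forall>v \<in> W. c \<cdot>\<^sub>v v \<in> W) \<and>
     (\<forall>g \<in> carrier G. \<forall>v \<in> W. \<rho> g *\<^sub>v v \<in> W)"

definition irreducible_rep :: "('a, 'b) monoid_scheme \<Rightarrow> nat \<Rightarrow> ('a \<Rightarrow> complex mat) \<Rightarrow> bool" where
  "irreducible_rep G n \<rho> \<longleftrightarrow> is_rep G n \<rho> \<and> n > 0 \<and>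
     (\<forall>W. invariant_subspace G n \<rho> W \<longrightarrow> W = {0\<^sub>v n} \<or> W = carrier_vec n)"

definition mat_trace :: "complex mat \<Rightarrow> complex" where
  "mat_trace A = (\<Sum>i<dim_row A. A $$ (i, i))"

definition character :: "('a, 'b) monoid_scheme \<Rightarrow> ('a \<Rightarrow> complex mat) \<Rightarrow> 'a \<Rightarrow> complex" where
  "character G \<rho> = (\<lambda>g. if g \<in> carrier G then mat_trace (\<rho> g) else 0)"

definition Irr :: "('a, 'b) monoid_scheme \<Rightarrow> ('a \<Rightarrow> complex) set" where
  "Irr G = {character G \<rho> | \<rho> n. irreducible_rep G n \<rho>}"

definition Irr_rat :: "('a, 'b) monoid_scheme \<Rightarrow> ('a \<Rightarrow> complex) set" where
  "Irr_rat G = {\<chi> \<in> Irr G. \<forall>g \<in> carrier G. \<chi> g \<in> \<rat>}"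

definition rational_class :: "('a, 'b) monoid_scheme \<Rightarrow> 'a set \<Rightarrow> bool" where
  "rational_class G K \<longleftrightarrow> (\<forall>\<chi> \<in> Irr G. \<forall>g \<in> K. \<chi> g \<in> \<rat>)"

definition cl_rat :: "('a, 'b) monoid_scheme \<Rightarrow> 'a set set" where
  "cl_rat G = {K \<in> conj_classes G. rational_class G K}"

definition cl_irrat :: "('a, 'b) monoid_scheme \<Rightarrow> 'a set set" where
  "cl_irrat G = {K \<in> conj_classes G. \<not> rational_class G K}"

end

theory Submission
  imports
    Defs
    "Jordan_Normal_Form.Schur_Decomposition"
    "Jordan_Normal_Form.Spectral_Radius"
    "HOL-Algebra.Multiplicative_Group"
    "HOL-Library.Function_Algebras"
begin

text \<open>
  Write \<open>N\<close> for the group order. An exponent \<open>k\<close> coprime to \<open>N\<close> sends a class \<open>K\<close> to the class of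
  \<open>k\<close>-th powers and a character \<open>\<chi>\<close> to \<open>g \<mapsto> \<chi> (g\<^sup>k)\<close>, and both actions have equally many fixed
  points (Brauer). That \<open>g \<mapsto> \<chi> (g\<^sup>k)\<close> is again an irreducible character follows without extending
  field automorphisms to the complex numbers: by irreducibility of the cyclotomic polynomials the
  integral identity \<open>N \<chi>(x) \<chi>(y) = \<chi>(1) \<Sum>h. \<chi>(x h y h\<inverse>)\<close> survives \<open>\<zeta> \<mapsto> \<zeta>\<^sup>k\<close>, and it
  characterises irreducible characters among class functions up to a scalar.

  With at most five irrational classes some exponent \<open>c\<close> moves all of them, so that exactly as many
  characters are fixed by \<open>c\<close> as there are rational classes. If such a character \<open>\<alpha>\<close> were moved by
  some \<open>l\<close>, linear independence of characters would force exactly four irrational classes, permuted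
  regularly by the Klein four-group generated by \<open>c\<close> and \<open>l\<close>, and counting fixed points would give
  characters \<open>\<beta>\<close> and \<open>\<gamma>\<close> fixed by \<open>l\<close> and by \<open>c l\<close>, respectively, and moved by \<open>c\<close>. The
  differences of \<open>\<alpha>\<close>, \<open>\<beta>\<close>, \<open>\<gamma>\<close> and their conjugates vanish on rational classes and have the same
  norm, so their squares at an irrational class agree up to sign; hence two of the three differences
  agree up to sign there, although the Galois action treats them differently.
\<close>

hide_const (open) up_ring.monom up_ring.coeff Coset.order

section \<open>Conjugate roots of unity\<close>

text \<open>For each \<open>\<chi>\<close> and \<open>g\<close> a single integer polynomial q
  satisfies \<open>\<chi> (g [^] k) = q(zeta ^ k)\<close> for every \<open>k\<close>: the sum of
  \<open>X ^ e\<close> over the eigenvalues \<open>zeta ^ e\<close> of \<open>g\<close>. An integer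
  relation among character values is therefore the vanishing of an integer polynomial at
  \<open>zeta\<close>, and it passes to \<open>zeta ^ k\<close>. The bound five enters by counting.
  On six classes a Klein four-group could act with three orbits of length two and three different
  stabilisers, and then no exponent would move everything; with five or fewer, commuting power maps
  leave no room for this. On a regular orbit of the four-group each of the three differences is
  multiplied by a sign under every exponent, and the three realise the three nontrivial sign
  patterns. The scalar product pairs \<open>g\<close> with \<open>inv g\<close>, and it is unknown
  which exponent acts as inversion. So the squares are known only up to the sign by which inversion
  acts, and among three signs two must agree.\<close>

lemma pow_add_prime_dvd:
  fixes a b :: "'a :: comm_ring_1"
  assumes "prime p"
  shows "of_nat p dvd (a + b) ^ p - a ^ p - b ^ p"
proof -
  have p0: "p > 0" using assms prime_gt_0_nat by blast
  have "(a + b) ^ p = (\<Sum>k\<le>p. of_nat (p choose k) * a ^ k * b ^ (p - k))"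
    by (rule binomial_ring)
  also have "{..p} = insert 0 (insert p {1..<p})" using p0 by auto
  also have "(\<Sum>k\<in>\<dots>. of_nat (p choose k) * a ^ k * b ^ (p - k)) =
      b ^ p + (a ^ p + (\<Sum>k\<in>{1..<p}. of_nat (p choose k) * a ^ k * b ^ (p - k)))"
    using p0 by (subst sum.insert; force)
  finally have eq: "(a + b) ^ p - a ^ p - b ^ p =
      (\<Sum>k\<in>{1..<p}. of_nat (p choose k) * a ^ k * b ^ (p - k))" by simp
  have "of_nat p dvd (of_nat (p choose k) * a ^ k * b ^ (p - k) :: 'a)" if "k \<in> {1..<p}" for k
  proof -
    have "p dvd (p choose k)" using that assms by (intro dvd_choose_prime) auto
    then show ?thesis by (metis dvd_def mult.assoc of_nat_mult)
  qed
  then show ?thesis unfolding eq by (rule dvd_sum)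
qed

lemma int_pow_prime_dvd:
  fixes a :: int
  assumes "prime p"
  shows "int p dvd a ^ p - a"
proof (induction a rule: int_induct[where k = 0])
  case base
  then show ?case using prime_gt_0_nat[OF assms] by (simp add: zero_power)
next
  case (step1 i)
  have "(i + 1) ^ p - (i + 1) = ((i + 1) ^ p - i ^ p - 1 ^ p) + (i ^ p - i)" by simp
  then show ?case using pow_add_prime_dvd[OF assms, of i 1] step1 by (metis dvd_add)
next
  case (step2 i)
  have "(i - 1) ^ p - (i - 1) = (i ^ p - i) - ((i - 1 + 1) ^ p - (i - 1) ^ p - 1 ^ p)" by simp
  then show ?case using pow_add_prime_dvd[OF assms, of "i - 1" 1] step2 by (metis dvd_diff)
qed

text \<open>The Frobenius congruence modulo \<open>p\<close>, by peeling off the constant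
  coefficient: Fermat's congruence handles that coefficient, and the binomial congruence separates
  it from the rest.\<close>

lemma int_poly_pow_prime_dvd:
  fixes q :: "int poly"
  assumes "prime p"
  shows "[:int p:] dvd pcompose q ([:0, 1:] ^ p) - q ^ p"
proof (induction q)
  case 0
  then show ?case using prime_gt_0_nat[OF assms] by (simp add: zero_power)
next
  case (pCons a q)
  let ?X = "[:0, 1:] :: int poly"
  have p: "of_nat p = [:int p:]" by (simp add: of_nat_poly)
  have "pCons a q = [:a:] + ?X * q" by simp
  then have pw: "pCons a q ^ p = ([:a:] + ?X * q) ^ p" by (rule arg_cong)
  have 1: "[:int p:] dvd ([:a:] + ?X * q) ^ p - [:a:] ^ p - (?X * q) ^ p"
    using pow_add_prime_dvd[OF assms, of "[:a:]" "?X * q"] unfolding p .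
  have 2: "[:int p:] dvd [:a:] - [:a:] ^ p"
    using int_pow_prime_dvd[OF assms, of a] by (auto simp: poly_const_pow dvd_diff_commute)
  have 3: "[:int p:] dvd ?X ^ p * (pcompose q (?X ^ p) - q ^ p)"
    using pCons.IH by (rule dvd_mult)
  have "pcompose (pCons a q) (?X ^ p) - (pCons a q) ^ p =
     ([:a:] - [:a:] ^ p) + ?X ^ p * (pcompose q (?X ^ p) - q ^ p)
     - (([:a:] + ?X * q) ^ p - [:a:] ^ p - (?X * q) ^ p)"
    unfolding pcompose_pCons pw power_mult_distrib[of ?X q p] by (simp only: algebra_simps)
  then show ?case using 1 2 3 by (simp only: dvd_add dvd_diff)
qed

abbreviation ieval :: "int poly \<Rightarrow> complex \<Rightarrow> complex" where
  "ieval q x \<equiv> poly (of_int_poly q) x"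

text \<open>Gauss's lemma: contents multiply, so with \<open>f\<close> primitive the factor
  \<open>c\<close> divides the content of \<open>h\<close> and can be cancelled.\<close>

lemma primitive_dvd_of_smult:
  fixes f g h :: "int poly"
  assumes "smult c g = f * h" "content f = 1" "c \<noteq> 0"
  shows "f dvd g"
proof -
  have "f * h = [:c:] * g" using assms(1) by simp
  then have "[:c:] dvd f * h" by (rule dvdI)
  then have "c dvd content h" using assms(2) by (simp add: const_poly_dvd_iff_dvd_content content_mult)
  then have "[:c:] dvd h" by (simp add: const_poly_dvd_iff_dvd_content)
  then obtain h' where h': "h = [:c:] * h'" by (elim dvdE)
  have "smult c g = smult c (f * h')" unfolding assms(1) h' by simp
  then have "g = f * h'" using assms(3) by (simp add: smult_cancel)
  then show ?thesis by simp
qed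

text \<open>The primitive part of a nonzero polynomial of least degree vanishing at \<open>z\<close>
  works: pseudo-division by it leaves a remainder of smaller degree that vanishes at
  \<open>z\<close>, hence zero, and Gauss's lemma removes the scalar that pseudo-division
  introduces.\<close>

lemma int_min_poly_exists:
  fixes z :: complex
  assumes q: "ieval q z = 0" "q \<noteq> 0"
  obtains f where "f \<noteq> 0" "ieval f z = 0"
    "\<And>g. ieval g z = 0 \<Longrightarrow> degree g < degree f \<Longrightarrow> g = 0"
    "\<And>g. ieval g z = 0 \<Longrightarrow> f dvd g"
proof -
  let ?P = "\<lambda>f. f \<noteq> (0 :: int poly) \<and> ieval f z = 0"
  obtain f0 where f0: "?P f0" and min0: "\<And>g. ?P g \<Longrightarrow> degree f0 \<le> degree g"
    using ex_has_least_nat[of ?P q degree] q by auto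
  define f where "f = primitive_part f0"
  have c0: "content f0 \<noteq> 0" using f0 by simp
  have "ieval f0 z = ieval (smult (content f0) f) z" unfolding f_def by simp
  then have "of_int (content f0) * ieval f z = 0" using f0 by (simp add: hom_distribs)
  then have f: "f \<noteq> 0" "ieval f z = 0" "content f = 1"
    using f0 c0 by (auto simp: f_def)
  have min: "g = 0" if "ieval g z = 0" "degree g < degree f" for g
    using min0[of g] that unfolding f_def by fastforce
  have dvd: "f dvd g" if "ieval g z = 0" for g
  proof -
    obtain h r where hr: "pseudo_divmod g f = (h, r)" by force
    let ?c = "coeff f (degree f) ^ (Suc (degree g) - degree f)"
    note pd = pseudo_divmod[OF f(1) hr]
    have "ieval (smult ?c g) z = ieval (f * h + r) z" unfolding pd(1) ..
    then have "ieval r z = 0" using that f(2) by (simp add: hom_distribs)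
    then have "r = 0" using min pd(2) by blast
    then show ?thesis using pd(1) f by (intro primitive_dvd_of_smult[of ?c _ _ h]) auto
  qed
  show ?thesis using that[OF f(1,2) min dvd] by blast
qed

text \<open>Powers of the inverse \<open>u\<close> cancel the scalar of pseudo-division, so a
  remainder over the integers exists.\<close>

lemma int_poly_division_unit_lead:
  fixes f s :: "int poly"
  assumes "lead_coeff f * u = 1" "degree f > 0"
  obtains h t where "s = f * h + t" "degree t < degree f"
proof -
  have f: "f \<noteq> 0" using assms by auto
  obtain h' s' where hs: "pseudo_divmod s f = (h', s')" by force
  let ?e = "Suc (degree s) - degree f"
  note pd = pseudo_divmod[OF f hs]
  have "smult (u ^ ?e) (smult (lead_coeff f ^ ?e) s) = smult (u ^ ?e) (f * h' + s')"
    unfolding pd(1) ..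
  moreover have "u ^ ?e * lead_coeff f ^ ?e = 1"
    using assms(1) by (simp add: power_mult_distrib[symmetric] mult.commute)
  ultimately have "s = f * smult (u ^ ?e) h' + smult (u ^ ?e) s'"
    by (simp add: smult_add_right)
  moreover have "degree (smult (u ^ ?e) s') < degree f"
    using pd(2) assms(2) by (metis degree_0 degree_smult_le order.strict_trans1 smult_0_right)
  ultimately show ?thesis by (rule that)
qed

text \<open>The step behind the irreducibility of cyclotomic polynomials, carried out in Z[z]. If
  the minimal polynomial \<open>f\<close> does not vanish at \<open>z ^ p\<close>, its cofactor
  \<open>h\<close> in \<open>X^N - 1\<close> does, and differentiating gives
  \<open>N = f(z^p) h'(z^p) z^p\<close>. Frobenius makes \<open>f(z^p)\<close> a multiple of
  \<open>p\<close>, so \<open>p\<close> divides \<open>N\<close> in Z[z] and, after division by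
  \<open>f\<close>, in the integers.\<close>

lemma ieval_root_of_unity_prime:
  fixes z :: complex
  assumes z: "z ^ N = 1" and p: "prime p" and ndvd: "\<not> p dvd N" and q: "ieval q z = 0"
  shows "ieval q (z ^ p) = 0"
proof (rule ccontr)
  assume nz: "ieval q (z ^ p) \<noteq> 0"
  have N0: "N > 0" using ndvd by (cases N) auto
  have "q \<noteq> 0" using nz by auto
  then obtain f where f: "f \<noteq> 0" "ieval f z = 0"
    and min: "\<And>g. ieval g z = 0 \<Longrightarrow> degree g < degree f \<Longrightarrow> g = 0"
    and dvd': "\<And>g. ieval g z = 0 \<Longrightarrow> f dvd g"
    using int_min_poly_exists[OF q] by metis
  have fp: "ieval f (z ^ p) \<noteq> 0"
  proof
    assume "ieval f (z ^ p) = 0"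
    moreover obtain h where "q = f * h" using dvd'[OF q] by blast
    ultimately show False using nz by (simp add: hom_distribs)
  qed
  let ?X = "[:0, 1:] :: int poly"
  have "ieval (?X ^ N - 1) z = 0" using z by (simp add: hom_distribs)
  then obtain h where h: "?X ^ N - 1 = f * h" using dvd' by blast
  have "lead_coeff (?X ^ N - 1) = 1"
  proof -
    have X: "?X ^ N - 1 = monom 1 N + (- 1)" by (simp add: monom_altdef)
    have "degree (?X ^ N - 1) = N"
      unfolding X using N0 by (subst degree_add_eq_left) (simp_all add: degree_monom_eq)
    then show ?thesis using N0 unfolding X by (simp add: coeff_1)
  qed
  then have lc: "lead_coeff f * lead_coeff h = 1" unfolding h by (simp add: lead_coeff_mult)
  then have lcf: "lead_coeff f dvd 1" by (metis dvd_triv_left)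
  have deg: "degree f > 0"
  proof (rule ccontr)
    assume "\<not> degree f > 0"
    then obtain a where a: "f = [:a:]" by (metis gr0I degree_eq_zeroE)
    then show False using f by simp
  qed
  have zp: "(z ^ p) ^ N = 1" using z by (metis power_mult mult.commute power_one)
  have "ieval (f * h) (z ^ p) = 0" unfolding h[symmetric] using zp by (simp add: hom_distribs)
  then have hp: "ieval h (z ^ p) = 0" using fp by (simp add: hom_distribs)
  have "pderiv (?X ^ N - 1) = pderiv f * h + f * pderiv h"
    unfolding h by (simp add: pderiv_mult algebra_simps)
  moreover have "pderiv (?X ^ N - 1) = smult (int N) (?X ^ (N - 1))"
    by (simp add: pderiv_diff pderiv_power pderiv_pCons)
  ultimately have "ieval (smult (int N) (?X ^ (N - 1))) (z ^ p) = ieval (pderiv f * h + f * pderiv h) (z ^ p)"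
    by simp
  then have "of_nat N * (z ^ p) ^ (N - 1) = ieval f (z ^ p) * ieval (pderiv h) (z ^ p)"
    by (simp add: hp hom_distribs)
  then have eN: "of_nat N * ((z ^ p) ^ (N - 1) * z ^ p) = ieval f (z ^ p) * ieval (pderiv h) (z ^ p) * z ^ p"
    by (simp only: mult.assoc[symmetric])
  have "(z ^ p) ^ (N - 1) * z ^ p = 1" using zp N0
    by (metis Suc_diff_1 power_Suc2)
  with eN have NN: "of_nat N = ieval f (z ^ p) * ieval (pderiv h) (z ^ p) * z ^ p"
    by (simp only: mult_1_right)
  obtain r where r: "pcompose f (?X ^ p) - f ^ p = [:int p:] * r"
    using int_poly_pow_prime_dvd[OF p, of f] by blast
  have "ieval (pcompose f (?X ^ p) - f ^ p) z = ieval f (z ^ p)"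
    using f(2) zero_power[OF prime_gt_0_nat[OF p]] prime_gt_0_nat[OF p] by (simp add: hom_distribs poly_pcompose)
  then have fr: "ieval f (z ^ p) = of_nat p * ieval r z" unfolding r by (simp add: hom_distribs)
  \<comment> \<open>The remaining factors of \<open>N\<close>, with \<open>z ^ p\<close> rewritten
    as a polynomial in \<open>z\<close>.\<close>
  define s where "s = r * pcompose (pderiv h) (?X ^ p) * ?X ^ p"
  have Ns: "of_nat N = of_nat p * ieval s z"
    unfolding NN fr s_def by (simp add: hom_distribs poly_pcompose)
  obtain u where u: "lead_coeff f * u = 1" using lc by blast
  obtain h' t where us: "s = f * h' + t" and dt: "degree t < degree f"
    using int_poly_division_unit_lead[OF u deg] by metis
  have "ieval s z = ieval t z" by (subst us) (simp add: hom_distribs f(2))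
  \<comment> \<open>A polynomial of degree below that of \<open>f\<close> vanishing at
    \<open>z\<close> is zero; its constant coefficient then exhibits \<open>p\<close> as a divisor
    of \<open>N\<close>.\<close>
  then have "ieval ([:int N:] - [:int p:] * t) z = 0" using Ns by (simp add: hom_distribs)
  moreover have "degree ([:int N:] - [:int p:] * t) < degree f"
    using dt deg by (intro degree_diff_less) (auto intro: le_less_trans[OF degree_smult_le])
  ultimately have "[:int N:] - [:int p:] * t = 0" by (rule min)
  then have "coeff ([:int N:] - [:int p:] * t) 0 = 0" by simp
  then have "int N = int p * coeff t 0" by simp
  then have "int p dvd int N" by simp
  then show False using ndvd by simp
qed

text \<open>One prime factor of \<open>k\<close> at a time: every intermediate power is again an
  \<open>N\<close>-th root of unity, so the prime case keeps applying. The exponent 0 is coprime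
  only to 1, where \<open>z\<close> is 1.\<close>

theorem ieval_root_of_unity_coprime:
  fixes z :: complex
  assumes "z ^ N = 1" and "coprime k N" and "ieval q z = 0" and "N > 0"
  shows "ieval q (z ^ k) = 0"
  using assms
proof (induction k arbitrary: z rule: prime_divisors_induct)
  case zero
  then have "N = 1" by simp
  then show ?case using zero by simp
next
  case (unit k)
  then show ?case by simp
next
  case (factor p k)
  have cop: "coprime p N" "coprime k N" using factor.prems by simp_all
  have "\<not> p dvd N"
    using cop(1) factor.hyps by (metis coprime_absorb_left not_prime_unit)
  then have 1: "ieval q (z ^ p) = 0"
    using factor.hyps factor.prems by (intro ieval_root_of_unity_prime[of z N])
  have "(z ^ p) ^ N = 1" using factor.prems by (metis power_mult mult.commute power_one)
  then have "ieval q ((z ^ p) ^ k) = 0"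
    using factor.prems 1 cop by (intro factor.IH)
  then show ?case by (simp add: power_mult)
qed

section \<open>Matrices and Schur's lemma\<close>

text \<open>Dimensions are explicit because \<open>complex mat\<close> holds matrices of all sizes,
  so the value of an empty sum depends on them.\<close>

definition msum :: "nat \<Rightarrow> nat \<Rightarrow> ('a \<Rightarrow> complex mat) \<Rightarrow> 'a set \<Rightarrow> complex mat" where
  "msum n m F S = mat n m (\<lambda>(i, j). \<Sum>g\<in>S. F g $$ (i, j))"

lemma msum_carrier [simp]: "msum n m F S \<in> carrier_mat n m"
  by (simp add: msum_def)

lemma msum_index: "i < n \<Longrightarrow> j < m \<Longrightarrow> msum n m F S $$ (i, j) = (\<Sum>g\<in>S. F g $$ (i, j))"
  by (simp add: msum_def)

lemma msum_cong: "(\<And>g. g \<in> S \<Longrightarrow> F g = F' g) \<Longrightarrow> msum n m F S = msum n m F' S"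
  by (simp add: msum_def cong: sum.cong)

lemma msum_reindex_bij_betw: "bij_betw h S T \<Longrightarrow> msum n m (\<lambda>g. F (h g)) S = msum n m F T"
  unfolding msum_def by (simp add: sum.reindex_bij_betw[of h S T "\<lambda>g. F g $$ _"])

lemma mat_mult_index:
  "A \<in> carrier_mat n k \<Longrightarrow> B \<in> carrier_mat k m \<Longrightarrow> i < n \<Longrightarrow> j < m \<Longrightarrow>
    (A * B) $$ (i, j) = (\<Sum>l<k. A $$ (i, l) * B $$ (l, j))"
  by (auto simp: scalar_prod_def atLeast0LessThan intro!: sum.cong)

lemma mult_msum:
  assumes "A \<in> carrier_mat k n" "\<And>g. g \<in> S \<Longrightarrow> F g \<in> carrier_mat n m"
  shows "A * msum n m F S = msum k m (\<lambda>g. A * F g) S"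
proof (rule eq_matI)
  fix i j assume "i < dim_row (msum k m (\<lambda>g. A * F g) S)" "j < dim_col (msum k m (\<lambda>g. A * F g) S)"
  then have ij: "i < k" "j < m" by (simp_all add: msum_def)
  have "(A * msum n m F S) $$ (i, j) = (\<Sum>l<n. \<Sum>g\<in>S. A $$ (i, l) * F g $$ (l, j))"
    using ij by (subst mat_mult_index[OF assms(1) msum_carrier]) (auto simp: msum_index sum_distrib_left)
  also have "\<dots> = (\<Sum>g\<in>S. (A * F g) $$ (i, j))"
    using ij by (subst sum.swap) (intro sum.cong refl mat_mult_index[symmetric, OF assms(1) assms(2)])
  finally show "(A * msum n m F S) $$ (i, j) = msum k m (\<lambda>g. A * F g) S $$ (i, j)"
    using ij by (simp add: msum_index)
qed (use assms(1) in \<open>auto simp: msum_def\<close>)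

lemma msum_mult:
  assumes "A \<in> carrier_mat m k" "\<And>g. g \<in> S \<Longrightarrow> F g \<in> carrier_mat n m"
  shows "msum n m F S * A = msum n k (\<lambda>g. F g * A) S"
proof (rule eq_matI)
  fix i j assume "i < dim_row (msum n k (\<lambda>g. F g * A) S)" "j < dim_col (msum n k (\<lambda>g. F g * A) S)"
  then have ij: "i < n" "j < k" by (simp_all add: msum_def)
  have "(msum n m F S * A) $$ (i, j) = (\<Sum>l<m. \<Sum>g\<in>S. F g $$ (i, l) * A $$ (l, j))"
    using ij by (subst mat_mult_index[OF msum_carrier assms(1)]) (auto simp: msum_index sum_distrib_right)
  also have "\<dots> = (\<Sum>g\<in>S. (F g * A) $$ (i, j))"
    using ij by (subst sum.swap) (intro sum.cong refl mat_mult_index[symmetric, OF assms(2) assms(1)])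
  finally show "(msum n m F S * A) $$ (i, j) = msum n k (\<lambda>g. F g * A) S $$ (i, j)"
    using ij by (simp add: msum_index)
qed (use assms(1) in \<open>auto simp: msum_def\<close>)

lemma mat_trace_msum:
  assumes "\<And>g. g \<in> S \<Longrightarrow> F g \<in> carrier_mat n n"
  shows "mat_trace (msum n n F S) = (\<Sum>g\<in>S. mat_trace (F g))"
proof -
  have "mat_trace (msum n n F S) = (\<Sum>i<n. \<Sum>g\<in>S. F g $$ (i, i))"
    by (simp add: mat_trace_def msum_def)
  also have "\<dots> = (\<Sum>g\<in>S. \<Sum>i<n. F g $$ (i, i))" by (rule sum.swap)
  also have "\<dots> = (\<Sum>g\<in>S. mat_trace (F g))" 
    using carrier_matD(1)[OF assms] by (auto simp: mat_trace_def intro!: sum.cong)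
  finally show ?thesis .
qed

lemma mat_trace_mult_comm:
  assumes "A \<in> carrier_mat n m" "B \<in> carrier_mat m n"
  shows "mat_trace (A * B) = mat_trace (B * A)"
proof -
  have "mat_trace (A * B) = (\<Sum>i<n. \<Sum>j<m. A $$ (i, j) * B $$ (j, i))"
    using assms by (auto simp: mat_trace_def mat_mult_index[OF assms] simp del: index_mult_mat(1) intro!: sum.cong)
  also have "\<dots> = (\<Sum>j<m. \<Sum>i<n. B $$ (j, i) * A $$ (i, j))"
    by (subst sum.swap) (simp add: mult.commute)
  also have "\<dots> = mat_trace (B * A)"
    using assms by (auto simp: mat_trace_def mat_mult_index[OF assms(2,1)] simp del: index_mult_mat(1) intro!: sum.cong)
  finally show ?thesis .
qed

lemma mat_trace_smult_one: "mat_trace (c \<cdot>\<^sub>m 1\<^sub>m n) = of_nat n * c"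
  by (simp add: mat_trace_def)

lemma mat_trace_smult: "mat_trace (c \<cdot>\<^sub>m A) = c * mat_trace A"
  if "A \<in> carrier_mat n n" using that by (simp add: mat_trace_def sum_distrib_left)

lemma mult_mat_unit_vec:
  assumes "(A :: complex mat) \<in> carrier_mat n m" "j < m"
  shows "A *\<^sub>v unit_vec m j = col A j"
proof (rule eq_vecI)
  fix i assume "i < dim_vec (col A j)"
  then have i: "i < dim_row A" by simp
  have "row A i \<bullet> unit_vec m j = row A i $ j" using assms(2) by (rule scalar_prod_right_unit)
  then show "(A *\<^sub>v unit_vec m j) $ i = col A j $ i" using i assms by simp
qed simp

lemma smult_zero_vec_right: "c \<cdot>\<^sub>v 0\<^sub>v n = (0\<^sub>v n :: complex vec)"
  by (rule eq_vecI) simp_all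

lemma mult_mat_zero_vec:
  assumes "(A :: complex mat) \<in> carrier_mat n m"
  shows "A *\<^sub>v 0\<^sub>v m = 0\<^sub>v n"
  by (rule eq_vecI) (use assms in simp_all)

lemma mat_eq_if_mult_vec_eq:
  assumes "A \<in> carrier_mat n m" "B \<in> carrier_mat n m"
    and "\<And>v. v \<in> carrier_vec m \<Longrightarrow> A *\<^sub>v v = B *\<^sub>v (v :: complex vec)"
  shows "A = B"
proof (rule eq_matI)
  fix i j assume "i < dim_row B" "j < dim_col B"
  then have ij: "i < n" "j < m" using assms by auto
  have "col A j = col B j"
    using assms(3)[of "unit_vec m j"] ij assms(1,2) by (simp add: mult_mat_unit_vec[of _ n])
  then show "A $$ (i, j) = B $$ (i, j)" using ij assms(1,2)
    by (metis carrier_matD(1) carrier_matD(2) index_col)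
qed (use assms in auto)

section \<open>Representations and Schur's lemma\<close>

lemma is_rep_carrier: "is_rep G n \<rho> \<Longrightarrow> g \<in> carrier G \<Longrightarrow> \<rho> g \<in> carrier_mat n n"
  by (auto simp: is_rep_def)

lemma is_rep_one: "is_rep G n \<rho> \<Longrightarrow> \<rho> \<one>\<^bsub>G\<^esub> = 1\<^sub>m n"
  by (auto simp: is_rep_def)

lemma is_rep_mult: "is_rep G n \<rho> \<Longrightarrow> g \<in> carrier G \<Longrightarrow> h \<in> carrier G \<Longrightarrow> \<rho> (g \<otimes>\<^bsub>G\<^esub> h) = \<rho> g * \<rho> h"
  by (auto simp: is_rep_def)

lemma irreducible_repD:
  "irreducible_rep G n \<rho> \<Longrightarrow> is_rep G n \<rho>" "irreducible_rep G n \<rho> \<Longrightarrow> n > 0"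
  by (auto simp: irreducible_rep_def)

text \<open>Kernel and image of an intertwiner are invariant, so a nonzero one is bijective, and its
  inverse conjugates one representation into the other. Traces do not see the conjugation.\<close>

lemma schur_equivalent:
  assumes \<rho>: "irreducible_rep G n \<rho>" and \<sigma>: "irreducible_rep G m \<sigma>"
    and A: "A \<in> carrier_mat n m" and comm: "\<And>g. g \<in> carrier G \<Longrightarrow> \<rho> g * A = A * \<sigma> g"
    and nz: "A \<noteq> 0\<^sub>m n m"
  shows "character G \<rho> = character G \<sigma>"
proof -
  note r = irreducible_repD(1)[OF \<rho>] irreducible_repD(1)[OF \<sigma>]
  have ex: "\<exists>v\<in>carrier_vec m. A *\<^sub>v v \<noteq> 0\<^sub>v n"
  proof (rule ccontr)
    assume "\<not> ?thesis"
    then have z: "A *\<^sub>v v = 0\<^sub>v n" if "v \<in> carrier_vec m" for v using that by blast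
    have "A *\<^sub>v v = 0\<^sub>m n m *\<^sub>v v" if "v \<in> carrier_vec m" for v
      unfolding z[OF that] by (rule eq_vecI) (use that in simp_all)
    then have "A = 0\<^sub>m n m" by (rule mat_eq_if_mult_vec_eq[OF A zero_carrier_mat])
    then show False using nz by simp
  qed
  let ?K = "{v \<in> carrier_vec m. A *\<^sub>v v = 0\<^sub>v n}"
  have "invariant_subspace G m \<sigma> ?K"
    unfolding invariant_subspace_def
  proof (intro conjI ballI allI)
    fix g v assume g: "g \<in> carrier G" and v: "v \<in> ?K"
    have s: "\<sigma> g \<in> carrier_mat m m" "\<rho> g \<in> carrier_mat n n" using is_rep_carrier[OF r(2) g] is_rep_carrier[OF r(1) g] .
    have "A *\<^sub>v (\<sigma> g *\<^sub>v v) = (\<rho> g * A) *\<^sub>v v"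
      using s v A comm[OF g] by (simp add: assoc_mult_mat_vec[of A n m])
    also have "\<dots> = \<rho> g *\<^sub>v (A *\<^sub>v v)" using v by (intro assoc_mult_mat_vec[OF s(2) A]) simp
    also have "\<dots> = 0\<^sub>v n" using v mult_mat_zero_vec[OF s(2)] by simp
    finally show "\<sigma> g *\<^sub>v v \<in> ?K" using s v by simp
  next
    show "?K \<subseteq> carrier_vec m" by blast
    show "0\<^sub>v m \<in> ?K" using mult_mat_zero_vec[OF A] by simp
  next
    fix v w assume "v \<in> ?K" "w \<in> ?K"
    then show "v + w \<in> ?K" by (simp add: mult_add_distrib_mat_vec[OF A])
  next
    fix c v assume "v \<in> ?K"
    then show "c \<cdot>\<^sub>v v \<in> ?K" by (simp add: mult_mat_vec[OF A] smult_zero_vec_right)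
  qed
  with \<sigma> ex have ker: "?K = {0\<^sub>v m}" unfolding irreducible_rep_def by blast
  let ?I = "(\<lambda>v. A *\<^sub>v v) ` carrier_vec m"
  have "invariant_subspace G n \<rho> ?I"
    unfolding invariant_subspace_def
  proof (intro conjI ballI allI)
    fix g w assume g: "g \<in> carrier G" and "w \<in> ?I"
    then obtain v where v: "v \<in> carrier_vec m" and w: "w = A *\<^sub>v v" by blast
    have s: "\<sigma> g \<in> carrier_mat m m" "\<rho> g \<in> carrier_mat n n" using is_rep_carrier[OF r(2) g] is_rep_carrier[OF r(1) g] .
    have "\<rho> g *\<^sub>v w = (\<rho> g * A) *\<^sub>v v" unfolding w using v by (intro assoc_mult_mat_vec[OF s(2) A, symmetric])
    also have "\<dots> = A *\<^sub>v (\<sigma> g *\<^sub>v v)" using s v A comm[OF g] by (simp add: assoc_mult_mat_vec[of A n m])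
    finally show "\<rho> g *\<^sub>v w \<in> ?I" using s v by auto
  next
    fix u w assume "u \<in> ?I" "w \<in> ?I"
    then obtain x y where "u = A *\<^sub>v x" "w = A *\<^sub>v y" and xy: "x \<in> carrier_vec m" "y \<in> carrier_vec m"
      by blast
    then have "u + w = A *\<^sub>v (x + y)" by (simp add: mult_add_distrib_mat_vec[OF A])
    then show "u + w \<in> ?I" using xy by simp
  next
    fix c w assume "w \<in> ?I"
    then obtain x where "w = A *\<^sub>v x" and x: "x \<in> carrier_vec m" by blast
    then have "c \<cdot>\<^sub>v w = A *\<^sub>v (c \<cdot>\<^sub>v x)" by (simp add: mult_mat_vec[OF A])
    then show "c \<cdot>\<^sub>v w \<in> ?I" using x by simp
  next
    show "0\<^sub>v n \<in> ?I" using mult_mat_zero_vec[OF A] by (metis imageI zero_carrier_vec)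
  qed (use A in auto)
  moreover have "?I \<noteq> {0\<^sub>v n}" using ex by blast
  ultimately have im: "?I = carrier_vec n" using \<rho> unfolding irreducible_rep_def by blast
  \<comment> \<open>Preimages of the unit vectors become the columns of a right inverse
    \<open>B\<close>; injectivity of \<open>A\<close> makes it two-sided without comparing
    \<open>n\<close> with \<open>m\<close>.\<close>
  have "\<exists>v\<in>carrier_vec m. A *\<^sub>v v = unit_vec n i" for i
    using im unit_vec_carrier[of n i] by (metis (no_types, lifting) image_iff)
  then obtain c where c: "\<And>i. c i \<in> carrier_vec m" "\<And>i. A *\<^sub>v c i = unit_vec n i" by metis
  define B where "B = mat m n (\<lambda>(j, i). c i $ j)"
  have B: "B \<in> carrier_mat m n" by (simp add: B_def)
  have colB: "col B i = c i" if "i < n" for i using that c(1)[of i] by (auto simp: B_def)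
  have AB: "A * B = 1\<^sub>m n"
  proof (rule eq_matI)
    fix i j assume "i < dim_row (1\<^sub>m n)" "j < dim_col (1\<^sub>m n)"
    then have ij: "i < n" "j < n" by auto
    have "(A * B) $$ (i, j) = (A *\<^sub>v c j) $ i" using ij A B colB by simp
    then show "(A * B) $$ (i, j) = 1\<^sub>m n $$ (i, j)" using ij c by simp
  qed (use A B in auto)
  have BA: "B * A = 1\<^sub>m m"
  proof (rule mat_eq_if_mult_vec_eq)
    fix v :: "complex vec" assume v: "v \<in> carrier_vec m"
    have "A *\<^sub>v ((B * A) *\<^sub>v v) = A *\<^sub>v v"
    proof -
      have "A *\<^sub>v ((B * A) *\<^sub>v v) = A *\<^sub>v (B *\<^sub>v (A *\<^sub>v v))" using A B v by (simp add: assoc_mult_mat_vec[of B m n])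
      also have "\<dots> = (A * B) *\<^sub>v (A *\<^sub>v v)" using A v by (intro assoc_mult_mat_vec[OF A B, symmetric]) simp
      finally show ?thesis using AB A v by simp
    qed
    then have "A *\<^sub>v ((B * A) *\<^sub>v v - v) = 0\<^sub>v n"
      using A B v by (simp add: mult_minus_distrib_mat_vec[OF A])
    then have "(B * A) *\<^sub>v v - v \<in> ?K" using A B v by auto
    then have z: "(B * A) *\<^sub>v v - v = 0\<^sub>v m" unfolding ker by simp
    have "(B * A) *\<^sub>v v = v"
    proof (rule eq_vecI)
      fix i assume i: "i < dim_vec v"
      then have "((B * A) *\<^sub>v v - v) $ i = 0" unfolding z using v by simp
      then show "((B * A) *\<^sub>v v) $ i = v $ i" using i A B v by (simp del: index_mult_mat_vec)
    qed (use A B v in auto)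
    then show "(B * A) *\<^sub>v v = 1\<^sub>m m *\<^sub>v v" using v by simp
  qed (use A B in auto)
  have "mat_trace (\<rho> g) = mat_trace (\<sigma> g)" if g: "g \<in> carrier G" for g
  proof -
    have s: "\<sigma> g \<in> carrier_mat m m" "\<rho> g \<in> carrier_mat n n" using is_rep_carrier[OF r(2) g] is_rep_carrier[OF r(1) g] .
    have "\<rho> g = \<rho> g * (A * B)" using AB s by simp
    also have "\<dots> = A * \<sigma> g * B" using assoc_mult_mat[OF s(2) A B] comm[OF g] by simp
    finally have "mat_trace (\<rho> g) = mat_trace (A * (\<sigma> g * B))" using assoc_mult_mat[OF A s(1) B] by simp
    also have "\<dots> = mat_trace (\<sigma> g * B * A)" using A B s by (intro mat_trace_mult_comm) auto
    also have "\<sigma> g * B * A = \<sigma> g" using assoc_mult_mat[OF s(1) B A] BA s by simp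
    finally show ?thesis .
  qed
  then show ?thesis by (auto simp: character_def)
qed

text \<open>The eigenspace of any eigenvalue is a nonzero invariant subspace, hence everything.
  Expressing the scalar by the trace lets it be computed for averages.\<close>

lemma schur_scalar:
  assumes \<rho>: "irreducible_rep G n \<rho>"
    and A: "A \<in> carrier_mat n n" and comm: "\<And>g. g \<in> carrier G \<Longrightarrow> \<rho> g * A = A * \<rho> g"
  shows "A = (mat_trace A / of_nat n) \<cdot>\<^sub>m 1\<^sub>m n"
proof -
  note r = irreducible_repD[OF \<rho>]
  obtain c where "c \<in> spectrum A" using spectrum_non_empty[OF A r(2)] by blast
  then obtain v0 where v0: "v0 \<in> carrier_vec n" "v0 \<noteq> 0\<^sub>v n" "A *\<^sub>v v0 = c \<cdot>\<^sub>v v0"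
    using A by (auto simp: spectrum_def eigenvalue_def eigenvector_def)
  let ?K = "{v \<in> carrier_vec n. A *\<^sub>v v = c \<cdot>\<^sub>v v}"
  have "invariant_subspace G n \<rho> ?K"
    unfolding invariant_subspace_def
  proof (intro conjI ballI allI)
    fix g v assume g: "g \<in> carrier G" and v: "v \<in> ?K"
    have s: "\<rho> g \<in> carrier_mat n n" using is_rep_carrier[OF r(1) g] .
    have "A *\<^sub>v (\<rho> g *\<^sub>v v) = (\<rho> g * A) *\<^sub>v v"
      using s v A comm[OF g] by (simp add: assoc_mult_mat_vec[of A n n])
    also have "\<dots> = \<rho> g *\<^sub>v (A *\<^sub>v v)" using v by (intro assoc_mult_mat_vec[OF s A]) simp
    also have "\<dots> = c \<cdot>\<^sub>v (\<rho> g *\<^sub>v v)" using v s by (simp add: mult_mat_vec[OF s])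
    finally show "\<rho> g *\<^sub>v v \<in> ?K" using s v by simp
  next
    show "?K \<subseteq> carrier_vec n" by blast
    show "0\<^sub>v n \<in> ?K" using mult_mat_zero_vec[OF A] by (simp add: smult_zero_vec_right)
  next
    fix v w assume "v \<in> ?K" "w \<in> ?K"
    then show "v + w \<in> ?K" by (simp add: mult_add_distrib_mat_vec[OF A] smult_add_distrib_vec[of _ n])
  next
    fix d v assume "v \<in> ?K"
    then show "d \<cdot>\<^sub>v v \<in> ?K" by (simp add: mult_mat_vec[OF A] smult_smult_assoc mult.commute)
  qed
  with \<rho> v0 have K: "?K = carrier_vec n" unfolding irreducible_rep_def by blast
  have Ac: "A = c \<cdot>\<^sub>m 1\<^sub>m n"
  proof (rule mat_eq_if_mult_vec_eq)
    fix v :: "complex vec" assume v: "v \<in> carrier_vec n"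
    then have "A *\<^sub>v v = c \<cdot>\<^sub>v v" using K by blast
    also have "\<dots> = (c \<cdot>\<^sub>m 1\<^sub>m n) *\<^sub>v v" 
      by (rule eq_vecI) (use v in \<open>auto simp: scalar_prod_def if_distrib[of "\<lambda>x. x * _"] if_distrib[of "\<lambda>x. _ * x"] cong: if_cong\<close>)
    finally show "A *\<^sub>v v = (c \<cdot>\<^sub>m 1\<^sub>m n) *\<^sub>v v" .
  qed (use A in auto)
  then have "mat_trace A = of_nat n * c" by (simp add: mat_trace_smult_one)
  then have "mat_trace A / of_nat n = c" using r(2) by simp
  then show ?thesis using Ac by simp
qed

section \<open>Orthogonality of irreducible characters\<close>

locale finite_group = group G for G :: "('a, 'b) monoid_scheme" (structure) +
  assumes fin: "finite (carrier G)"
begin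

abbreviation N :: nat where "N \<equiv> card (carrier G)"

lemma N_pos: "N > 0"
  using fin one_closed by (simp add: card_gt_0_iff) blast

lemma bij_betw_mult_left: "h \<in> carrier G \<Longrightarrow> bij_betw (\<lambda>g. h \<otimes> g) (carrier G) (carrier G)"
  by (rule bij_betw_byWitness[where f' = "\<lambda>g. inv h \<otimes> g"]) (auto simp: m_assoc[symmetric])

lemma bij_betw_conj: "h \<in> carrier G \<Longrightarrow> bij_betw (\<lambda>g. inv h \<otimes> g \<otimes> h) (carrier G) (carrier G)"
  by (rule bij_betw_byWitness[where f' = "\<lambda>g. h \<otimes> g \<otimes> inv h"])
    (auto simp: m_assoc, auto simp: m_assoc[symmetric])

lemma rep_inv_mult:
  assumes "is_rep G n \<rho>" "g \<in> carrier G"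
  shows "\<rho> (inv g) * \<rho> g = 1\<^sub>m n" "\<rho> g * \<rho> (inv g) = 1\<^sub>m n"
  using is_rep_mult[OF assms(1), of "inv g" g] is_rep_mult[OF assms(1), of g "inv g"] is_rep_one[OF assms(1)] assms(2)
  by simp_all

text \<open>Turns an arbitrary matrix into an intertwiner; left unnormalised, so the group order
  appears as a factor.\<close>

definition avg :: "nat \<Rightarrow> nat \<Rightarrow> ('a \<Rightarrow> complex mat) \<Rightarrow> ('a \<Rightarrow> complex mat) \<Rightarrow> complex mat \<Rightarrow> complex mat" where
  "avg n m \<rho> \<sigma> B = msum n m (\<lambda>g. \<rho> g * B * \<sigma> (inv g)) (carrier G)"

lemma avg_carrier: "avg n m \<rho> \<sigma> B \<in> carrier_mat n m"
  by (simp add: avg_def)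

lemma avg_intertwines:
  assumes \<rho>: "is_rep G n \<rho>" and \<sigma>: "is_rep G m \<sigma>" and B: "B \<in> carrier_mat n m" and h: "h \<in> carrier G"
  shows "\<rho> h * avg n m \<rho> \<sigma> B = avg n m \<rho> \<sigma> B * \<sigma> h"
proof -
  note R = is_rep_carrier[OF \<rho>] and S = is_rep_carrier[OF \<sigma>]
  have "\<rho> h * avg n m \<rho> \<sigma> B = msum n m (\<lambda>g. \<rho> h * (\<rho> g * B * \<sigma> (inv g))) (carrier G)"
    unfolding avg_def by (rule mult_msum[OF R[OF h]]) (intro mult_carrier_mat[OF mult_carrier_mat[OF R B] S] inv_closed)
  also have "\<dots> = msum n m (\<lambda>g. \<rho> (h \<otimes> g) * B * (\<sigma> (inv (h \<otimes> g)) * \<sigma> h)) (carrier G)"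
  proof (rule msum_cong)
    fix g assume g: "g \<in> carrier G"
    have c: "\<rho> g \<in> carrier_mat n n" "\<rho> h \<in> carrier_mat n n" "\<sigma> (inv g) \<in> carrier_mat m m"
      using R S g h by simp_all
    have "\<rho> h * (\<rho> g * B * \<sigma> (inv g)) = \<rho> h * (\<rho> g * B) * \<sigma> (inv g)"
      by (rule assoc_mult_mat[OF c(2) mult_carrier_mat[OF c(1) B] c(3), symmetric])
    moreover have "\<rho> h * (\<rho> g * B) = \<rho> (h \<otimes> g) * B"
      using assoc_mult_mat[OF c(2) c(1) B] is_rep_mult[OF \<rho> h g] by simp
    moreover have "\<sigma> (inv g) = \<sigma> (inv (h \<otimes> g)) * \<sigma> h"
      using is_rep_mult[OF \<sigma>, of "inv (h \<otimes> g)" h] g h by (simp add: inv_mult_group m_assoc)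
    ultimately show "\<rho> h * (\<rho> g * B * \<sigma> (inv g)) = \<rho> (h \<otimes> g) * B * (\<sigma> (inv (h \<otimes> g)) * \<sigma> h)"
      by argo
  qed
  also have "\<dots> = msum n m (\<lambda>g. \<rho> g * B * (\<sigma> (inv g) * \<sigma> h)) (carrier G)"
    by (rule msum_reindex_bij_betw[OF bij_betw_mult_left[OF h]])
  also have "\<dots> = msum n m (\<lambda>g. \<rho> g * B * \<sigma> (inv g) * \<sigma> h) (carrier G)"
    by (rule msum_cong) (rule assoc_mult_mat[OF mult_carrier_mat[OF R B] S S, symmetric]; simp add: h)
  also have "\<dots> = avg n m \<rho> \<sigma> B * \<sigma> h"
    unfolding avg_def by (rule msum_mult[OF S[OF h], symmetric]) (intro mult_carrier_mat[OF mult_carrier_mat[OF R B] S] inv_closed)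
  finally show ?thesis .
qed

lemma avg_trace:
  assumes \<rho>: "is_rep G n \<rho>" and B: "B \<in> carrier_mat n n"
  shows "mat_trace (avg n n \<rho> \<rho> B) = of_nat N * mat_trace B"
proof -
  note R = is_rep_carrier[OF \<rho>]
  have "mat_trace (\<rho> g * B * \<rho> (inv g)) = mat_trace B" if g: "g \<in> carrier G" for g
  proof -
    have c: "\<rho> g \<in> carrier_mat n n" "\<rho> (inv g) \<in> carrier_mat n n" using R g by simp_all
    have "mat_trace (\<rho> g * B * \<rho> (inv g)) = mat_trace (\<rho> (inv g) * (\<rho> g * B))"
      by (rule mat_trace_mult_comm[OF mult_carrier_mat[OF c(1) B] c(2)])
    also have "\<rho> (inv g) * (\<rho> g * B) = B"
      using assoc_mult_mat[OF c(2) c(1) B] rep_inv_mult[OF \<rho> g] B by simp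
    finally show ?thesis .
  qed
  then show ?thesis unfolding avg_def
    by (subst mat_trace_msum) (auto intro!: mult_carrier_mat[OF mult_carrier_mat[OF R B] R])
qed

lemma avg_scalar:
  assumes \<rho>: "irreducible_rep G n \<rho>" and B: "B \<in> carrier_mat n n"
  shows "avg n n \<rho> \<rho> B = (of_nat N * mat_trace B / of_nat n) \<cdot>\<^sub>m 1\<^sub>m n"
  using schur_scalar[OF \<rho> avg_carrier avg_intertwines[OF irreducible_repD(1)[OF \<rho>] irreducible_repD(1)[OF \<rho>] B]]
  by (simp add: avg_trace[OF irreducible_repD(1)[OF \<rho>] B])

lemma avg_zero:
  assumes \<rho>: "irreducible_rep G n \<rho>" and \<sigma>: "irreducible_rep G m \<sigma>" and B: "B \<in> carrier_mat n m"
    and "character G \<rho> \<noteq> character G \<sigma>"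
  shows "avg n m \<rho> \<sigma> B = 0\<^sub>m n m"
  using schur_equivalent[OF \<rho> \<sigma> avg_carrier avg_intertwines[OF irreducible_repD(1)[OF \<rho>] irreducible_repD(1)[OF \<sigma>] B]] assms(4)
  by blast

definition unit_mat :: "nat \<Rightarrow> nat \<Rightarrow> nat \<Rightarrow> nat \<Rightarrow> complex mat" where
  "unit_mat n m j k = mat n m (\<lambda>(a, b). if a = j \<and> b = k then 1 else 0)"

text \<open>Averaging a matrix unit isolates a sum of products of two matrix coefficients;
  evaluating the average by Schur's lemma then gives Schur's relations.\<close>

lemma avg_unit_index:
  assumes \<rho>: "is_rep G n \<rho>" and \<sigma>: "is_rep G m \<sigma>" and ij: "i < n" "j < n" "k < m" "l < m"
  shows "avg n m \<rho> \<sigma> (unit_mat n m j k) $$ (i, l) = (\<Sum>g\<in>carrier G. \<rho> g $$ (i, j) * \<sigma> (inv g) $$ (k, l))"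
proof -
  note R = is_rep_carrier[OF \<rho>] and S = is_rep_carrier[OF \<sigma>]
  have E: "unit_mat n m j k \<in> carrier_mat n m" by (simp add: unit_mat_def)
  have "(\<rho> g * unit_mat n m j k * \<sigma> (inv g)) $$ (i, l) = \<rho> g $$ (i, j) * \<sigma> (inv g) $$ (k, l)"
    if g: "g \<in> carrier G" for g
  proof -
    have c: "\<rho> g \<in> carrier_mat n n" "\<sigma> (inv g) \<in> carrier_mat m m" using R S g by simp_all
    have "(\<rho> g * unit_mat n m j k) $$ (i, b) = (if b = k then \<rho> g $$ (i, j) else 0)" if "b < m" for b
      unfolding mat_mult_index[OF c(1) E ij(1) that] using that ij
      by (cases "b = k") (simp_all add: unit_mat_def if_distrib cong: if_cong)
    then show ?thesis
      unfolding mat_mult_index[OF mult_carrier_mat[OF c(1) E] c(2) ij(1,4)] using ij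
      by (simp add: if_distrib[where f = "\<lambda>x. x * _"] cong: if_cong)
  qed
  then show ?thesis unfolding avg_def using ij by (simp add: msum_index)
qed

lemma Irr_iff: "\<chi> \<in> Irr G \<longleftrightarrow> (\<exists>\<rho> n. irreducible_rep G n \<rho> \<and> \<chi> = character G \<rho>)"
  by (auto simp: Irr_def)

lemma character_eq_sum:
  "is_rep G n \<rho> \<Longrightarrow> g \<in> carrier G \<Longrightarrow> character G \<rho> g = (\<Sum>i<n. \<rho> g $$ (i, i))"
  using is_rep_carrier[of G n \<rho> g] by (simp add: character_def mat_trace_def)

lemma character_one: "is_rep G n \<rho> \<Longrightarrow> character G \<rho> \<one> = of_nat n"
  by (simp add: character_eq_sum is_rep_one)

text \<open>The form is bilinear, with \<open>\<psi> (inv g)\<close> where a complex conjugate is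
  customary, which suits arbitrary matrix representations. Expanding traces into matrix coefficients
  reduces it to averages of matrix units.\<close>

lemma Irr_orthogonal:
  assumes "\<chi> \<in> Irr G" "\<psi> \<in> Irr G"
  shows "(\<Sum>g\<in>carrier G. \<chi> g * \<psi> (inv g)) = (if \<chi> = \<psi> then of_nat N else 0)"
proof -
  obtain \<rho> n where \<rho>: "irreducible_rep G n \<rho>" and \<chi>: "\<chi> = character G \<rho>" using assms Irr_iff by blast
  \<comment> \<open>A character may come from several matrix representations; if the characters
    agree, the same one is taken for both, so that the scalar form of the average applies.\<close>
  obtain \<sigma> m where \<sigma>: "irreducible_rep G m \<sigma>" and \<psi>: "\<psi> = character G \<sigma>" and same: "\<chi> = \<psi> \<longrightarrow> \<sigma> = \<rho> \<and> m = n"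
    using assms Irr_iff \<rho> \<chi> by (cases "\<chi> = \<psi>") blast+
  note r = irreducible_repD(1)[OF \<rho>] irreducible_repD(1)[OF \<sigma>]
  have "(\<Sum>g\<in>carrier G. \<chi> g * \<psi> (inv g)) =
      (\<Sum>g\<in>carrier G. \<Sum>i<n. \<Sum>k<m. \<rho> g $$ (i, i) * \<sigma> (inv g) $$ (k, k))"
    unfolding \<chi> \<psi> by (intro sum.cong refl) (simp add: character_eq_sum[OF r(1)] character_eq_sum[OF r(2)] sum_product)
  also have "\<dots> = (\<Sum>i<n. \<Sum>k<m. \<Sum>g\<in>carrier G. \<rho> g $$ (i, i) * \<sigma> (inv g) $$ (k, k))"
    by (subst sum.swap, rule sum.cong[OF refl], rule sum.swap)
  also have "\<dots> = (\<Sum>i<n. \<Sum>k<m. avg n m \<rho> \<sigma> (unit_mat n m i k) $$ (i, k))"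
    by (intro sum.cong refl) (simp add: avg_unit_index[OF r])
  also have "\<dots> = (if \<chi> = \<psi> then of_nat N else 0)"
  proof (cases "\<chi> = \<psi>")
    case False
    have "avg n m \<rho> \<sigma> (unit_mat n m i k) = 0\<^sub>m n m" for i k
      by (rule avg_zero[OF \<rho> \<sigma>]) (use False \<chi> \<psi> in \<open>simp_all add: unit_mat_def\<close>)
    then show ?thesis using False by simp
  next
    case True
    with same have s: "\<sigma> = \<rho>" "m = n" by simp_all
    have t: "mat_trace (unit_mat n n i k) = (if i = k then 1 else 0)" if "i < n" "k < n" for i k
      using that by (auto simp: mat_trace_def unit_mat_def)
    have a: "avg n n \<rho> \<rho> (unit_mat n n i k) $$ (i, k) = (if i = k then of_nat N / of_nat n else 0)" if "i < n" "k < n" for i k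
      using that by (subst avg_scalar[OF \<rho>]) (simp_all add: unit_mat_def[of n n i k] t[unfolded unit_mat_def])
    have "(\<Sum>i<n. \<Sum>k<n. avg n n \<rho> \<rho> (unit_mat n n i k) $$ (i, k)) = (\<Sum>i<n. of_nat N / of_nat n)"
      by (intro sum.cong refl) (simp add: a)
    also have "\<dots> = of_nat N" using irreducible_repD(2)[OF \<rho>] by simp
    finally show ?thesis using s True by simp
  qed
  finally show ?thesis .
qed

lemma character_conj:
  assumes \<rho>: "is_rep G n \<rho>" and g: "g \<in> carrier G" and h: "h \<in> carrier G"
  shows "character G \<rho> (inv h \<otimes> g \<otimes> h) = character G \<rho> g"
proof -
  have c: "\<rho> g \<in> carrier_mat n n" "\<rho> h \<in> carrier_mat n n" "\<rho> (inv h) \<in> carrier_mat n n"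
    using is_rep_carrier[OF \<rho>] g h by simp_all
  have "\<rho> (inv h \<otimes> g \<otimes> h) = \<rho> (inv h) * \<rho> g * \<rho> h" using is_rep_mult[OF \<rho>] g h by simp
  then have "mat_trace (\<rho> (inv h \<otimes> g \<otimes> h)) = mat_trace (\<rho> h * (\<rho> (inv h) * \<rho> g))"
    using mat_trace_mult_comm[OF mult_carrier_mat[OF c(3) c(1)] c(2)] by simp
  also have "\<rho> h * (\<rho> (inv h) * \<rho> g) = \<rho> g"
    using assoc_mult_mat[OF c(2) c(3) c(1)] rep_inv_mult[OF \<rho> h] c by simp
  finally show ?thesis using g h by (simp add: character_def)
qed

lemma Irr_conj: "\<chi> \<in> Irr G \<Longrightarrow> g \<in> carrier G \<Longrightarrow> h \<in> carrier G \<Longrightarrow> \<chi> (inv h \<otimes> g \<otimes> h) = \<chi> g"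
  using character_conj irreducible_repD(1) unfolding Irr_iff by blast

lemma Irr_one: 
  assumes "\<chi> \<in> Irr G" obtains n where "n > 0" "\<chi> \<one> = of_nat n"
  using assms character_one irreducible_repD unfolding Irr_iff by blast

lemma Irr_eq_0: "\<chi> \<in> Irr G \<Longrightarrow> g \<notin> carrier G \<Longrightarrow> \<chi> g = 0"
  by (auto simp: Irr_iff character_def)

text \<open>The sum of \<open>\<rho> y\<close> over all its conjugates is the scalar
  \<open>N \<chi>(y) / n\<close>; multiplying by \<open>\<rho> x\<close> and taking traces gives the
  identity. It expresses multiplicativity of the central character with denominators cleared, the
  form in which it can be transferred along \<open>zeta \<mapsto> zeta ^ k\<close>.\<close>

lemma Irr_product_formula:
  assumes "\<chi> \<in> Irr G" "x \<in> carrier G" "y \<in> carrier G"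
  shows "of_nat N * \<chi> x * \<chi> y = \<chi> \<one> * (\<Sum>h\<in>carrier G. \<chi> (x \<otimes> (h \<otimes> y \<otimes> inv h)))"
proof -
  obtain \<rho> n where \<rho>: "irreducible_rep G n \<rho>" and \<chi>: "\<chi> = character G \<rho>" using assms Irr_iff by blast
  note r = irreducible_repD(1)[OF \<rho>] and R = is_rep_carrier[OF irreducible_repD(1)[OF \<rho>]]
  have c: "\<rho> x \<in> carrier_mat n n" "\<rho> y \<in> carrier_mat n n" using R assms by simp_all
  have "\<chi> (x \<otimes> (h \<otimes> y \<otimes> inv h)) = mat_trace (\<rho> x * (\<rho> h * \<rho> y * \<rho> (inv h)))" if "h \<in> carrier G" for h
    using that assms(2,3) unfolding \<chi> by (simp add: character_def is_rep_mult[OF r])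
  then have "(\<Sum>h\<in>carrier G. \<chi> (x \<otimes> (h \<otimes> y \<otimes> inv h))) =
      (\<Sum>h\<in>carrier G. mat_trace (\<rho> x * (\<rho> h * \<rho> y * \<rho> (inv h))))" by simp
  also have "\<dots> = mat_trace (msum n n (\<lambda>h. \<rho> x * (\<rho> h * \<rho> y * \<rho> (inv h))) (carrier G))"
    by (rule mat_trace_msum[symmetric]) (intro mult_carrier_mat[OF c(1) mult_carrier_mat[OF mult_carrier_mat[OF R c(2)] R]] inv_closed)
  also have "msum n n (\<lambda>h. \<rho> x * (\<rho> h * \<rho> y * \<rho> (inv h))) (carrier G) = \<rho> x * avg n n \<rho> \<rho> (\<rho> y)"
    unfolding avg_def by (rule mult_msum[OF c(1), symmetric]) (intro mult_carrier_mat[OF mult_carrier_mat[OF R c(2)] R] inv_closed)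
  also have "\<dots> = (of_nat N * mat_trace (\<rho> y) / of_nat n) \<cdot>\<^sub>m \<rho> x"
    unfolding avg_scalar[OF \<rho> c(2)] using c(1) by (simp add: mult_smult_distrib[OF c(1) one_carrier_mat])
  also have "mat_trace \<dots> = (of_nat N * mat_trace (\<rho> y) / of_nat n) * mat_trace (\<rho> x)"
    by (rule mat_trace_smult[OF c(1)])
  finally show ?thesis
    using irreducible_repD(2)[OF \<rho>] assms(2,3) character_one[OF r] unfolding \<chi> by (simp add: character_def)
qed

end

section \<open>Decomposition of representations\<close>

text \<open>Vectors of dimension \<open>n\<close> are modelled as functions vanishing from
  \<open>n\<close> on, so that spans and bases are available in a fixed vector space.\<close>

interpretation fn: vector_space "\<lambda>(c :: complex) (f :: nat \<Rightarrow> complex) i. c * f i"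
  by unfold_locales (auto simp: fun_eq_iff algebra_simps)

lemma sum_fun_apply: "(\<Sum>x\<in>A. F x) i = (\<Sum>x\<in>A. F x i)" for F :: "_ \<Rightarrow> nat \<Rightarrow> complex"
  by (induction A rule: infinite_finite_induct) auto

text \<open>The columns of \<open>P\<close> are a basis of the whole space whose first
  \<open>m\<close> members span \<open>W\<close>, and \<open>Q\<close> reads off coordinates.
  Together with \<open>0 < m < k\<close>, the bound \<open>k \<le> n\<close> makes both diagonal
  blocks smaller than \<open>n\<close> in the later induction.\<close>

lemma subspace_adapted_basis:
  fixes W :: "complex vec set"
  assumes W: "W \<subseteq> carrier_vec n" "0\<^sub>v n \<in> W" "W \<noteq> {0\<^sub>v n}" "W \<noteq> carrier_vec n"
    and add: "\<And>v w. v \<in> W \<Longrightarrow> w \<in> W \<Longrightarrow> v + w \<in> W"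
    and smult: "\<And>c v. v \<in> W \<Longrightarrow> c \<cdot>\<^sub>v v \<in> W"
  obtains P Q m k where "P \<in> carrier_mat n k" "Q \<in> carrier_mat k n" "P * Q = 1\<^sub>m n" "Q * P = 1\<^sub>m k"
    "0 < m" "m < k" "k \<le> n" "\<And>j. j < m \<Longrightarrow> col P j \<in> W"
    "\<And>w i. w \<in> W \<Longrightarrow> m \<le> i \<Longrightarrow> i < k \<Longrightarrow> (Q *\<^sub>v w) $ i = 0"
proof -
  define \<phi> where "\<phi> v = (\<lambda>i. if i < n then v $ i else 0)" for v :: "complex vec"
  define e where "e l = (\<lambda>i. if i = l then 1 else 0 :: complex)" for l :: nat
  define V where "V = \<phi> ` carrier_vec n"
  define W' where "W' = \<phi> ` W"
  have \<phi>_inj: "v = w" if "v \<in> carrier_vec n" "w \<in> carrier_vec n" "\<phi> v = \<phi> w" for v w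
  proof (rule eq_vecI)
    fix i assume "i < dim_vec w"
    then show "v $ i = w $ i" using that(1,2) fun_cong[OF that(3)[unfolded \<phi>_def], of i] by simp
  qed (use that in simp)
  have \<phi>_add: "\<phi> (v + w) = \<phi> v + \<phi> w" if "v \<in> carrier_vec n" "w \<in> carrier_vec n" for v w
    using that by (auto simp: \<phi>_def fun_eq_iff)
  have \<phi>_smult: "\<phi> (c \<cdot>\<^sub>v v) = (\<lambda>i. c * \<phi> v i)" if "v \<in> carrier_vec n" for c v
    using that by (auto simp: \<phi>_def fun_eq_iff)
  have \<phi>_zero: "\<phi> (0\<^sub>v n) = 0" by (auto simp: \<phi>_def fun_eq_iff)
  have V_iff: "f \<in> V \<longleftrightarrow> (\<forall>i\<ge>n. f i = 0)" for f
  proof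
    assume "\<forall>i\<ge>n. f i = 0"
    then have "f = \<phi> (vec n f)" by (auto simp: \<phi>_def fun_eq_iff)
    then show "f \<in> V" unfolding V_def by (rule image_eqI) simp
  qed (auto simp: V_def \<phi>_def)
  have W'V: "W' \<subseteq> V" unfolding W'_def V_def by (rule image_mono[OF W(1)])
  have sub: "fn.subspace W'"
    unfolding fn.subspace_def W'_def
  proof (intro conjI ballI allI)
    show "0 \<in> \<phi> ` W" using imageI[OF W(2), of \<phi>] unfolding \<phi>_zero .
    fix x y assume "x \<in> \<phi> ` W" "y \<in> \<phi> ` W"
    then obtain v w where vw: "v \<in> W" "w \<in> W" and xy: "x = \<phi> v" "y = \<phi> w" by blast
    have "v \<in> carrier_vec n" "w \<in> carrier_vec n" using vw W(1) by blast+
    then have "x + y = \<phi> (v + w)" unfolding xy by (rule \<phi>_add[symmetric])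
    then show "x + y \<in> \<phi> ` W" using imageI[OF add[OF vw], of \<phi>] by simp
  next
    fix c x assume "x \<in> \<phi> ` W"
    then obtain v where v: "v \<in> W" and x: "x = \<phi> v" by blast
    have "v \<in> carrier_vec n" using v W(1) by blast
    then have "(\<lambda>i. c * x i) = \<phi> (c \<cdot>\<^sub>v v)" unfolding x by (rule \<phi>_smult[symmetric])
    then show "(\<lambda>i. c * x i) \<in> \<phi> ` W" using imageI[OF smult[OF v], of \<phi> c] by simp
  qed
  obtain B where B: "B \<subseteq> W'" "fn.independent B" "W' \<subseteq> fn.span B"
    by (rule fn.maximal_independent_subset[of W'])
  obtain B' where B': "B \<subseteq> B'" "B' \<subseteq> V" "fn.independent B'" "V \<subseteq> fn.span B'"
    by (rule fn.maximal_independent_subset_extend[OF order_trans[OF B(1) W'V] B(2)])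
  have spanB: "fn.span B = W'" using B sub by (simp add: fn.span_subspace)
  have V_sum: "f = (\<Sum>l<n. (\<lambda>i. f l * e l i))" if "f \<in> V" for f
    using that by (auto simp: fun_eq_iff sum_fun_apply e_def V_iff not_less if_distrib cong: if_cong)
  have "V \<subseteq> fn.span (e ` {..<n})"
  proof
    fix f assume "f \<in> V"
    have "(\<Sum>l<n. (\<lambda>i. f l * e l i)) \<in> fn.span (e ` {..<n})"
      by (intro fn.span_sum fn.span_scale fn.span_base) auto
    then show "f \<in> fn.span (e ` {..<n})" using V_sum[OF \<open>f \<in> V\<close>] by simp
  qed
  then have bound: "finite B' \<and> card B' \<le> card (e ` {..<n})"
    using B' by (intro fn.independent_span_bound) auto
  have finB': "finite B'" using bound by simp
  have finB: "finite B" using finB' B'(1) finite_subset by blast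
  obtain xs where xs: "set xs = B" "distinct xs" using finite_distinct_list[OF finB] by blast
  obtain ys where ys: "set ys = B' - B" "distinct ys" using finite_distinct_list[of "B' - B"] finB' by blast
  define bs where "bs = xs @ ys"
  define m where "m = length xs"
  define k where "k = length bs"
  have bs: "distinct bs" "set bs = B'" using xs ys B'(1) by (auto simp: bs_def)
  have bij: "bij_betw ((!) bs) {..<k} B'" using bs by (simp add: bij_betw_nth k_def)
  have bij1: "bij_betw ((!) xs) {..<m} B" using xs by (simp add: bij_betw_nth m_def)
  have bsxs: "bs ! i = xs ! i" if "i < m" for i using that by (simp add: bs_def m_def nth_append)
  have mk: "m \<le> k" by (simp add: m_def k_def bs_def)
  have kn: "k \<le> n" using bound card_image_le[of "{..<n}" e] bij_betw_same_card[OF bij] by simp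
  have B_nth: "xs ! j \<in> W'" if "j < m" for j using that B(1) xs by (auto simp: m_def)
  have B'_V: "bs ! j \<in> V" if "j < k" for j using that B'(2) bs by (auto simp: k_def)
  have m0: "0 < m"
  proof (rule ccontr)
    assume "\<not> 0 < m"
    then have "B = {}" using xs by (simp add: m_def)
    then have W0: "W' = {0}" using spanB by simp
    have "w = 0\<^sub>v n" if "w \<in> W" for w
    proof (rule \<phi>_inj)
      show "\<phi> w = \<phi> (0\<^sub>v n)" using W0 that unfolding W'_def \<phi>_zero by blast
    qed (use that W in auto)
    then show False using W by blast
  qed
  have mk': "m < k"
  proof (rule ccontr)
    assume "\<not> m < k"
    then have "ys = []" by (simp add: m_def k_def bs_def)
    then have "B' = B" using ys B'(1) by auto
    then have VW: "V \<subseteq> W'" using B'(4) spanB by simp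
    have "v \<in> W" if v: "v \<in> carrier_vec n" for v
    proof -
      obtain w where "w \<in> W" "\<phi> v = \<phi> w" using VW v unfolding V_def W'_def by blast
      then show ?thesis using \<phi>_inj[of v w] v W(1) by auto
    qed
    then show False using W by blast
  qed
  define P where "P = mat n k (\<lambda>(i, j). (bs ! j) i)"
  \<comment> \<open>Column \<open>i\<close> of \<open>Q\<close> holds the coordinates of the
    \<open>i\<close>-th unit vector.\<close>
  define Q where "Q = mat k n (\<lambda>(j, i). fn.representation B' (e i) (bs ! j))"
  have P: "P \<in> carrier_mat n k" and Q: "Q \<in> carrier_mat k n" by (simp_all add: P_def Q_def)
  have eV: "e i \<in> V" if "i < n" for i using that by (auto simp: V_iff e_def)
  have rep_sum: "(\<Sum>j<k. fn.representation B' f (bs ! j) * (bs ! j) i) = f i" if "f \<in> V" for f i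
  proof -
    have "(\<Sum>j<k. fn.representation B' f (bs ! j) * (bs ! j) i) = (\<Sum>b\<in>B'. fn.representation B' f b * b i)"
      by (rule sum.reindex_bij_betw[OF bij])
    also have "\<dots> = (\<Sum>b\<in>B'. (\<lambda>i. fn.representation B' f b * b i)) i" by (simp add: sum_fun_apply)
    also have "(\<Sum>b\<in>B'. (\<lambda>i. fn.representation B' f b * b i)) = f"
      using B'(3,4) that finB' by (intro fn.sum_representation_eq) auto
    finally show ?thesis .
  qed
  have PQ: "P * Q = 1\<^sub>m n"
  proof (rule eq_matI)
    fix i l assume "i < dim_row (1\<^sub>m n)" "l < dim_col (1\<^sub>m n)"
    then have il: "i < n" "l < n" by auto
    have "(P * Q) $$ (i, l) = (\<Sum>j<k. fn.representation B' (e l) (bs ! j) * (bs ! j) i)"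
      unfolding mat_mult_index[OF P Q il] using il by (intro sum.cong) (auto simp: P_def Q_def)
    also have "\<dots> = e l i" by (rule rep_sum[OF eV[OF il(2)]])
    finally show "(P * Q) $$ (i, l) = 1\<^sub>m n $$ (i, l)" using il by (simp add: e_def)
  qed (use P Q in auto)
  have QP: "Q * P = 1\<^sub>m k"
  proof (rule eq_matI)
    fix i l assume "i < dim_row (1\<^sub>m k)" "l < dim_col (1\<^sub>m k)"
    then have il: "i < k" "l < k" by auto
    have b: "bs ! l \<in> B'" "bs ! i \<in> B'" using il bs by (auto simp: k_def)
    have "(Q * P) $$ (i, l) = (\<Sum>j<n. (bs ! l) j * fn.representation B' (e j) (bs ! i))"
      unfolding mat_mult_index[OF Q P il] using il by (intro sum.cong) (auto simp: P_def Q_def)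
    also have "\<dots> = (\<Sum>j<n. fn.representation B' (\<lambda>i. (bs ! l) j * e j i) (bs ! i))"
      using eV B'(3,4) by (intro sum.cong refl) (subst fn.representation_scale; auto)
    also have "\<dots> = fn.representation B' (\<Sum>j<n. (\<lambda>i. (bs ! l) j * e j i)) (bs ! i)"
    proof (subst fn.representation_sum)
      show "(\<lambda>i. (bs ! l) j * e j i) \<in> fn.span B'" if "j \<in> {..<n}" for j
        using that eV B'(4) by (intro fn.span_scale) auto
    qed (use B'(3) in auto)
    also have "\<dots> = fn.representation B' (bs ! l) (bs ! i)" using V_sum[OF B'_V[OF il(2)]] by simp
    also have "\<dots> = (if i = l then 1 else 0)"
      using fn.representation_basis[OF B'(3) b(1)] nth_eq_iff_index_eq[OF bs(1)] il by (simp add: k_def)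
    finally show "(Q * P) $$ (i, l) = 1\<^sub>m k $$ (i, l)" using il by simp
  qed (use P Q in auto)
  have \<phi>_col: "\<phi> (col P j) = bs ! j" if "j < k" for j
    using that B'_V[OF that] P by (auto simp: \<phi>_def fun_eq_iff P_def V_iff)
  have colW: "col P j \<in> W" if j: "j < m" for j
  proof -
    obtain w where w: "w \<in> W" "bs ! j = \<phi> w" using B_nth[OF j] bsxs[OF j] by (auto simp: W'_def)
    have "col P j = w"
      using w j mk W(1) \<phi>_col[of j] P by (intro \<phi>_inj) (auto intro: carrier_vecI)
    then show ?thesis using w by simp
  qed
  have zero: "(Q *\<^sub>v w) $ i = 0" if w: "w \<in> W" and i: "m \<le> i" "i < k" for w i
  proof -
    have wc: "w \<in> carrier_vec n" using w W(1) by blast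
    have "\<phi> w \<in> fn.span B" using spanB w by (auto simp: W'_def)
    then obtain u where u: "\<phi> w = (\<Sum>b\<in>B. (\<lambda>i. u b * b i))" using fn.span_finite[OF finB] by auto
    \<comment> \<open>Coordinates of \<open>w\<close>, padded by zeros: a vector of \<open>W\<close>
      involves only the first \<open>m\<close> basis vectors. From \<open>P *v c = w\<close>,
      multiplication by \<open>Q\<close> recovers \<open>c\<close>.\<close>
    define c where "c = vec k (\<lambda>i. if i < m then u (bs ! i) else 0)"
    have c: "c \<in> carrier_vec k" by (simp add: c_def)
    have "P *\<^sub>v c = w"
    proof (rule eq_vecI)
      fix l assume "l < dim_vec w"
      then have l: "l < n" using wc by simp
      have "(P *\<^sub>v c) $ l = (\<Sum>i<k. (bs ! i) l * (if i < m then u (bs ! i) else 0))"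
        using l P by (auto simp: scalar_prod_def c_def P_def atLeast0LessThan intro!: sum.cong)
      also have "\<dots> = (\<Sum>i<m. (bs ! i) l * (if i < m then u (bs ! i) else 0))"
        using mk by (intro sum.mono_neutral_right) auto
      also have "\<dots> = (\<Sum>i<m. u (xs ! i) * (xs ! i) l)" using bsxs by (intro sum.cong) auto
      also have "\<dots> = (\<Sum>b\<in>B. u b * b l)" by (rule sum.reindex_bij_betw[OF bij1])
      also have "\<dots> = \<phi> w l" unfolding u by (simp add: sum_fun_apply)
      finally show "(P *\<^sub>v c) $ l = w $ l" using l by (simp add: \<phi>_def)
    qed (use P wc in auto)
    then have "Q *\<^sub>v w = (Q * P) *\<^sub>v c" using assoc_mult_mat_vec[OF Q P c] by simp
    also have "\<dots> = c" using QP c by simp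
    finally show ?thesis using i by (simp add: c_def)
  qed
  show ?thesis by (rule that[OF P Q PQ QP m0 mk' kn colW zero])
qed

text \<open>The zero block makes the two diagonal blocks multiply separately: \<open>\<rho>1\<close>
  is the subrepresentation and \<open>\<rho>2\<close> the quotient. Their traces add up whatever the
  off-diagonal block is.\<close>

lemma is_rep_blocks:
  assumes \<tau>: "is_rep G k \<tau>" and mk: "m \<le> k" and G: "group G"
    and z': "\<forall>g\<in>carrier G. \<forall>i j. m \<le> i \<longrightarrow> i < k \<longrightarrow> j < m \<longrightarrow> \<tau> g $$ (i, j) = 0"
  defines "\<rho>1 \<equiv> \<lambda>g. mat m m (\<lambda>(i, j). \<tau> g $$ (i, j))"
    and "\<rho>2 \<equiv> \<lambda>g. mat (k - m) (k - m) (\<lambda>(i, j). \<tau> g $$ (m + i, m + j))"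
  shows "is_rep G m \<rho>1" "is_rep G (k - m) \<rho>2"
    "g \<in> carrier G \<Longrightarrow> character G \<tau> g = character G \<rho>1 g + character G \<rho>2 g"
proof -
  interpret group G by (rule G)
  have z: "\<tau> g $$ (i, j) = 0" if "g \<in> carrier G" "m \<le> i" "i < k" "j < m" for g i j
    using z' that by blast
  have split: "(\<Sum>l<k. f l) = (\<Sum>l<m. f l) + (\<Sum>l<k - m. f (m + l))" for f :: "nat \<Rightarrow> complex"
  proof -
    have "{..<k} = {..<m} \<union> {m..<k}" using mk by auto
    then have "(\<Sum>l<k. f l) = (\<Sum>l<m. f l) + (\<Sum>l\<in>{m..<k}. f l)" by (simp add: sum.union_disjoint ivl_disj_int)
    also have "(\<Sum>l\<in>{m..<k}. f l) = (\<Sum>l<k - m. f (m + l))"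
      by (rule sum.reindex_bij_witness[of _ "\<lambda>l. m + l" "\<lambda>l. l - m"]) auto
    finally show ?thesis .
  qed
  have T: "\<tau> g \<in> carrier_mat k k" if "g \<in> carrier G" for g using is_rep_carrier[OF \<tau> that] .
  have mult: "\<tau> (g \<otimes>\<^bsub>G\<^esub> h) $$ (i, j) = (\<Sum>l<m. \<tau> g $$ (i, l) * \<tau> h $$ (l, j)) + (\<Sum>l<k - m. \<tau> g $$ (i, m + l) * \<tau> h $$ (m + l, j))"
    if "g \<in> carrier G" "h \<in> carrier G" "i < k" "j < k" for g h i j
    unfolding is_rep_mult[OF \<tau> that(1,2)] mat_mult_index[OF T[OF that(1)] T[OF that(2)] that(3,4)] by (rule split)
  show "is_rep G m \<rho>1"
    unfolding is_rep_def
  proof (intro conjI ballI)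
    show "\<rho>1 \<one>\<^bsub>G\<^esub> = 1\<^sub>m m" using mk by (intro eq_matI) (auto simp: \<rho>1_def is_rep_one[OF \<tau>])
    fix g h assume gh: "g \<in> carrier G" "h \<in> carrier G"
    have c: "\<rho>1 g \<in> carrier_mat m m" "\<rho>1 h \<in> carrier_mat m m" by (simp_all add: \<rho>1_def)
    show "\<rho>1 (g \<otimes>\<^bsub>G\<^esub> h) = \<rho>1 g * \<rho>1 h"
    proof (rule eq_matI)
      fix i j assume "i < dim_row (\<rho>1 g * \<rho>1 h)" "j < dim_col (\<rho>1 g * \<rho>1 h)"
      then have ij: "i < m" "j < m" by (auto simp: \<rho>1_def)
      show "\<rho>1 (g \<otimes>\<^bsub>G\<^esub> h) $$ (i, j) = (\<rho>1 g * \<rho>1 h) $$ (i, j)"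
        unfolding mat_mult_index[OF c ij] using ij mk z[OF gh(2)] by (simp add: \<rho>1_def mult[OF gh])
    qed (simp_all add: \<rho>1_def)
  qed (simp add: \<rho>1_def)
  show "is_rep G (k - m) \<rho>2"
    unfolding is_rep_def
  proof (intro conjI ballI)
    show "\<rho>2 \<one>\<^bsub>G\<^esub> = 1\<^sub>m (k - m)" using mk by (intro eq_matI) (auto simp: \<rho>2_def is_rep_one[OF \<tau>])
    fix g h assume gh: "g \<in> carrier G" "h \<in> carrier G"
    have c: "\<rho>2 g \<in> carrier_mat (k - m) (k - m)" "\<rho>2 h \<in> carrier_mat (k - m) (k - m)" by (simp_all add: \<rho>2_def)
    show "\<rho>2 (g \<otimes>\<^bsub>G\<^esub> h) = \<rho>2 g * \<rho>2 h"
    proof (rule eq_matI)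
      fix i j assume "i < dim_row (\<rho>2 g * \<rho>2 h)" "j < dim_col (\<rho>2 g * \<rho>2 h)"
      then have ij: "i < k - m" "j < k - m" by (auto simp: \<rho>2_def)
      show "\<rho>2 (g \<otimes>\<^bsub>G\<^esub> h) $$ (i, j) = (\<rho>2 g * \<rho>2 h) $$ (i, j)"
        unfolding mat_mult_index[OF c ij] using ij mk z[OF gh(1)] by (simp add: \<rho>2_def mult[OF gh])
    qed (simp_all add: \<rho>2_def)
  qed (simp add: \<rho>2_def)
  show "character G \<tau> g = character G \<rho>1 g + character G \<rho>2 g" if "g \<in> carrier G"
    using that carrier_matD(1)[OF T[OF that]] split[of "\<lambda>i. \<tau> g $$ (i, i)"]
    by (simp add: character_def mat_trace_def \<rho>1_def \<rho>2_def)
qed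

lemma is_rep_similar:
  assumes \<rho>: "is_rep G n \<rho>" and P: "P \<in> carrier_mat n k" and Q: "Q \<in> carrier_mat k n"
    and PQ: "P * Q = 1\<^sub>m n" and QP: "Q * P = 1\<^sub>m k"
  shows "is_rep G k (\<lambda>g. Q * \<rho> g * P)"
    "g \<in> carrier G \<Longrightarrow> character G (\<lambda>g. Q * \<rho> g * P) g = character G \<rho> g"
proof -
  note R = is_rep_carrier[OF \<rho>]
  show "is_rep G k (\<lambda>g. Q * \<rho> g * P)"
    unfolding is_rep_def
  proof (intro conjI ballI)
    show "Q * \<rho> \<one>\<^bsub>G\<^esub> * P = 1\<^sub>m k" using is_rep_one[OF \<rho>] QP Q by simp
  next
    fix g assume "g \<in> carrier G"
    then show "Q * \<rho> g * P \<in> carrier_mat k k" using mult_carrier_mat[OF mult_carrier_mat[OF Q R] P] by blast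
  next
    fix g h assume gh: "g \<in> carrier G" "h \<in> carrier G"
    note c = R[OF gh(1)] R[OF gh(2)]
    have q: "Q * \<rho> g \<in> carrier_mat k n" "\<rho> h * P \<in> carrier_mat n k" using mult_carrier_mat[OF Q c(1)] mult_carrier_mat[OF c(2) P] .
    have "Q * \<rho> (g \<otimes>\<^bsub>G\<^esub> h) * P = Q * \<rho> g * (\<rho> h * P)"
      unfolding is_rep_mult[OF \<rho> gh] using assoc_mult_mat[OF Q c] assoc_mult_mat[OF q(1) c(2) P] by simp
    also have "\<rho> h * P = (P * Q) * (\<rho> h * P)" unfolding PQ by (rule left_mult_one_mat[OF q(2), symmetric])
    also have "\<dots> = P * (Q * (\<rho> h * P))" by (rule assoc_mult_mat[OF P Q q(2)])
    also have "Q * (\<rho> h * P) = Q * \<rho> h * P" by (rule assoc_mult_mat[OF Q c(2) P, symmetric])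
    also have "Q * \<rho> g * (P * (Q * \<rho> h * P)) = Q * \<rho> g * P * (Q * \<rho> h * P)"
      by (rule assoc_mult_mat[OF q(1) P mult_carrier_mat[OF mult_carrier_mat[OF Q c(2)] P], symmetric])
    finally show "Q * \<rho> (g \<otimes>\<^bsub>G\<^esub> h) * P = Q * \<rho> g * P * (Q * \<rho> h * P)" .
  qed
  show "character G (\<lambda>g. Q * \<rho> g * P) g = character G \<rho> g" if g: "g \<in> carrier G"
  proof -
    have "mat_trace (Q * \<rho> g * P) = mat_trace (P * (Q * \<rho> g))"
      by (rule mat_trace_mult_comm[OF mult_carrier_mat[OF Q R[OF g]] P])
    also have "P * (Q * \<rho> g) = \<rho> g" using assoc_mult_mat[OF P Q R[OF g]] PQ R[OF g] by simp
    finally show ?thesis using g by (simp add: character_def)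
  qed
qed

lemma mat_mult_index_col:
  "A \<in> carrier_mat n k \<Longrightarrow> B \<in> carrier_mat k m \<Longrightarrow> i < n \<Longrightarrow> j < m \<Longrightarrow> (A * B) $$ (i, j) = (A *\<^sub>v col B j) $ i"
  by simp

text \<open>A proper invariant subspace splits the character into those of a subrepresentation and a
  quotient, both of smaller dimension. A list is used so that multiplicities are recorded; dimension
  0 gives the empty list.\<close>

lemma rep_decompose:
  assumes G: "group G" and "is_rep G n \<rho>"
  shows "\<exists>cs. set cs \<subseteq> Irr G \<and> (\<forall>g\<in>carrier G. character G \<rho> g = (\<Sum>\<chi>\<leftarrow>cs. \<chi> g))"
  using assms(2)
proof (induction n arbitrary: \<rho> rule: less_induct)
  case (less n)
  note \<rho> = less.prems and R = is_rep_carrier[OF less.prems]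
  consider "n = 0" | "irreducible_rep G n \<rho>" | W where "n > 0" "invariant_subspace G n \<rho> W" "W \<noteq> {0\<^sub>v n}" "W \<noteq> carrier_vec n"
    using \<rho> unfolding irreducible_rep_def by blast
  then show ?case
  proof cases
    case 1
    have "character G \<rho> g = 0" if "g \<in> carrier G" for g
      using carrier_matD(1)[OF R[OF that]] 1 that by (simp add: character_def mat_trace_def)
    then show ?thesis by (intro exI[of _ "[]"]) simp
  next
    case 2
    then show ?thesis by (intro exI[of _ "[character G \<rho>]"]) (auto simp: Irr_def)
  next
    case 3
    note inv = 3(2)[unfolded invariant_subspace_def]
    obtain P Q m k where P: "P \<in> carrier_mat n k" and Q: "Q \<in> carrier_mat k n"
      and PQ: "P * Q = 1\<^sub>m n" and QP: "Q * P = 1\<^sub>m k" and m: "0 < m" "m < k" "k \<le> n"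
      and col: "\<And>j. j < m \<Longrightarrow> col P j \<in> W"
      and zero: "\<And>w i. w \<in> W \<Longrightarrow> m \<le> i \<Longrightarrow> i < k \<Longrightarrow> (Q *\<^sub>v w) $ i = 0"
      by (rule subspace_adapted_basis[of W n]) (use inv 3 in blast)+
    define \<tau> where "\<tau> = (\<lambda>g. Q * \<rho> g * P)"
    note sim = is_rep_similar[OF \<rho> P Q PQ QP, folded \<tau>_def]
    have z: "\<tau> g $$ (i, j) = 0" if g: "g \<in> carrier G" and ij: "m \<le> i" "i < k" "j < m" for g i j
    proof -
      have cj: "col P j \<in> carrier_vec n" using col[OF ij(3)] inv by blast
      have "\<tau> g $$ (i, j) = ((Q * \<rho> g) *\<^sub>v col P j) $ i"
        unfolding \<tau>_def using ij m by (intro mat_mult_index_col[OF mult_carrier_mat[OF Q R[OF g]] P]) auto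
      also have "(Q * \<rho> g) *\<^sub>v col P j = Q *\<^sub>v (\<rho> g *\<^sub>v col P j)"
        by (rule assoc_mult_mat_vec[OF Q R[OF g] cj])
      also have "\<dots> $ i = 0" using zero inv col ij g by blast
      finally show ?thesis .
    qed
    let ?r1 = "\<lambda>g. mat m m (\<lambda>(i, j). \<tau> g $$ (i, j))"
    let ?r2 = "\<lambda>g. mat (k - m) (k - m) (\<lambda>(i, j). \<tau> g $$ (m + i, m + j))"
    have z': "\<forall>g\<in>carrier G. \<forall>i j. m \<le> i \<longrightarrow> i < k \<longrightarrow> j < m \<longrightarrow> \<tau> g $$ (i, j) = 0"
      using z by blast
    note bl = is_rep_blocks[OF sim(1) less_imp_le[OF m(2)] G z']
    have lt: "m < n" "k - m < n" using m by simp_all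
    obtain cs where cs: "set cs \<subseteq> Irr G" "\<forall>g\<in>carrier G. character G ?r1 g = (\<Sum>\<chi>\<leftarrow>cs. \<chi> g)"
      using less.IH[OF lt(1) bl(1)] by (elim exE conjE, intro that)
    obtain ds where ds: "set ds \<subseteq> Irr G" "\<forall>g\<in>carrier G. character G ?r2 g = (\<Sum>\<chi>\<leftarrow>ds. \<chi> g)"
      using less.IH[OF lt(2) bl(2)] by (elim exE conjE, intro that)
    have "character G \<rho> g = (\<Sum>\<chi>\<leftarrow>cs @ ds. \<chi> g)" if g: "g \<in> carrier G" for g
    proof -
      have "character G \<rho> g = character G ?r1 g + character G ?r2 g"
        using sim(2)[OF g] bl(3)[OF g] by argo
      then show ?thesis using cs(2) ds(2) g by simp
    qed
    moreover have "set (cs @ ds) \<subseteq> Irr G" using cs(1) ds(1) by simp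
    ultimately show ?thesis by blast
  qed
qed

section \<open>Completeness of the irreducible characters\<close>

context finite_group
begin

text \<open>Decomposes the regular representation: left multiplication by \<open>g\<close> fixes an
  element only if \<open>g\<close> is the identity, so the trace is \<open>N\<close> or 0.
  Finiteness and completeness of \<open>Irr G\<close> both rest on this identity.\<close>

lemma regular_decompose:
  "\<exists>cs. set cs \<subseteq> Irr G \<and> (\<forall>g\<in>carrier G. (\<Sum>\<chi>\<leftarrow>cs. \<chi> g) = (if g = \<one> then of_nat N else 0))"
proof -
  obtain e where e: "bij_betw e {..<N} (carrier G)"
    using ex_bij_betw_nat_finite[OF fin] by (auto simp: atLeast0LessThan)
  have eG: "e i \<in> carrier G" if "i < N" for i using e that by (auto simp: bij_betw_def)
  have e_inj: "e i = e j \<longleftrightarrow> i = j" if "i < N" "j < N" for i j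
    using e that by (auto simp: bij_betw_def inj_on_def)
  define R where "R g = mat N N (\<lambda>(i, j). if e i = g \<otimes> e j then 1 else 0 :: complex)" for g
  have Rc: "R g \<in> carrier_mat N N" for g by (simp add: R_def)
  have R: "is_rep G N R"
    unfolding is_rep_def
  proof (intro conjI ballI Rc)
    show "R \<one> = 1\<^sub>m N" by (rule eq_matI) (auto simp: R_def eG e_inj)
    fix g h assume gh: "g \<in> carrier G" "h \<in> carrier G"
    show "R (g \<otimes> h) = R g * R h"
    proof (rule eq_matI)
      fix i j assume "i < dim_row (R g * R h)" "j < dim_col (R g * R h)"
      then have ij: "i < N" "j < N" by (auto simp: R_def)
      have "h \<otimes> e j \<in> e ` {..<N}" using e gh eG[OF ij(2)] by (auto simp: bij_betw_def)
      then obtain l0 where l0: "l0 < N" "e l0 = h \<otimes> e j" by auto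
      have "(R g * R h) $$ (i, j) = (\<Sum>l<N. (if l = l0 then if e i = g \<otimes> e l then 1 else 0 else 0))"
        unfolding mat_mult_index[OF Rc Rc ij]
      proof (intro sum.cong refl)
        fix l assume "l \<in> {..<N}"
        then have l: "l < N" by simp
        then have "e l = h \<otimes> e j \<longleftrightarrow> l = l0" using l0 e_inj[OF l l0(1)] by simp
        then show "R g $$ (i, l) * R h $$ (l, j) = (if l = l0 then if e i = g \<otimes> e l then 1 else 0 else 0)"
          using ij l by (simp add: R_def)
      qed
      also have "\<dots> = (if e i = g \<otimes> (h \<otimes> e j) then 1 else 0)" using l0 by simp
      also have "\<dots> = R (g \<otimes> h) $$ (i, j)" using ij gh eG by (simp add: R_def m_assoc)
      finally show "R (g \<otimes> h) $$ (i, j) = (R g * R h) $$ (i, j)" by simp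
    qed (simp_all add: R_def)
  qed
  have "character G R g = (if g = \<one> then of_nat N else 0)" if g: "g \<in> carrier G" for g
  proof -
    have "e i = g \<otimes> e i \<longleftrightarrow> g = \<one>" if "i < N" for i
      using g eG[OF that] by (metis l_one r_cancel_one')
    then show ?thesis using g by (simp add: character_eq_sum[OF R] R_def)
  qed
  then show ?thesis using rep_decompose[OF is_group R] by metis
qed

lemma Irr_nonzero_at_one: "\<chi> \<in> Irr G \<Longrightarrow> \<chi> \<one> \<noteq> 0"
  by (elim Irr_one[of \<chi>]) simp

text \<open>Every irreducible character occurs in the regular one: its pairing with the regular
  character is \<open>N \<chi>(1)\<close>, which is nonzero, whereas it is orthogonal to all
  characters other than itself.\<close>

lemma finite_Irr: "finite (Irr G)"
proof -
  obtain cs where cs: "set cs \<subseteq> Irr G" and reg: "\<And>g. g \<in> carrier G \<Longrightarrow> (\<Sum>\<chi>\<leftarrow>cs. \<chi> g) = (if g = \<one> then of_nat N else 0)"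
    using regular_decompose by blast
  have "\<chi> \<in> set cs" if \<chi>: "\<chi> \<in> Irr G" for \<chi>
  proof (rule ccontr)
    assume "\<chi> \<notin> set cs"
    have sl: "(\<Sum>g\<in>carrier G. (\<Sum>\<psi>\<leftarrow>ds. \<psi> g) * \<chi> (inv g)) = (\<Sum>\<psi>\<leftarrow>ds. \<Sum>g\<in>carrier G. \<psi> g * \<chi> (inv g))" for ds :: "('a \<Rightarrow> complex) list"
      by (induction ds) (simp_all add: distrib_right sum.distrib)
    have "(\<Sum>g\<in>carrier G. (\<Sum>\<psi>\<leftarrow>cs. \<psi> g) * \<chi> (inv g)) = (\<Sum>g\<in>carrier G. if g = \<one> then of_nat N * \<chi> (inv g) else 0)"
      by (intro sum.cong refl) (simp add: reg)
    also have "\<dots> = of_nat N * \<chi> \<one>" using fin by simp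
    finally have "(\<Sum>\<psi>\<leftarrow>cs. \<Sum>g\<in>carrier G. \<psi> g * \<chi> (inv g)) = of_nat N * \<chi> \<one>" unfolding sl .
    moreover have "(\<Sum>\<psi>\<leftarrow>cs. \<Sum>g\<in>carrier G. \<psi> g * \<chi> (inv g)) = (\<Sum>\<psi>\<leftarrow>cs. 0)"
      using cs \<chi> \<open>\<chi> \<notin> set cs\<close> by (intro arg_cong[where f = sum_list] map_cong refl) (auto simp: Irr_orthogonal)
    ultimately show False using N_pos Irr_nonzero_at_one[OF \<chi>] by simp
  qed
  then show ?thesis by (meson finite_set finite_subset subsetI)
qed

definition class_fun :: "('a \<Rightarrow> complex) \<Rightarrow> bool" where
  "class_fun f \<longleftrightarrow> (\<forall>g\<in>carrier G. \<forall>h\<in>carrier G. f (inv h \<otimes> g \<otimes> h) = f g)"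

lemma class_funD: "class_fun f \<Longrightarrow> g \<in> carrier G \<Longrightarrow> h \<in> carrier G \<Longrightarrow> f (inv h \<otimes> g \<otimes> h) = f g"
  by (auto simp: class_fun_def)

lemma class_fun_Irr: "\<chi> \<in> Irr G \<Longrightarrow> class_fun \<chi>"
  by (simp add: class_fun_def Irr_conj)

lemma class_fun_mult_comm:
  assumes "class_fun f" "x \<in> carrier G" "y \<in> carrier G"
  shows "f (x \<otimes> y) = f (y \<otimes> x)"
  using class_funD[OF assms(1), of "x \<otimes> y" x] assms(2,3) by (simp add: m_assoc[symmetric])

text \<open>A class function acts by a scalar on each irreducible representation. At the level of
  characters: \<open>g\<close> may be replaced by any conjugate, and summing over all conjugators
  brings in the product formula.\<close>

lemma class_fun_convolution:
  assumes f: "class_fun f" and \<chi>: "\<chi> \<in> Irr G" and x: "x \<in> carrier G"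
  shows "\<chi> \<one> * (\<Sum>g\<in>carrier G. f g * \<chi> (inv g \<otimes> x)) = \<chi> x * (\<Sum>g\<in>carrier G. f g * \<chi> (inv g))"
proof -
  have "(\<Sum>g\<in>carrier G. f g * \<chi> (inv g \<otimes> x)) = (\<Sum>g\<in>carrier G. f g * \<chi> (x \<otimes> (h \<otimes> inv g \<otimes> inv h)))"
    if h: "h \<in> carrier G" for h
  proof -
    have "(\<Sum>g\<in>carrier G. f g * \<chi> (inv g \<otimes> x)) =
        (\<Sum>g\<in>carrier G. f (inv (inv h) \<otimes> g \<otimes> inv h) * \<chi> (inv (inv (inv h) \<otimes> g \<otimes> inv h) \<otimes> x))"
      by (rule sum.reindex_bij_betw[OF bij_betw_conj, symmetric]) (simp add: h)
    also have "\<dots> = (\<Sum>g\<in>carrier G. f g * \<chi> (x \<otimes> (h \<otimes> inv g \<otimes> inv h)))"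
    proof (intro sum.cong refl arg_cong2[where f = "(*)"])
      fix g assume g: "g \<in> carrier G"
      show "f (inv (inv h) \<otimes> g \<otimes> inv h) = f g" by (rule class_funD[OF f g]) (simp add: h)
      show "\<chi> (inv (inv (inv h) \<otimes> g \<otimes> inv h) \<otimes> x) = \<chi> (x \<otimes> (h \<otimes> inv g \<otimes> inv h))"
        using g h x by (subst class_fun_mult_comm[OF class_fun_Irr[OF \<chi>]]) (simp_all add: inv_mult_group m_assoc)
    qed
    finally show ?thesis .
  qed
  then have "(\<Sum>h\<in>carrier G. \<Sum>g\<in>carrier G. f g * \<chi> (inv g \<otimes> x)) =
      (\<Sum>h\<in>carrier G. \<Sum>g\<in>carrier G. f g * \<chi> (x \<otimes> (h \<otimes> inv g \<otimes> inv h)))"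
    by (rule sum.cong[OF refl])
  then have "\<chi> \<one> * (of_nat N * (\<Sum>g\<in>carrier G. f g * \<chi> (inv g \<otimes> x))) =
      \<chi> \<one> * (\<Sum>h\<in>carrier G. \<Sum>g\<in>carrier G. f g * \<chi> (x \<otimes> (h \<otimes> inv g \<otimes> inv h)))" by simp
  also have "\<dots> = (\<Sum>g\<in>carrier G. f g * (\<chi> \<one> * (\<Sum>h\<in>carrier G. \<chi> (x \<otimes> (h \<otimes> inv g \<otimes> inv h)))))"
    by (subst sum.swap) (simp add: sum_distrib_left mult.left_commute)
  also have "\<dots> = (\<Sum>g\<in>carrier G. f g * (of_nat N * \<chi> x * \<chi> (inv g)))"
    by (intro sum.cong refl) (simp add: Irr_product_formula[OF \<chi> x])
  also have "\<dots> = of_nat N * \<chi> x * (\<Sum>g\<in>carrier G. f g * \<chi> (inv g))"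
    by (simp add: sum_distrib_left algebra_simps)
  finally show ?thesis using N_pos by simp
qed

text \<open>The regular character is \<open>N\<close> times the delta function at the identity, so
  convolution with it returns \<open>N f\<close>; split into irreducibles, each convolution vanishes
  by \<open>orth\<close>.\<close>

lemma class_fun_orthogonal_zero:
  assumes f: "class_fun f" and x: "x \<in> carrier G"
    and orth: "\<And>\<chi>. \<chi> \<in> Irr G \<Longrightarrow> (\<Sum>g\<in>carrier G. f g * \<chi> (inv g)) = 0"
  shows "f x = 0"
proof -
  obtain cs where cs: "set cs \<subseteq> Irr G" and reg: "\<And>g. g \<in> carrier G \<Longrightarrow> (\<Sum>\<chi>\<leftarrow>cs. \<chi> g) = (if g = \<one> then of_nat N else 0)"
    using regular_decompose by blast
  have sl: "(\<Sum>g\<in>carrier G. f g * (\<Sum>\<psi>\<leftarrow>ds. \<psi> (inv g \<otimes> x))) = (\<Sum>\<psi>\<leftarrow>ds. \<Sum>g\<in>carrier G. f g * \<psi> (inv g \<otimes> x))"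
    for ds :: "('a \<Rightarrow> complex) list"
    by (induction ds) (simp_all add: distrib_left sum.distrib)
  have "(\<Sum>g\<in>carrier G. f g * (\<Sum>\<psi>\<leftarrow>cs. \<psi> (inv g \<otimes> x))) = (\<Sum>g\<in>carrier G. if g = x then f g * of_nat N else 0)"
  proof (intro sum.cong refl)
    fix g assume g: "g \<in> carrier G"
    have "inv g \<otimes> x = \<one> \<longleftrightarrow> g = x" using g x by (metis inv_closed inv_equality inv_inv l_inv)
    then show "f g * (\<Sum>\<psi>\<leftarrow>cs. \<psi> (inv g \<otimes> x)) = (if g = x then f g * of_nat N else 0)"
      using g x by (simp add: reg)
  qed
  also have "\<dots> = f x * of_nat N" using fin x by simp
  finally have "f x * of_nat N = (\<Sum>\<psi>\<leftarrow>cs. \<Sum>g\<in>carrier G. f g * \<psi> (inv g \<otimes> x))" unfolding sl ..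
  also have "\<dots> = (\<Sum>\<psi>\<leftarrow>cs. 0)"
  proof (intro arg_cong[where f = sum_list] map_cong refl)
    fix \<psi> assume "\<psi> \<in> set cs"
    then have \<psi>: "\<psi> \<in> Irr G" using cs by blast
    show "(\<Sum>g\<in>carrier G. f g * \<psi> (inv g \<otimes> x)) = 0"
      using class_fun_convolution[OF f \<psi> x] orth[OF \<psi>] Irr_nonzero_at_one[OF \<psi>] by simp
  qed
  finally show ?thesis using N_pos by simp
qed

text \<open>The difference \<open>d\<close> of the two sides is a class function orthogonal to every
  irreducible character.\<close>

lemma class_fun_expansion:
  assumes f: "class_fun f" and x: "x \<in> carrier G"
  shows "of_nat N * f x = (\<Sum>\<chi>\<in>Irr G. (\<Sum>g\<in>carrier G. f g * \<chi> (inv g)) * \<chi> x)"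
proof -
  define c where "c \<chi> = (\<Sum>g\<in>carrier G. f g * \<chi> (inv g))" for \<chi> :: "'a \<Rightarrow> complex"
  define d where "d y = of_nat N * f y - (\<Sum>\<chi>\<in>Irr G. c \<chi> * \<chi> y)" for y
  have "d x = 0"
  proof (rule class_fun_orthogonal_zero[OF _ x])
    show "class_fun d" using f Irr_conj by (auto simp: class_fun_def d_def intro!: sum.cong)
    fix \<psi> assume \<psi>: "\<psi> \<in> Irr G"
    have "(\<Sum>g\<in>carrier G. d g * \<psi> (inv g)) =
        of_nat N * c \<psi> - (\<Sum>g\<in>carrier G. \<Sum>\<chi>\<in>Irr G. c \<chi> * (\<chi> g * \<psi> (inv g)))"
      by (simp add: d_def c_def left_diff_distrib sum_subtractf sum_distrib_left sum_distrib_right mult.assoc)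
    also have "(\<Sum>g\<in>carrier G. \<Sum>\<chi>\<in>Irr G. c \<chi> * (\<chi> g * \<psi> (inv g))) = (\<Sum>\<chi>\<in>Irr G. c \<chi> * (\<Sum>g\<in>carrier G. \<chi> g * \<psi> (inv g)))"
      by (subst sum.swap) (simp add: sum_distrib_left)
    also have "\<dots> = (\<Sum>\<chi>\<in>Irr G. if \<chi> = \<psi> then c \<chi> * of_nat N else 0)"
      using \<psi> by (intro sum.cong refl) (simp add: Irr_orthogonal)
    also have "\<dots> = c \<psi> * of_nat N" using \<psi> finite_Irr by simp
    finally show "(\<Sum>g\<in>carrier G. d g * \<psi> (inv g)) = 0" by (simp add: mult.commute)
  qed
  then show ?thesis by (simp add: d_def c_def)
qed

section \<open>Conjugacy classes and the second orthogonality relation\<close>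

definition conj_class :: "'a \<Rightarrow> 'a set" where
  "conj_class g = {inv h \<otimes> g \<otimes> h | h. h \<in> carrier G}"

lemma conj_classes_eq: "conj_classes G = conj_class ` carrier G"
  by (simp add: conj_classes_def conj_class_def)

lemma conj_class_subset: "g \<in> carrier G \<Longrightarrow> conj_class g \<subseteq> carrier G"
  by (auto simp: conj_class_def)

lemma conj_class_refl: "g \<in> carrier G \<Longrightarrow> g \<in> conj_class g"
  unfolding conj_class_def by (intro CollectI exI[of _ \<one>]) simp

lemma conj_class_eq:
  assumes g: "g \<in> carrier G" and x: "x \<in> conj_class g"
  shows "conj_class x = conj_class g"
proof -
  obtain h where h: "h \<in> carrier G" "x = inv h \<otimes> g \<otimes> h" using x by (auto simp: conj_class_def)
  have "inv k \<otimes> x \<otimes> k = inv (h \<otimes> k) \<otimes> g \<otimes> (h \<otimes> k)" if "k \<in> carrier G" for k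
    using that h g by (simp add: inv_mult_group m_assoc)
  then have 1: "conj_class x \<subseteq> conj_class g" using h(1) by (auto simp: conj_class_def)
  have "inv k \<otimes> g \<otimes> k = inv (inv h \<otimes> k) \<otimes> x \<otimes> (inv h \<otimes> k)" if "k \<in> carrier G" for k
  proof -
    have "inv (inv h \<otimes> k) \<otimes> x \<otimes> (inv h \<otimes> k) = inv k \<otimes> (h \<otimes> inv h) \<otimes> g \<otimes> (h \<otimes> inv h) \<otimes> k"
      using that h g by (simp only: inv_mult_group m_assoc inv_inv inv_closed m_closed)
    then show ?thesis using that h g by simp
  qed
  then have 2: "conj_class g \<subseteq> conj_class x" using h(1)
    unfolding conj_class_def by (smt (verit) Collect_mono inv_closed m_closed)
  show ?thesis using 1 2 by blast
qed

lemma conj_class_eq_iff: "g \<in> carrier G \<Longrightarrow> x \<in> carrier G \<Longrightarrow> conj_class x = conj_class g \<longleftrightarrow> x \<in> conj_class g"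
  using conj_class_eq conj_class_refl by metis

lemma class_fun_conj_class: "class_fun f \<Longrightarrow> g \<in> carrier G \<Longrightarrow> x \<in> conj_class g \<Longrightarrow> f x = f g"
  by (auto simp: conj_class_def class_funD)

text \<open>Expansion of the indicator function of the class of \<open>x\<close>, whose coefficient
  at \<open>\<chi>\<close> is the class size times \<open>\<chi> (inv x)\<close>.\<close>

lemma second_orthogonality:
  assumes x: "x \<in> carrier G" and y: "y \<in> carrier G"
  shows "of_nat (card (conj_class x)) * (\<Sum>\<chi>\<in>Irr G. \<chi> (inv x) * \<chi> y) = (if y \<in> conj_class x then of_nat N else 0)"
proof -
  define f :: "'a \<Rightarrow> complex" where "f g = (if g \<in> conj_class x then 1 else 0)" for g
  have f: "class_fun f"
    unfolding class_fun_def
  proof (intro ballI)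
    fix g h assume gh: "g \<in> carrier G" "h \<in> carrier G"
    then have "conj_class (inv h \<otimes> g \<otimes> h) = conj_class g"
      by (intro conj_class_eq) (auto simp: conj_class_def)
    then have "inv h \<otimes> g \<otimes> h \<in> conj_class x \<longleftrightarrow> g \<in> conj_class x"
      using gh conj_class_eq_iff[OF x, of g] conj_class_eq_iff[OF x, of "inv h \<otimes> g \<otimes> h"] by simp
    then show "f (inv h \<otimes> g \<otimes> h) = f g" by (simp add: f_def)
  qed
  have c: "(\<Sum>g\<in>carrier G. f g * \<chi> (inv g)) = of_nat (card (conj_class x)) * \<chi> (inv x)" if \<chi>: "\<chi> \<in> Irr G" for \<chi>
  proof -
    have "(\<Sum>g\<in>carrier G. f g * \<chi> (inv g)) = (\<Sum>g\<in>conj_class x. \<chi> (inv g))"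
      using fin conj_class_subset[OF x] unfolding f_def
      by (simp add: if_distrib[where f = "\<lambda>z. z * _"] sum.If_cases Int_absorb1 cong: if_cong)
    also have "\<dots> = (\<Sum>g\<in>conj_class x. \<chi> (inv x))"
    proof (rule sum.cong[OF refl])
      fix g assume "g \<in> conj_class x"
      then obtain h where h: "h \<in> carrier G" "g = inv h \<otimes> x \<otimes> h" by (auto simp: conj_class_def)
      then have "inv g = inv h \<otimes> inv x \<otimes> h" using x by (simp add: inv_mult_group m_assoc)
      then show "\<chi> (inv g) = \<chi> (inv x)" using Irr_conj[OF \<chi>] h x by simp
    qed
    finally show ?thesis by simp
  qed
  have "of_nat N * f y = (\<Sum>\<chi>\<in>Irr G. (of_nat (card (conj_class x)) * \<chi> (inv x)) * \<chi> y)"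
    unfolding class_fun_expansion[OF f y] by (intro sum.cong refl) (simp add: c)
  then show ?thesis by (cases "y \<in> conj_class x") (simp_all add: f_def sum_distrib_left mult.assoc)
qed

lemma conj_class_eq_if_Irr_eq:
  assumes x: "x \<in> carrier G" and y: "y \<in> carrier G" and eq: "\<And>\<chi>. \<chi> \<in> Irr G \<Longrightarrow> \<chi> x = \<chi> y"
  shows "conj_class x = conj_class y"
proof -
  have "(\<Sum>\<chi>\<in>Irr G. \<chi> (inv x) * \<chi> y) = (\<Sum>\<chi>\<in>Irr G. \<chi> (inv x) * \<chi> x)"
    by (rule sum.cong) (simp_all add: eq)
  then have "(if y \<in> conj_class x then of_nat N else 0 :: complex) = (if x \<in> conj_class x then of_nat N else 0)"
    using second_orthogonality[OF x y] second_orthogonality[OF x x] by simp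
  then have "y \<in> conj_class x" using conj_class_refl[OF x] N_pos by (auto split: if_splits)
  then show ?thesis using conj_class_eq[OF x] by simp
qed

end

section \<open>The Galois action on characters\<close>

text \<open>These are Ramanujan sums. The full geometric sum is 0 or \<open>N\<close>; sorting
  exponents by their gcd \<open>d\<close> with \<open>N\<close> turns each part with
  \<open>d > 1\<close> into a sum of the same kind for \<open>N / d\<close> and
  \<open>z ^ d\<close>, so induction isolates the coprime part.\<close>

lemma sum_coprime_powers_rational:
  fixes z :: complex
  assumes "N > 0" "z ^ N = 1"
  shows "(\<Sum>k | k < N \<and> coprime k N. z ^ k) \<in> \<rat>"
  using assms
proof (induction N arbitrary: z rule: less_induct)
  case (less N)
  let ?T = "{d. d dvd N}"
  let ?S = "\<lambda>d. {k. k < N \<and> gcd k N = d}"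
  have fT: "finite ?T" using less.prems by simp
  have "(\<Sum>d\<in>?T. \<Sum>k\<in>{k \<in> {..<N}. gcd k N = d}. z ^ k) = (\<Sum>k<N. z ^ k)"
    by (rule sum.group) (use fT in auto)
  then have tot: "(\<Sum>k<N. z ^ k) = (\<Sum>d\<in>?T. \<Sum>k\<in>?S d. z ^ k)" by (simp add: lessThan_def conj_commute)
  also have "\<dots> = (\<Sum>k\<in>?S 1. z ^ k) + (\<Sum>d\<in>?T - {1}. \<Sum>k\<in>?S d. z ^ k)"
    using fT by (subst sum.remove[of _ 1]) auto
  finally have eq: "(\<Sum>k\<in>?S 1. z ^ k) = (\<Sum>k<N. z ^ k) - (\<Sum>d\<in>?T - {1}. \<Sum>k\<in>?S d. z ^ k)" by simp
  have geo: "(\<Sum>k<N. z ^ k) \<in> \<rat>"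
  proof (cases "z = 1")
    case False
    then show ?thesis using less.prems geometric_sum[OF False, of N] by simp
  qed simp
  have "(\<Sum>k\<in>?S d. z ^ k) \<in> \<rat>" if d: "d \<in> ?T - {1}" for d
  proof -
    obtain m where m: "N = d * m" using d by (auto elim: dvdE)
    have dm: "d > 1" "m > 0" "m < N" using m less.prems d by (auto intro: Nat.gr0I simp: nat_neq_iff)
    have "(\<Sum>k\<in>?S d. z ^ k) = (\<Sum>j | j < m \<and> coprime j m. (z ^ d) ^ j)"
    proof (rule sum.reindex_bij_witness[of _ "\<lambda>j. d * j" "\<lambda>k. k div d"])
      fix k assume "k \<in> ?S d"
      then have k: "k < N" "gcd k N = d" by auto
      then obtain j where j: "k = d * j" by (metis dvd_def gcd_dvd1)
      show "d * (k div d) = k" using j dm by simp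
      show "k div d \<in> {j. j < m \<and> coprime j m}"
        using k m j dm by (auto simp: gcd_mult_distrib_nat[symmetric] coprime_iff_gcd_eq_1)
      show "(z ^ d) ^ (k div d) = z ^ k" using j dm by (simp add: power_mult)
    next
      fix j assume "j \<in> {j. j < m \<and> coprime j m}"
      then show "d * j div d = j" "d * j \<in> ?S d" using m dm by (auto simp: gcd_mult_distrib_nat[symmetric])
    qed
    also have "\<dots> \<in> \<rat>" using less.prems m dm by (intro less.IH) (auto simp: power_mult)
    finally show ?thesis .
  qed
  then have "(\<Sum>d\<in>?T - {1}. \<Sum>k\<in>?S d. z ^ k) \<in> \<rat>" by (rule Rats_sum)
  with geo have "(\<Sum>k\<in>?S 1. z ^ k) \<in> \<rat>" unfolding eq by (rule Rats_diff)
  then show ?case by (simp add: coprime_iff_gcd_eq_1)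
qed

section \<open>Eigenvalues of a matrix of finite order\<close>

lemma upper_triangular_mult:
  fixes A B :: "complex mat"
  assumes A: "A \<in> carrier_mat n n" and B: "B \<in> carrier_mat n n"
    and tA: "upper_triangular A" and tB: "upper_triangular B"
  shows "upper_triangular (A * B)" "i < n \<Longrightarrow> (A * B) $$ (i, i) = A $$ (i, i) * B $$ (i, i)"
proof -
  have zA: "A $$ (i, j) = 0" if "j < i" "i < n" for i j using upper_triangularD[OF tA that(1)] that A by simp
  have zB: "B $$ (i, j) = 0" if "j < i" "i < n" for i j using upper_triangularD[OF tB that(1)] that B by simp
  show "upper_triangular (A * B)"
  proof (rule upper_triangularI)
    fix i j assume ij: "j < i" "i < dim_row (A * B)"
    then have n: "i < n" "j < n" using A by auto
    have "A $$ (i, l) * B $$ (l, j) = 0" if "l < n" for l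
      using zA[of l i] zB[of j l] n ij that by (cases "l < i") auto
    then show "(A * B) $$ (i, j) = 0" unfolding mat_mult_index[OF A B n] by (intro sum.neutral) simp
  qed
  show "(A * B) $$ (i, i) = A $$ (i, i) * B $$ (i, i)" if i: "i < n"
  proof -
    have "A $$ (i, l) * B $$ (l, i) = (if l = i then A $$ (i, i) * B $$ (i, i) else 0)" if "l < n" for l
      using zA[of l i] zB[of i l] i that by (cases l i rule: linorder_cases) auto
    then have "(A * B) $$ (i, i) = (\<Sum>l<n. if l = i then A $$ (i, i) * B $$ (i, i) else 0)"
      unfolding mat_mult_index[OF A B i i] by (intro sum.cong[OF refl]) (metis lessThan_iff)
    then show ?thesis using i by simp
  qed
qed

lemma upper_triangular_pow:
  fixes B :: "complex mat"
  assumes B: "B \<in> carrier_mat n n" and t: "upper_triangular B"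
  shows "upper_triangular (B ^\<^sub>m k) \<and> (\<forall>i<n. (B ^\<^sub>m k) $$ (i, i) = (B $$ (i, i)) ^ k)"
proof (induction k)
  case 0
  then show ?case using B by simp
next
  case (Suc k)
  have Bk: "B ^\<^sub>m k \<in> carrier_mat n n" using B by (rule pow_carrier_mat)
  show ?case using Suc upper_triangular_mult[OF Bk B _ t] by (simp add: mult.commute)
qed

text \<open>After triangularisation, taking powers of the matrix takes powers of its diagonal
  entries. The same numbers \<open>c i\<close> serve all exponents \<open>k\<close>.\<close>

lemma mat_pow_trace_eigenvalues:
  fixes A :: "complex mat"
  assumes A: "A \<in> carrier_mat n n" and AN: "A ^\<^sub>m M = 1\<^sub>m n"
  obtains c where "\<And>k. mat_trace (A ^\<^sub>m k) = (\<Sum>i<n. c i ^ k)" "\<And>i. i < n \<Longrightarrow> c i ^ M = 1"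
proof -
  obtain as where "char_poly A = (\<Prod>a\<leftarrow>as. [:- a, 1:])" using char_poly_factorized[OF A] by blast
  then obtain B where B: "B \<in> carrier_mat n n" "upper_triangular B" "similar_mat A B"
    using schur_decomposition_exists[OF A] by blast
  then obtain P Q where wit: "similar_mat_wit A B P Q" by (auto simp: similar_mat_def)
  note w = similar_mat_witD2[OF A wit]
  have 1: "mat_trace (A ^\<^sub>m k) = (\<Sum>i<n. (B $$ (i, i)) ^ k)" for k
  proof -
    have Bk: "B ^\<^sub>m k \<in> carrier_mat n n" using B(1) by (rule pow_carrier_mat)
    have "mat_trace (A ^\<^sub>m k) = mat_trace (P * B ^\<^sub>m k * Q)" using similar_mat_wit_pow_id[OF wit] by simp
    also have "\<dots> = mat_trace (Q * (P * B ^\<^sub>m k))"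
      by (rule mat_trace_mult_comm[OF mult_carrier_mat[OF w(6) Bk] w(7)])
    also have "Q * (P * B ^\<^sub>m k) = B ^\<^sub>m k" using assoc_mult_mat[OF w(7,6) Bk] left_mult_one_mat[OF Bk] w(2) by simp
    also have "mat_trace (B ^\<^sub>m k) = (\<Sum>i<n. (B ^\<^sub>m k) $$ (i, i))"
      unfolding mat_trace_def carrier_matD(1)[OF Bk] ..
    also have "\<dots> = (\<Sum>i<n. (B $$ (i, i)) ^ k)"
      using upper_triangular_pow[OF B(1,2), of k] by simp
    finally show ?thesis .
  qed
  have "B ^\<^sub>m M = Q * A ^\<^sub>m M * P" by (rule similar_mat_wit_pow_id[OF similar_mat_wit_sym[OF wit]])
  also have "\<dots> = 1\<^sub>m n" unfolding AN using w by simp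
  finally have BN: "B ^\<^sub>m M = 1\<^sub>m n" .
  have "(B $$ (i, i)) ^ M = 1" if "i < n" for i
    using upper_triangular_pow[OF B(1,2), of M] that unfolding BN by simp
  with 1 show ?thesis by (intro that[of "\<lambda>i. B $$ (i, i)"])
qed

context finite_group
begin

section \<open>Power maps and character values as polynomials in a root of unity\<close>

definition zeta :: complex where "zeta = cis (2 * pi / real N)"

lemma zeta_pow_N: "zeta ^ N = 1"
  using N_pos by (simp add: zeta_def DeMoivre)

lemma root_of_unity_is_zeta_pow:
  assumes "z ^ N = 1" obtains e where "z = zeta ^ e"
proof -
  have "z \<in> (\<lambda>k. cis (2 * pi * real k / real N)) ` {..<N}"
    using bij_betw_roots_unity[OF N_pos] assms by (simp add: bij_betw_def)
  then obtain k where "z = cis (2 * pi * real k / real N)" by blast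
  then have "z = zeta ^ k" by (simp add: zeta_def DeMoivre mult_ac)
  then show ?thesis by (rule that)
qed

lemma pow_N: "g \<in> carrier G \<Longrightarrow> g [^] N = \<one>"
  using pow_order_eq_1 by (simp add: order_def)

lemma pow_cong:
  assumes "g \<in> carrier G" "a mod N = b mod N"
  shows "g [^] a = g [^] b"
proof -
  have "g [^] c = g [^] (c mod N)" for c
  proof -
    have "g [^] c = g [^] (N * (c div N) + c mod N)" by simp
    also have "\<dots> = (g [^] N) [^] (c div N) \<otimes> g [^] (c mod N)"
      using assms(1) by (simp only: nat_pow_mult[symmetric] nat_pow_pow)
    finally show ?thesis using assms(1) by (simp add: pow_N)
  qed
  then show ?thesis using assms(2) by metis
qed

lemma coprime_inverse:
  assumes "coprime k N"
  obtains l where "coprime l N" "(k * l) mod N = 1 mod N"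
proof (cases "k = 0")
  \<comment> \<open>The exponent 0 is coprime to \<open>N\<close> only if \<open>N = 1\<close>,
    where all residues coincide.\<close>
  case True
  then show ?thesis using assms by (intro that[of 1]) simp_all
next
  case False
  then obtain l y where l: "k * l = N * y + 1" using bezout_nat[of k N] assms by auto
  have "coprime l N"
  proof (rule coprimeI)
    fix c assume "c dvd l" "c dvd N"
    then have "c dvd N * y + 1" "c dvd N * y" unfolding l[symmetric] by simp_all
    then show "c dvd 1" using dvd_add_right_iff by blast
  qed
  moreover have "(k * l) mod N = 1 mod N" unfolding l by (rule mod_mult_self4)
  ultimately show ?thesis by (rule that)
qed

lemma pow_coprime_inverse:
  assumes "coprime k N"
  obtains l where "coprime l N" "\<And>g. g \<in> carrier G \<Longrightarrow> (g [^] k) [^] l = g" "\<And>g. g \<in> carrier G \<Longrightarrow> (g [^] l) [^] k = g"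
proof -
  obtain l where l: "coprime l N" "(k * l) mod N = 1 mod N" using coprime_inverse[OF assms] by blast
  show ?thesis
    by (rule that[OF l(1)]) (use pow_cong[OF _ l(2)] in \<open>simp_all add: nat_pow_pow mult.commute\<close>)
qed

lemma bij_betw_pow:
  assumes "coprime k N"
  shows "bij_betw (\<lambda>g. g [^] k) (carrier G) (carrier G)"
proof -
  obtain l where "coprime l N" "\<And>g. g \<in> carrier G \<Longrightarrow> (g [^] k) [^] l = g" "\<And>g. g \<in> carrier G \<Longrightarrow> (g [^] l) [^] k = g"
    using pow_coprime_inverse[OF assms] by metis
  then show ?thesis by (intro bij_betw_byWitness[where f' = "\<lambda>g. g [^] l"]) auto
qed

lemma mult_inv_cancel:
  "x \<in> carrier G \<Longrightarrow> y \<in> carrier G \<Longrightarrow> x \<otimes> (inv x \<otimes> y) = y"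
  "x \<in> carrier G \<Longrightarrow> y \<in> carrier G \<Longrightarrow> inv x \<otimes> (x \<otimes> y) = y"
  by (simp_all add: m_assoc[symmetric])

lemma conj_pow:
  "g \<in> carrier G \<Longrightarrow> h \<in> carrier G \<Longrightarrow> (inv h \<otimes> g \<otimes> h) [^] (k :: nat) = inv h \<otimes> g [^] k \<otimes> h"
proof (induction k)
  case (Suc k)
  then show ?case by (simp add: m_assoc mult_inv_cancel)
qed simp

lemma Irr_pow_eigenvalues:
  assumes "\<chi> \<in> Irr G" "g \<in> carrier G"
  obtains es :: "nat list" where "\<And>k :: nat. \<chi> (g [^] k) = (\<Sum>e\<leftarrow>es. (zeta ^ e) ^ k)"
proof -
  obtain \<rho> n where irr: "irreducible_rep G n \<rho>" and \<chi>: "\<chi> = character G \<rho>" using assms Irr_iff by blast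
  note \<rho> = irreducible_repD(1)[OF irr]
  have A: "\<rho> g \<in> carrier_mat n n" by (rule is_rep_carrier[OF \<rho> assms(2)])
  have pw: "\<rho> (g [^] k) = \<rho> g ^\<^sub>m k" for k :: nat
  proof (induction k)
    case 0
    then show ?case using is_rep_one[OF \<rho>] A by simp
  next
    case (Suc k)
    then show ?case using is_rep_mult[OF \<rho> nat_pow_closed[OF assms(2)] assms(2)] by simp
  qed
  have AN: "\<rho> g ^\<^sub>m N = 1\<^sub>m n" using pw[of N] pow_N[OF assms(2)] is_rep_one[OF \<rho>] by simp
  obtain c where c: "\<And>k. mat_trace (\<rho> g ^\<^sub>m k) = (\<Sum>i<n. c i ^ k)" "\<And>i. i < n \<Longrightarrow> c i ^ N = 1"
    using mat_pow_trace_eigenvalues[OF A AN] by blast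
  have "\<exists>e. i < n \<longrightarrow> c i = zeta ^ e" for i
    using root_of_unity_is_zeta_pow[OF c(2)[of i]] by metis
  then obtain e where e: "\<And>i. i < n \<Longrightarrow> c i = zeta ^ e i" by metis
  have "\<chi> (g [^] k) = (\<Sum>e\<leftarrow>map e [0..<n]. (zeta ^ e) ^ k)" for k :: nat
  proof -
    have "\<chi> (g [^] k) = (\<Sum>i<n. c i ^ k)" using assms(2) unfolding \<chi> by (simp add: character_def pw c(1))
    also have "\<dots> = (\<Sum>i<n. (zeta ^ e i) ^ k)" by (intro sum.cong refl) (simp add: e)
    finally show ?thesis by (simp add: interv_sum_list_conv_sum_set_nat atLeast0LessThan o_def)
  qed
  then show ?thesis by (rule that)
qed

text \<open>The polynomial sums \<open>X ^ e\<close> over the eigenvalues \<open>zeta ^ e\<close> of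
  \<open>g\<close>; passing to \<open>g [^] k\<close> amounts to evaluating it at
  \<open>zeta ^ k\<close>.\<close>

lemma Irr_pow_poly:
  assumes "\<chi> \<in> Irr G" "g \<in> carrier G"
  shows "\<exists>q. \<forall>k :: nat. \<chi> (g [^] k) = ieval q (zeta ^ k)"
proof -
  obtain es :: "nat list" where es: "\<And>k :: nat. \<chi> (g [^] k) = (\<Sum>e\<leftarrow>es. (zeta ^ e) ^ k)"
    using Irr_pow_eigenvalues[OF assms] by blast
  have "(\<Sum>e\<leftarrow>es. (zeta ^ e) ^ k) = ieval (\<Sum>e\<leftarrow>es. monom 1 e) (zeta ^ k)" for k
    by (induction es) (simp_all add: hom_distribs poly_monom power_mult[symmetric] mult.commute)
  then show ?thesis using es by (intro exI[of _ "\<Sum>e\<leftarrow>es. monom 1 e"]) simp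
qed

text \<open>Not a characteristic polynomial: an integer polynomial expressing
  \<open>\<chi> g\<close> through \<open>zeta\<close>, uniformly over the powers of
  \<open>g\<close>. It enters only through its values at powers of \<open>zeta\<close>, which are
  independent of the choice.\<close>

definition char_poly_of :: "('a \<Rightarrow> complex) \<Rightarrow> 'a \<Rightarrow> int poly" where
  "char_poly_of \<chi> g = (SOME q. \<forall>k :: nat. \<chi> (g [^] k) = ieval q (zeta ^ k))"

lemma char_poly_of_eval:
  assumes "\<chi> \<in> Irr G" "g \<in> carrier G"
  shows "ieval (char_poly_of \<chi> g) (zeta ^ k) = \<chi> (g [^] k)"
proof -
  have "\<forall>k :: nat. \<chi> (g [^] k) = ieval (char_poly_of \<chi> g) (zeta ^ k)"
    unfolding char_poly_of_def by (rule someI_ex[OF Irr_pow_poly[OF assms]])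
  then have "\<chi> (g [^] k) = ieval (char_poly_of \<chi> g) (zeta ^ k)" by (rule spec)
  then show ?thesis by (rule sym)
qed

lemma char_poly_of_eval_one:
  "\<chi> \<in> Irr G \<Longrightarrow> g \<in> carrier G \<Longrightarrow> ieval (char_poly_of \<chi> g) zeta = \<chi> g"
  using char_poly_of_eval[of \<chi> g 1] by simp

text \<open>Plays the part of the field automorphism \<open>zeta \<mapsto> zeta ^ k\<close>.\<close>

lemma ieval_zeta_transfer: "coprime k N \<Longrightarrow> ieval q zeta = 0 \<Longrightarrow> ieval q (zeta ^ k) = 0"
  by (rule ieval_root_of_unity_coprime[OF zeta_pow_N _ _ N_pos])

text \<open>With denominators cleared, \<open>\<chi> g = a / b\<close> is an integer relation at
  \<open>zeta\<close>; its transfer states the same value for \<open>g [^] k\<close>.\<close>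

lemma Irr_pow_eq_if_rational:
  assumes \<chi>: "\<chi> \<in> Irr G" and g: "g \<in> carrier G" and k: "coprime k N" and rat: "\<chi> g \<in> \<rat>"
  shows "\<chi> (g [^] k) = \<chi> g"
proof -
  obtain a b :: int where ab: "b \<noteq> 0" "\<chi> g = of_int a / of_int b"
    using rat by (metis Rats_cases' of_int_0_less_iff less_irrefl)
  let ?q = "[:b:] * char_poly_of \<chi> g - [:a:]"
  have "ieval ?q zeta = 0" using ab by (simp add: hom_distribs char_poly_of_eval_one[OF \<chi> g])
  then have "ieval ?q (zeta ^ k) = 0" by (rule ieval_zeta_transfer[OF k])
  then have "of_int b * \<chi> (g [^] k) = of_int a" by (simp add: hom_distribs char_poly_of_eval[OF \<chi> g])
  then have "of_int b * \<chi> (g [^] k) = of_int b * \<chi> g" using ab by simp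
  then show ?thesis using ab(1) by simp
qed

text \<open>An invariant value equals its average over the coprime exponents below \<open>N\<close>,
  and on each eigenvalue that average is a multiple of a Ramanujan sum.\<close>

lemma Irr_rational_if_pow_eq:
  assumes \<chi>: "\<chi> \<in> Irr G" and g: "g \<in> carrier G" and eq: "\<And>k. coprime k N \<Longrightarrow> \<chi> (g [^] k) = \<chi> g"
  shows "\<chi> g \<in> \<rat>"
proof -
  let ?U = "{k. k < N \<and> coprime k N}"
  obtain es :: "nat list" where es: "\<And>k :: nat. \<chi> (g [^] k) = (\<Sum>e\<leftarrow>es. (zeta ^ e) ^ k)"
    using Irr_pow_eigenvalues[OF \<chi> g] by blast
  \<comment> \<open>\<open>1 mod N\<close> rather than 1, because for \<open>N = 1\<close> the only
    exponent below \<open>N\<close> is 0.\<close>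
  have "1 mod N \<in> ?U" using N_pos by (cases "N = 1") auto
  then have U: "?U \<noteq> {}" "finite ?U" by auto
  have "of_nat (card ?U) * \<chi> g = (\<Sum>k\<in>?U. \<chi> (g [^] k))" by (simp add: eq)
  also have "\<dots> = (\<Sum>e\<leftarrow>es. \<Sum>k\<in>?U. (zeta ^ e) ^ k)"
    unfolding es by (induction es) (simp_all add: sum.distrib)
  also have "\<dots> \<in> \<rat>"
  proof -
    have "(\<Sum>k\<in>?U. (zeta ^ e) ^ k) \<in> \<rat>" for e
      by (rule sum_coprime_powers_rational[OF N_pos]) (metis power_mult mult.commute zeta_pow_N power_one)
    then show ?thesis by (induction es) (auto intro: Rats_add)
  qed
  finally have "of_nat (card ?U) * \<chi> g / of_nat (card ?U) \<in> \<rat>" by (intro Rats_divide) auto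
  moreover have "of_nat (card ?U) \<noteq> (0 :: complex)" using U by (simp only: of_nat_eq_0_iff card_eq_0_iff) blast
  then have "of_nat (card ?U) * \<chi> g / of_nat (card ?U) = \<chi> g" by (rule nonzero_mult_div_cancel_left)
  ultimately show ?thesis by argo
qed

text \<open>Extended by 0 outside the carrier, as characters are, so that conjugates can be compared
  as functions.\<close>

definition gal :: "nat \<Rightarrow> ('a \<Rightarrow> complex) \<Rightarrow> 'a \<Rightarrow> complex" where
  "gal k \<chi> = (\<lambda>g. if g \<in> carrier G then \<chi> (g [^] k) else 0)"

text \<open>Pairing the product formula with an irreducible \<open>\<psi>\<close> not orthogonal to
  \<open>f\<close>, and applying the convolution identity, gives
  \<open>f(x) \<psi>(1) = f(1) \<psi>(x)\<close>. The norm then makes the squares of the two degrees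
  equal, and positivity excludes a sign.\<close>

lemma Irr_if_product_formula:
  assumes f: "class_fun f" and f0: "\<And>g. g \<notin> carrier G \<Longrightarrow> f g = 0"
    and pf: "\<And>x y. x \<in> carrier G \<Longrightarrow> y \<in> carrier G \<Longrightarrow>
      of_nat N * f x * f y = f \<one> * (\<Sum>h\<in>carrier G. f (x \<otimes> (h \<otimes> y \<otimes> inv h)))"
    and deg: "f \<one> = of_nat d" "d > 0"
    and norm: "(\<Sum>g\<in>carrier G. f g * f (inv g)) = of_nat N"
  shows "f \<in> Irr G"
proof -
  define c where "c \<psi> = (\<Sum>g\<in>carrier G. f g * \<psi> (inv g))" for \<psi> :: "'a \<Rightarrow> complex"
  have "\<exists>\<psi>\<in>Irr G. c \<psi> \<noteq> 0"
    using class_fun_orthogonal_zero[OF f one_closed] deg unfolding c_def by force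
  then obtain \<psi> where \<psi>: "\<psi> \<in> Irr G" and c0: "c \<psi> \<noteq> 0" by blast
  have fx: "f x * \<psi> \<one> = f \<one> * \<psi> x" if x: "x \<in> carrier G" for x
  proof -
    have inner: "(\<Sum>y\<in>carrier G. f (x \<otimes> (h \<otimes> y \<otimes> inv h)) * \<psi> (inv y)) = (\<Sum>g\<in>carrier G. f g * \<psi> (inv g \<otimes> x))"
      if h: "h \<in> carrier G" for h
    proof -
      \<comment> \<open>The substitution is
        \<open>g = x \<otimes> (h \<otimes> y \<otimes> inv h)\<close>, solved for
        \<open>y\<close>.\<close>
      have "bij_betw (\<lambda>g. inv h \<otimes> (inv x \<otimes> g) \<otimes> h) (carrier G) (carrier G)"
        using bij_betw_trans[OF bij_betw_mult_left[OF inv_closed[OF x]] bij_betw_conj[OF h]] by (simp add: comp_def)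
      then have "(\<Sum>y\<in>carrier G. f (x \<otimes> (h \<otimes> y \<otimes> inv h)) * \<psi> (inv y)) =
         (\<Sum>g\<in>carrier G. f (x \<otimes> (h \<otimes> (inv h \<otimes> (inv x \<otimes> g) \<otimes> h) \<otimes> inv h)) * \<psi> (inv (inv h \<otimes> (inv x \<otimes> g) \<otimes> h)))"
        by (rule sum.reindex_bij_betw[symmetric])
      also have "\<dots> = (\<Sum>g\<in>carrier G. f g * \<psi> (inv g \<otimes> x))"
      proof (intro sum.cong refl arg_cong2[where f = "(*)"])
        fix g assume g: "g \<in> carrier G"
        show "f (x \<otimes> (h \<otimes> (inv h \<otimes> (inv x \<otimes> g) \<otimes> h) \<otimes> inv h)) = f g"
          using h x g by (simp add: m_assoc mult_inv_cancel)
        have "inv (inv h \<otimes> (inv x \<otimes> g) \<otimes> h) = inv h \<otimes> (inv g \<otimes> x) \<otimes> h"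
          using h x g by (simp add: inv_mult_group m_assoc)
        then show "\<psi> (inv (inv h \<otimes> (inv x \<otimes> g) \<otimes> h)) = \<psi> (inv g \<otimes> x)"
          using Irr_conj[OF \<psi>, of "inv g \<otimes> x" h] h x g by simp
      qed
      finally show ?thesis .
    qed
    have "of_nat N * f x * c \<psi> = (\<Sum>y\<in>carrier G. (of_nat N * f x * f y) * \<psi> (inv y))"
      by (simp add: c_def sum_distrib_left mult.assoc)
    also have "\<dots> = (\<Sum>y\<in>carrier G. \<Sum>h\<in>carrier G. f \<one> * (f (x \<otimes> (h \<otimes> y \<otimes> inv h)) * \<psi> (inv y)))"
    proof (intro sum.cong refl)
      fix y assume y: "y \<in> carrier G"
      show "of_nat N * f x * f y * \<psi> (inv y) = (\<Sum>h\<in>carrier G. f \<one> * (f (x \<otimes> (h \<otimes> y \<otimes> inv h)) * \<psi> (inv y)))"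
        unfolding pf[OF x y] by (simp add: sum_distrib_left sum_distrib_right mult.assoc)
    qed
    also have "\<dots> = (\<Sum>h\<in>carrier G. f \<one> * (\<Sum>y\<in>carrier G. f (x \<otimes> (h \<otimes> y \<otimes> inv h)) * \<psi> (inv y)))"
      by (subst sum.swap) (simp add: sum_distrib_left)
    also have "\<dots> = of_nat N * (f \<one> * (\<Sum>g\<in>carrier G. f g * \<psi> (inv g \<otimes> x)))"
      by (simp add: inner cong: sum.cong)
    finally have "f x * c \<psi> = f \<one> * (\<Sum>g\<in>carrier G. f g * \<psi> (inv g \<otimes> x))" using N_pos by simp
    then have "\<psi> \<one> * (f x * c \<psi>) = f \<one> * (\<psi> \<one> * (\<Sum>g\<in>carrier G. f g * \<psi> (inv g \<otimes> x)))" by simp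
    then have "\<psi> \<one> * (f x * c \<psi>) = f \<one> * (\<psi> x * c \<psi>)"
      unfolding class_fun_convolution[OF f \<psi> x] c_def .
    then have "(f x * \<psi> \<one>) * c \<psi> = (f \<one> * \<psi> x) * c \<psi>" by (simp add: algebra_simps)
    then show ?thesis using c0 by simp
  qed
  obtain e where e: "e > 0" "\<psi> \<one> = of_nat e" using Irr_one[OF \<psi>] by blast
  have "of_nat N * (of_nat e * of_nat e) = (\<Sum>g\<in>carrier G. (f g * \<psi> \<one>) * (f (inv g) * \<psi> \<one>))"
    unfolding norm[symmetric] e by (simp add: sum_distrib_left sum_distrib_right algebra_simps)
  also have "\<dots> = (\<Sum>g\<in>carrier G. (f \<one> * \<psi> g) * (f \<one> * \<psi> (inv g)))"
    by (intro sum.cong refl) (simp add: fx)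
  also have "\<dots> = of_nat d * of_nat d * (\<Sum>g\<in>carrier G. \<psi> g * \<psi> (inv g))"
    unfolding deg(1) by (simp add: sum_distrib_left algebra_simps)
  also have "\<dots> = of_nat d * of_nat d * of_nat N" using Irr_orthogonal[OF \<psi> \<psi>] by simp
  finally have "of_nat (N * (e * e)) = (of_nat (d * d * N) :: complex)" by simp
  then have "N * (e * e) = d * d * N" by (simp only: of_nat_eq_iff)
  then have "e * e = d * d" using N_pos by (simp add: mult.commute)
  then have "e = d" by (metis power2_eq_square power2_eq_iff_nonneg le0)
  then have "f x = \<psi> x" for x
    using fx[of x] deg e f0[of x] Irr_eq_0[OF \<psi>, of x] by (cases "x \<in> carrier G") auto
  then have "f = \<psi>" by blast
  then show ?thesis using \<psi> by simp
qed

text \<open>The product formula transfers to \<open>zeta ^ k\<close>; the degree is unchanged since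
  powers fix the identity, and the norm is kept because \<open>g \<mapsto> g [^] k\<close> permutes
  the group.\<close>

lemma gal_Irr:
  assumes \<chi>: "\<chi> \<in> Irr G" and k: "coprime k N"
  shows "gal k \<chi> \<in> Irr G"
proof -
  obtain d where d: "d > 0" "\<chi> \<one> = of_nat d" using Irr_one[OF \<chi>] by blast
  show ?thesis
  proof (rule Irr_if_product_formula)
    show "class_fun (gal k \<chi>)" by (auto simp: class_fun_def gal_def conj_pow Irr_conj[OF \<chi>])
    show "gal k \<chi> g = 0" if "g \<notin> carrier G" for g using that by (simp add: gal_def)
    show "gal k \<chi> \<one> = of_nat d" by (simp add: gal_def d)
    show "d > 0" by (rule d)
    fix x y assume xy: "x \<in> carrier G" "y \<in> carrier G"
    let ?p = "char_poly_of \<chi>"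
    let ?q = "[:int N:] * ?p x * ?p y - ?p \<one> * (\<Sum>h\<in>carrier G. ?p (x \<otimes> (h \<otimes> y \<otimes> inv h)))"
    have "ieval ?q zeta = 0"
      using Irr_product_formula[OF \<chi> xy] xy
      by (simp add: hom_distribs poly_sum char_poly_of_eval_one[OF \<chi>] mult.assoc)
    then have "ieval ?q (zeta ^ k) = 0" by (rule ieval_zeta_transfer[OF k])
    then show "of_nat N * gal k \<chi> x * gal k \<chi> y = gal k \<chi> \<one> * (\<Sum>h\<in>carrier G. gal k \<chi> (x \<otimes> (h \<otimes> y \<otimes> inv h)))"
      using xy by (simp add: hom_distribs poly_sum char_poly_of_eval[OF \<chi>] gal_def mult.assoc)
  next
    have "(\<Sum>g\<in>carrier G. gal k \<chi> g * gal k \<chi> (inv g)) = (\<Sum>g\<in>carrier G. \<chi> (g [^] k) * \<chi> (inv (g [^] k)))"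
      by (intro sum.cong refl) (simp add: gal_def nat_pow_inv)
    also have "\<dots> = (\<Sum>g\<in>carrier G. \<chi> g * \<chi> (inv g))" by (rule sum.reindex_bij_betw[OF bij_betw_pow[OF k]])
    also have "\<dots> = of_nat N" using Irr_orthogonal[OF \<chi> \<chi>] by simp
    finally show "(\<Sum>g\<in>carrier G. gal k \<chi> g * gal k \<chi> (inv g)) = of_nat N" .
  qed
qed

end

section \<open>Fixed points of the Galois action\<close>

context finite_group
begin

lemma gal_gal: "gal k (gal l \<chi>) = gal (k * l) \<chi>"
  by (auto simp: gal_def nat_pow_pow)

lemma gal_inj:
  assumes \<chi>: "\<chi> \<in> Irr G" and \<psi>: "\<psi> \<in> Irr G" and k: "coprime k N" and eq: "gal k \<chi> = gal k \<psi>"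
  shows "\<chi> = \<psi>"
proof
  fix g
  show "\<chi> g = \<psi> g"
  proof (cases "g \<in> carrier G")
    case True
    obtain l where "coprime l N" "\<And>g. g \<in> carrier G \<Longrightarrow> (g [^] k) [^] l = g"
      and l: "\<And>g. g \<in> carrier G \<Longrightarrow> (g [^] l) [^] k = g"
      using pow_coprime_inverse[OF k] by metis
    have "gal k \<chi> (g [^] l) = gal k \<psi> (g [^] l)" using eq by simp
    then show ?thesis using True l by (simp add: gal_def)
  qed (simp add: Irr_eq_0[OF \<chi>] Irr_eq_0[OF \<psi>])
qed

section \<open>Power maps on conjugacy classes\<close>

definition pw :: "nat \<Rightarrow> 'a set \<Rightarrow> 'a set" where
  "pw k K = (\<lambda>g. g [^] k) ` K"

lemma pw_conj_class: "g \<in> carrier G \<Longrightarrow> pw k (conj_class g) = conj_class (g [^] k)"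
  unfolding pw_def conj_class_def by (auto simp: conj_pow image_iff) (metis conj_pow)

lemma conj_classesE:
  assumes "K \<in> conj_classes G" obtains g where "g \<in> carrier G" "K = conj_class g"
  using assms unfolding conj_classes_eq by blast

lemma conj_class_in: "g \<in> carrier G \<Longrightarrow> conj_class g \<in> conj_classes G"
  by (simp add: conj_classes_eq)

lemma finite_conj_classes: "finite (conj_classes G)"
  using fin by (simp add: conj_classes_eq)

lemma pw_in: "K \<in> conj_classes G \<Longrightarrow> pw k K \<in> conj_classes G"
  by (metis conj_classesE conj_class_in nat_pow_closed pw_conj_class)

lemma pw_pw: "K \<in> conj_classes G \<Longrightarrow> pw k (pw l K) = pw (k * l) K"
  by (elim conj_classesE) (simp add: pw_conj_class nat_pow_pow mult.commute)

lemma pw_comm: "K \<in> conj_classes G \<Longrightarrow> pw k (pw l K) = pw l (pw k K)"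
  by (simp add: pw_pw mult.commute)

lemma pw_inj:
  assumes K: "K \<in> conj_classes G" and L: "L \<in> conj_classes G" and k: "coprime k N" and eq: "pw k K = pw k L"
  shows "K = L"
proof -
  obtain l where "coprime l N" and l: "\<And>g. g \<in> carrier G \<Longrightarrow> (g [^] k) [^] l = g"
    and "\<And>g. g \<in> carrier G \<Longrightarrow> (g [^] l) [^] k = g"
    using pow_coprime_inverse[OF k] by metis
  have "pw l (pw k K) = K" if "K \<in> conj_classes G" for K
    using that l by (elim conj_classesE) (simp add: pw_conj_class)
  then show ?thesis using K L eq by metis
qed

definition cval :: "('a \<Rightarrow> complex) \<Rightarrow> 'a set \<Rightarrow> complex" where
  "cval f K = f (SOME g. g \<in> K)"

lemma cval_conj_class:
  assumes "class_fun f" "g \<in> carrier G"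
  shows "cval f (conj_class g) = f g"
  unfolding cval_def
  by (rule class_fun_conj_class[OF assms]) (metis someI conj_class_refl[OF assms(2)])

lemma cval_Irr: "\<chi> \<in> Irr G \<Longrightarrow> g \<in> carrier G \<Longrightarrow> cval \<chi> (conj_class g) = \<chi> g"
  by (rule cval_conj_class[OF class_fun_Irr])

lemma cval_pw:
  assumes "\<chi> \<in> Irr G" "coprime k N" "K \<in> conj_classes G"
  shows "cval \<chi> (pw k K) = cval (gal k \<chi>) K"
  using assms(3)
  by (elim conj_classesE) (simp add: pw_conj_class cval_Irr[OF assms(1)] cval_Irr[OF gal_Irr[OF assms(1,2)]], simp add: gal_def)

lemma Irr_eqI:
  assumes "\<chi> \<in> Irr G" "\<psi> \<in> Irr G" "\<And>K. K \<in> conj_classes G \<Longrightarrow> cval \<chi> K = cval \<psi> K"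
  shows "\<chi> = \<psi>"
proof
  fix g show "\<chi> g = \<psi> g"
    using assms(3)[OF conj_class_in, of g] cval_Irr[OF assms(1)] cval_Irr[OF assms(2)] Irr_eq_0[OF assms(1)] Irr_eq_0[OF assms(2)]
    by (cases "g \<in> carrier G") auto
qed

definition fix_Irr :: "nat \<Rightarrow> ('a \<Rightarrow> complex) set" where
  "fix_Irr k = {\<chi> \<in> Irr G. gal k \<chi> = \<chi>}"

definition fix_cl :: "nat \<Rightarrow> 'a set set" where
  "fix_cl k = {K \<in> conj_classes G. pw k K = K}"

lemma finite_fix_Irr: "finite (fix_Irr k)"
  using finite_Irr by (simp add: fix_Irr_def)

text \<open>The sum of \<open>\<chi> (g [^] k) * \<chi> (inv g)\<close> over all
  \<open>\<chi>\<close> and \<open>g\<close> is evaluated twice. First orthogonality leaves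
  \<open>N\<close> for each fixed character; second orthogonality leaves \<open>N / card K\<close>
  for each element of a fixed class \<open>K\<close>, hence \<open>N\<close> for each such
  class.\<close>

lemma brauer_permutation:
  assumes k: "coprime k N"
  shows "card (fix_Irr k) = card (fix_cl k)"
proof -
  have "(of_nat N * of_nat (card (fix_Irr k)) :: complex) = (\<Sum>\<chi>\<in>Irr G. if gal k \<chi> = \<chi> then of_nat N else 0)"
    using finite_Irr by (simp add: fix_Irr_def sum.If_cases Int_def mult.commute)
  also have "\<dots> = (\<Sum>\<chi>\<in>Irr G. \<Sum>g\<in>carrier G. gal k \<chi> g * \<chi> (inv g))"
    by (intro sum.cong refl) (simp add: Irr_orthogonal[OF gal_Irr[OF _ k]])
  also have "\<dots> = (\<Sum>g\<in>carrier G. \<Sum>\<chi>\<in>Irr G. \<chi> (inv g) * \<chi> (g [^] k))"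
    by (subst sum.swap) (auto simp: gal_def mult.commute intro!: sum.cong)
  also have "\<dots> = (\<Sum>g\<in>carrier G. if pw k (conj_class g) = conj_class g then of_nat N / of_nat (card (conj_class g)) else 0)"
  proof (intro sum.cong refl)
    fix g assume g: "g \<in> carrier G"
    have "finite (conj_class g)" using conj_class_subset[OF g] fin finite_subset by blast
    then have c: "card (conj_class g) \<noteq> 0" using conj_class_refl[OF g] by auto
    have "g [^] k \<in> conj_class g \<longleftrightarrow> pw k (conj_class g) = conj_class g"
      using conj_class_eq_iff[OF g nat_pow_closed[OF g], of k] pw_conj_class[OF g] by simp
    then show "(\<Sum>\<chi>\<in>Irr G. \<chi> (inv g) * \<chi> (g [^] k)) =
        (if pw k (conj_class g) = conj_class g then of_nat N / of_nat (card (conj_class g)) else 0)"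
      using second_orthogonality[OF g nat_pow_closed[OF g], of k] c
      by (cases "pw k (conj_class g) = conj_class g") (simp_all add: nonzero_eq_divide_eq mult.commute)
  qed
  also have "\<dots> = (\<Sum>K\<in>conj_classes G. \<Sum>g\<in>{g \<in> carrier G. conj_class g = K}.
      if pw k (conj_class g) = conj_class g then of_nat N / of_nat (card (conj_class g)) else 0)"
    by (rule sum.group[symmetric]) (use fin finite_conj_classes conj_class_in in auto)
  also have "\<dots> = (\<Sum>K\<in>conj_classes G. if pw k K = K then of_nat N else 0)"
  proof (intro sum.cong refl)
    fix K assume "K \<in> conj_classes G"
    then obtain x where x: "x \<in> carrier G" "K = conj_class x" by (rule conj_classesE)
    have K: "{g \<in> carrier G. conj_class g = K} = K"
      using x conj_class_eq_iff conj_class_subset[OF x(1)] by blast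
    have "finite K" using conj_class_subset[OF x(1)] fin finite_subset x(2) by blast
    then have c: "card K \<noteq> 0" using conj_class_refl[OF x(1)] x(2) by auto
    have "(\<Sum>g\<in>{g \<in> carrier G. conj_class g = K}.
        if pw k (conj_class g) = conj_class g then of_nat N / of_nat (card (conj_class g)) else 0) =
        (\<Sum>g\<in>{g \<in> carrier G. conj_class g = K}. if pw k K = K then of_nat N / of_nat (card K) else 0 :: complex)"
      by (intro sum.cong refl) simp
    then show "(\<Sum>g\<in>{g \<in> carrier G. conj_class g = K}.
        if pw k (conj_class g) = conj_class g then of_nat N / of_nat (card (conj_class g)) else 0) =
        (if pw k K = K then of_nat N else 0 :: complex)"
      unfolding K using c by simp
  qed
  also have "\<dots> = of_nat N * of_nat (card (fix_cl k))"
    using finite_conj_classes by (simp add: fix_cl_def sum.If_cases Int_def mult.commute)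
  finally show ?thesis using N_pos by simp
qed

section \<open>Rationality as invariance under all coprime exponents\<close>

lemma Irr_rat_iff: "\<chi> \<in> Irr_rat G \<longleftrightarrow> \<chi> \<in> Irr G \<and> (\<forall>k. coprime k N \<longrightarrow> gal k \<chi> = \<chi>)"
proof (intro iffI conjI allI impI)
  assume \<chi>: "\<chi> \<in> Irr_rat G"
  then show I: "\<chi> \<in> Irr G" by (simp add: Irr_rat_def)
  fix k assume k: "coprime k N"
  show "gal k \<chi> = \<chi>"
    using \<chi> Irr_pow_eq_if_rational[OF I _ k] Irr_eq_0[OF I] by (auto simp: gal_def Irr_rat_def)
next
  assume a: "\<chi> \<in> Irr G \<and> (\<forall>k. coprime k N \<longrightarrow> gal k \<chi> = \<chi>)"
  have "\<chi> g \<in> \<rat>" if g: "g \<in> carrier G" for g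
  proof (rule Irr_rational_if_pow_eq[OF _ g])
    fix k assume "coprime k N"
    then have "gal k \<chi> g = \<chi> g" using a by simp
    then show "\<chi> (g [^] k) = \<chi> g" using g by (simp add: gal_def)
  qed (use a in blast)
  then show "\<chi> \<in> Irr_rat G" using a by (simp add: Irr_rat_def)
qed

lemma cl_rat_iff: "K \<in> cl_rat G \<longleftrightarrow> K \<in> conj_classes G \<and> (\<forall>k. coprime k N \<longrightarrow> pw k K = K)"
proof (cases "K \<in> conj_classes G")
  case True
  then obtain g where g: "g \<in> carrier G" and K: "K = conj_class g" by (rule conj_classesE)
  have "rational_class G K \<longleftrightarrow> (\<forall>\<chi>\<in>Irr G. \<chi> g \<in> \<rat>)"
    unfolding rational_class_def K
    using class_fun_conj_class[OF class_fun_Irr g] conj_class_refl[OF g] by metis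
  also have "\<dots> \<longleftrightarrow> (\<forall>k. coprime k N \<longrightarrow> pw k K = K)"
  proof (intro iffI allI impI ballI)
    fix k assume rat: "\<forall>\<chi>\<in>Irr G. \<chi> g \<in> \<rat>" and k: "coprime k N"
    have "conj_class (g [^] k) = conj_class g"
      by (rule conj_class_eq_if_Irr_eq) (use g rat Irr_pow_eq_if_rational[OF _ g k] in auto)
    then show "pw k K = K" using g by (simp add: K pw_conj_class)
  next
    fix \<chi> assume fixed: "\<forall>k. coprime k N \<longrightarrow> pw k K = K" and \<chi>: "\<chi> \<in> Irr G"
    show "\<chi> g \<in> \<rat>"
    proof (rule Irr_rational_if_pow_eq[OF \<chi> g])
      fix k assume "coprime k N"
      then have "conj_class (g [^] k) = conj_class g" using fixed g by (simp add: K pw_conj_class)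
      then show "\<chi> (g [^] k) = \<chi> g" using cval_Irr[OF \<chi>] g by (metis nat_pow_closed)
    qed
  qed
  finally show ?thesis using True by (simp add: cl_rat_def)
qed (simp add: cl_rat_def)

lemma cl_irrat_iff: "K \<in> cl_irrat G \<longleftrightarrow> K \<in> conj_classes G \<and> (\<exists>k. coprime k N \<and> pw k K \<noteq> K)"
proof -
  have "K \<in> cl_irrat G \<longleftrightarrow> K \<in> conj_classes G \<and> K \<notin> cl_rat G" by (auto simp: cl_irrat_def cl_rat_def)
  then show ?thesis using cl_rat_iff by blast
qed

lemma finite_cl_irrat: "finite (cl_irrat G)"
  using finite_conj_classes by (simp add: cl_irrat_def)

lemma cl_irrat_in: "K \<in> cl_irrat G \<Longrightarrow> K \<in> conj_classes G"
  by (simp add: cl_irrat_def)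

lemma pw_irrat:
  assumes K: "K \<in> cl_irrat G" and k: "coprime k N"
  shows "pw k K \<in> cl_irrat G"
proof -
  note Kc = cl_irrat_in[OF K]
  obtain l where l: "coprime l N" "pw l K \<noteq> K" using K cl_irrat_iff by blast
  have "pw l (pw k K) \<noteq> pw k K"
    using l pw_inj[OF pw_in[OF Kc] Kc k] pw_comm[OF Kc] by metis
  then show ?thesis using cl_irrat_iff pw_in[OF Kc] l by blast
qed

lemma pw_rat: "K \<in> conj_classes G \<Longrightarrow> K \<notin> cl_irrat G \<Longrightarrow> coprime k N \<Longrightarrow> pw k K = K"
  using cl_irrat_iff by blast

lemma card_le_of_cl_irrat: "S \<subseteq> cl_irrat G \<Longrightarrow> card S \<le> card (cl_irrat G)"
  by (rule card_mono[OF finite_cl_irrat])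

text \<open>An exponent \<open>c\<close> moving the most classes moves all. If it fixed
  \<open>K\<close>, some \<open>l\<close> would move \<open>K\<close>; as \<open>c\<close> fixes
  both \<open>K\<close> and \<open>pw l K\<close>, it moves at most three classes. Comparing
  \<open>c\<close> with \<open>c * l\<close> yields four classes moved by \<open>l\<close>, against
  maximality.\<close>

lemma exists_pw_moving_all:
  assumes le: "card (cl_irrat G) \<le> 5"
  obtains c where "coprime c N" "\<And>K. K \<in> cl_irrat G \<Longrightarrow> pw c K \<noteq> K"
proof -
  define M where "M k = {K \<in> cl_irrat G. pw k K \<noteq> K}" for k
  have fM: "finite (M k)" for k using finite_cl_irrat by (simp add: M_def)
  have "\<exists>c. coprime c N \<and> (\<forall>l. coprime l N \<longrightarrow> card (M l) \<le> card (M c))"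
  proof (rule ex_has_greatest_nat[of "\<lambda>k. coprime k N" 1 "\<lambda>k. card (M k)" 6])
    have "card (M l) < 6" for l
    proof -
      have "M l \<subseteq> cl_irrat G" by (auto simp: M_def)
      then show ?thesis using card_le_of_cl_irrat[of "M l"] le by linarith
    qed
    then show "\<forall>l. coprime l N \<longrightarrow> card (M l) < 6" by blast
  qed simp
  then obtain c where c: "coprime c N" and max: "\<And>l. coprime l N \<Longrightarrow> card (M l) \<le> card (M c)" by blast
  have "pw c K \<noteq> K" if K0: "K \<in> cl_irrat G" for K
  proof
    assume cK: "pw c K = K"
    note Kc = cl_irrat_in[OF K0]
    obtain l where l: "coprime l N" "pw l K \<noteq> K" using K0 cl_irrat_iff by blast
    have lK: "pw l K \<in> cl_irrat G" "pw l (pw l K) \<noteq> pw l K" "pw c (pw l K) = pw l K"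
      using pw_irrat[OF K0 l(1)] pw_inj[OF pw_in[OF Kc] Kc l(1), of l] l(2) pw_comm[OF Kc, of c l] cK by auto
    have K_notin: "K \<notin> M c" "pw l K \<notin> M c" using cK lK by (simp_all add: M_def)
    have "card (insert K (insert (pw l K) (M c))) = card (M c) + 2"
      using K_notin l(2) fM by auto
    moreover have "insert K (insert (pw l K) (M c)) \<subseteq> cl_irrat G" using K0 lK by (auto simp: M_def)
    ultimately have c3: "card (M c) \<le> 3" using card_le_of_cl_irrat[of "insert K (insert (pw l K) (M c))"] le by linarith
    \<comment> \<open>Otherwise \<open>c * l\<close> would move more classes than \<open>c\<close>.
      It does move \<open>K\<close>, so a class that it misses lies in \<open>M c\<close>.\<close>
    have "\<not> insert K (M c) \<subseteq> M (c * l)"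
    proof
      assume "insert K (M c) \<subseteq> M (c * l)"
      then have "card (insert K (M c)) \<le> card (M (c * l))" by (rule card_mono[OF fM])
      moreover have "card (M (c * l)) \<le> card (M c)" using max[of "c * l"] c l(1) by simp
      ultimately show False using K_notin fM by simp
    qed
    moreover have "K \<in> M (c * l)" using K0 lK l(2) by (simp add: M_def pw_pw[OF Kc, symmetric])
    ultimately obtain z where z: "z \<in> M c" "z \<notin> M (c * l)" by blast
    then have zi: "z \<in> cl_irrat G" "pw c z \<noteq> z" by (auto simp: M_def)
    note zc = cl_irrat_in[OF zi(1)]
    \<comment> \<open>On \<open>z\<close> the exponents \<open>l\<close> and \<open>c\<close>
      cancel, so \<open>l\<close> moves both \<open>z\<close> and \<open>pw c z\<close>.\<close>
    have clz: "pw c (pw l z) = z" using z zi by (simp add: M_def pw_pw[OF zc])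
    have lz: "pw l z \<noteq> z" using clz zi by metis
    have lcz: "pw l (pw c z) \<noteq> pw c z" using clz zi pw_comm[OF zc] by metis
    have cz: "pw c z \<in> cl_irrat G" "pw c (pw c z) \<noteq> pw c z"
      using pw_irrat[OF zi(1) c] pw_inj[OF pw_in[OF zc] zc c] zi(2) by auto
    have "{K, pw l K, z, pw c z} \<subseteq> M l"
      using K0 l(2) lK zi lz lcz cz by (auto simp: M_def)
    moreover have "K \<noteq> z" "K \<noteq> pw c z" "pw l K \<noteq> z" "pw l K \<noteq> pw c z"
      using zi(2) cz(2) cK lK(3) by metis+
    then have "card {K, pw l K, z, pw c z} = 4"
      using l(2) zi(2) by (simp add: eq_commute)
    ultimately have "4 \<le> card (M l)" using card_mono[OF fM] by metis
    then show False using max[OF l(1)] c3 by linarith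
  qed
  then show ?thesis using that[OF c] by blast
qed

end

section \<open>Differences of conjugate characters\<close>

context finite_group
begin

text \<open>The character minus its conjugate by \<open>t\<close>, read on classes. For
  \<open>t\<close> coprime to \<open>N\<close> it vanishes on rational classes, and it changes sign
  under \<open>t\<close> wherever \<open>t\<close> acts as an involution.\<close>

definition cdiff :: "('a \<Rightarrow> complex) \<Rightarrow> nat \<Rightarrow> 'a set \<Rightarrow> complex" where
  "cdiff \<chi> t K = cval \<chi> K - cval \<chi> (pw t K)"

lemma cdiff_conj_class:
  assumes "\<chi> \<in> Irr G" "g \<in> carrier G"
  shows "cdiff \<chi> t (conj_class g) = \<chi> g - \<chi> (g [^] t)"
  using assms by (simp add: cdiff_def pw_conj_class cval_Irr)

lemma cdiff_pw_fixed:
  assumes "\<chi> \<in> Irr G" "coprime c N" "gal c \<chi> = \<chi>" "K \<in> conj_classes G"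
  shows "cdiff \<chi> t (pw c K) = cdiff \<chi> t K"
proof -
  have "cval \<chi> (pw t (pw c K)) = cval \<chi> (pw c (pw t K))" by (simp add: pw_comm[OF assms(4)])
  then show ?thesis
    using assms(3) cval_pw[OF assms(1,2,4)] cval_pw[OF assms(1,2) pw_in[OF assms(4)], of t] by (simp add: cdiff_def)
qed

lemma cdiff_pw_involution:
  "K \<in> conj_classes G \<Longrightarrow> pw t (pw t K) = K \<Longrightarrow> cdiff \<chi> t (pw t K) = - cdiff \<chi> t K"
  by (simp add: cdiff_def)

lemma cdiff_rational: "K \<in> conj_classes G \<Longrightarrow> K \<notin> cl_irrat G \<Longrightarrow> coprime t N \<Longrightarrow> cdiff \<chi> t K = 0"
  by (simp add: cdiff_def pw_rat)

text \<open>Invariance would make \<open>\<psi>\<close> the mean of its neighbours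
  \<open>\<chi>\<close> and \<open>\<phi>\<close> in the orbit of \<open>l\<close>; pairing with
  \<open>\<psi>\<close>, which differs from both, gives \<open>2 N = 0\<close>.\<close>

lemma exists_cdiff_not_invariant:
  assumes \<chi>: "\<chi> \<in> Irr G" and l: "coprime l N" and ne: "gal l \<chi> \<noteq> \<chi>"
  obtains z where "z \<in> cl_irrat G" "cdiff \<chi> l (pw l z) \<noteq> cdiff \<chi> l z"
proof -
  have "\<exists>z\<in>conj_classes G. cdiff \<chi> l (pw l z) \<noteq> cdiff \<chi> l z"
  proof (rule ccontr)
    assume "\<not> ?thesis"
    then have eq: "cdiff \<chi> l (pw l z) = cdiff \<chi> l z" if "z \<in> conj_classes G" for z using that by blast
    define \<psi> where "\<psi> = gal l \<chi>"
    define \<phi> where "\<phi> = gal l \<psi>"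
    have I: "\<psi> \<in> Irr G" "\<phi> \<in> Irr G" using gal_Irr \<chi> l by (simp_all add: \<psi>_def \<phi>_def)
    have ne': "\<phi> \<noteq> \<psi>" using gal_inj[OF I(1) \<chi> l] ne by (auto simp: \<phi>_def \<psi>_def)
    have "2 * \<psi> g = \<chi> g + \<phi> g" if g: "g \<in> carrier G" for g
    proof -
      have "\<chi> (g [^] l) - \<chi> ((g [^] l) [^] l) = \<chi> g - \<chi> (g [^] l)"
        using eq[OF conj_class_in[OF g]] g by (simp only: pw_conj_class cdiff_conj_class[OF \<chi>] nat_pow_closed)
      then show ?thesis using g by (simp add: \<psi>_def \<phi>_def gal_def algebra_simps)
    qed
    then have "(\<Sum>g\<in>carrier G. (2 * \<psi> g) * \<psi> (inv g)) = (\<Sum>g\<in>carrier G. (\<chi> g + \<phi> g) * \<psi> (inv g))"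
      by simp
    then have "2 * (\<Sum>g\<in>carrier G. \<psi> g * \<psi> (inv g)) = (\<Sum>g\<in>carrier G. \<chi> g * \<psi> (inv g)) + (\<Sum>g\<in>carrier G. \<phi> g * \<psi> (inv g))"
      by (simp add: sum_distrib_left mult.assoc distrib_right sum.distrib)
    then show False
      using Irr_orthogonal[OF I(1) I(1)] Irr_orthogonal[OF \<chi> I(1)] Irr_orthogonal[OF I(2) I(1)] ne ne' N_pos
      by (simp add: \<psi>_def)
  qed
  then obtain z where z: "z \<in> conj_classes G" "cdiff \<chi> l (pw l z) \<noteq> cdiff \<chi> l z" by blast
  moreover have "z \<in> cl_irrat G" using z pw_rat[OF z(1) _ l] by metis
  ultimately show ?thesis using that by blast
qed

text \<open>The difference of two distinct irreducible characters has norm \<open>2 N\<close>, all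
  of it carried by the irrational classes. The form pairs \<open>g\<close> with its inverse, so the
  factor \<open>\<eta>\<close> of inversion accompanies the constant square
  \<open>u\<close>.\<close>

lemma cdiff_norm:
  assumes \<chi>: "\<chi> \<in> Irr G" and t: "coprime t N" and ne: "gal t \<chi> \<noteq> \<chi>"
    and sq: "\<And>K. K \<in> cl_irrat G \<Longrightarrow> (cdiff \<chi> t K)\<^sup>2 = u"
    and inv: "\<And>K. K \<in> cl_irrat G \<Longrightarrow> cdiff \<chi> t (pw (2 * N - 1) K) = \<eta> * cdiff \<chi> t K"
  shows "\<eta> * u * of_nat (card (\<Union>(cl_irrat G))) = 2 * of_nat N"
proof -
  let ?Y = "\<Union>(cl_irrat G)"
  define \<psi> where "\<psi> = gal t \<chi>"
  have \<psi>: "\<psi> \<in> Irr G" using gal_Irr[OF \<chi> t] by (simp add: \<psi>_def)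
  have d: "cdiff \<chi> t (conj_class g) = \<chi> g - \<psi> g" if "g \<in> carrier G" for g
    using that by (simp add: cdiff_conj_class[OF \<chi>] \<psi>_def gal_def)
  have Y: "g \<in> ?Y \<longleftrightarrow> conj_class g \<in> cl_irrat G" if g: "g \<in> carrier G" for g
  proof
    assume "g \<in> ?Y"
    then obtain K where K: "K \<in> cl_irrat G" "g \<in> K" by blast
    then obtain x where "x \<in> carrier G" "K = conj_class x" using cl_irrat_in conj_classesE by metis
    then show "conj_class g \<in> cl_irrat G" using K conj_class_eq by metis
  qed (use conj_class_refl[OF g] in blast)
  have YG: "?Y \<subseteq> carrier G"
  proof
    fix g assume "g \<in> ?Y"
    then obtain K where K: "K \<in> cl_irrat G" "g \<in> K" by blast
    then obtain x where "x \<in> carrier G" "K = conj_class x" using cl_irrat_in conj_classesE by metis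
    then show "g \<in> carrier G" using K conj_class_subset by blast
  qed
  have "(\<Sum>g\<in>carrier G. (\<chi> g - \<psi> g) * (\<chi> (inv g) - \<psi> (inv g))) =
      (\<Sum>g\<in>carrier G. \<chi> g * \<chi> (inv g)) - (\<Sum>g\<in>carrier G. \<chi> g * \<psi> (inv g))
      - (\<Sum>g\<in>carrier G. \<psi> g * \<chi> (inv g)) + (\<Sum>g\<in>carrier G. \<psi> g * \<psi> (inv g))"
    by (simp add: algebra_simps sum.distrib sum_subtractf)
  also have "\<dots> = 2 * of_nat N"
    using Irr_orthogonal[OF \<chi> \<chi>] Irr_orthogonal[OF \<chi> \<psi>] Irr_orthogonal[OF \<psi> \<chi>] Irr_orthogonal[OF \<psi> \<psi>] ne
    by (simp add: \<psi>_def[symmetric])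
  finally have "2 * of_nat N = (\<Sum>g\<in>carrier G. (\<chi> g - \<psi> g) * (\<chi> (inv g) - \<psi> (inv g)))" by simp
  also have "\<dots> = (\<Sum>g\<in>carrier G. if g \<in> ?Y then \<eta> * u else 0)"
  proof (rule sum.cong[OF refl])
    fix g assume g: "g \<in> carrier G"
    show "(\<chi> g - \<psi> g) * (\<chi> (inv g) - \<psi> (inv g)) = (if g \<in> ?Y then \<eta> * u else 0)"
    proof (cases "g \<in> ?Y")
      case True
      then have K: "conj_class g \<in> cl_irrat G" using Y[OF g] by simp
      \<comment> \<open>The exponent \<open>2 * N - 1\<close> is -1 modulo \<open>N\<close> and acts
        as inversion.\<close>
      have "g [^] (2 * N - 1) \<otimes> g = g [^] (Suc (2 * N - 1))" by simp
      also have "Suc (2 * N - 1) = N * 2" using N_pos by simp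
      also have "g [^] (N * 2) = \<one>" using pow_N[OF g] g by (simp only: nat_pow_pow[symmetric] nat_pow_one)
      finally have "g [^] (2 * N - 1) = inv g" using g by (metis inv_equality nat_pow_closed)
      then have "cdiff \<chi> t (conj_class (inv g)) = \<eta> * cdiff \<chi> t (conj_class g)"
        using inv[OF K] pw_conj_class[OF g, of "2 * N - 1"] by simp
      then have "\<chi> (inv g) - \<psi> (inv g) = \<eta> * (\<chi> g - \<psi> g)" using d g by simp
      then have "(\<chi> g - \<psi> g) * (\<chi> (inv g) - \<psi> (inv g)) = \<eta> * (\<chi> g - \<psi> g)\<^sup>2"
        by (simp add: power2_eq_square)
      then show ?thesis using sq[OF K] d[OF g] True by simp
    next
      case False
      then have "cdiff \<chi> t (conj_class g) = 0" using Y[OF g] cdiff_rational[OF conj_class_in[OF g] _ t] by simp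
      then show ?thesis using d[OF g] False by simp
    qed
  qed
  also have "\<dots> = (\<Sum>g\<in>?Y. \<eta> * u)"
    by (rule sum.mono_neutral_cong_right[OF fin YG]) simp_all
  also have "\<dots> = of_nat (card ?Y) * (\<eta> * u)" by simp
  finally show ?thesis by (simp add: mult_ac)
qed

text \<open>A relation with an integer factor is the vanishing of an integer polynomial at
  \<open>zeta\<close>; replacing \<open>zeta\<close> by \<open>zeta ^ k\<close> replaces the class
  by its image under \<open>pw k\<close>.\<close>

lemma cdiff_transfer:
  assumes \<chi>: "\<chi> \<in> Irr G" and \<psi>: "\<psi> \<in> Irr G" and k: "coprime k N" and z: "z \<in> conj_classes G"
    and eq: "cdiff \<chi> t z = of_int s * cdiff \<psi> t' z"
  shows "cdiff \<chi> t (pw k z) = of_int s * cdiff \<psi> t' (pw k z)"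
proof -
  obtain g where g: "g \<in> carrier G" "z = conj_class g" using z by (rule conj_classesE)
  let ?q = "(char_poly_of \<chi> g - char_poly_of \<chi> (g [^] t)) -
    [:s:] * (char_poly_of \<psi> g - char_poly_of \<psi> (g [^] t'))"
  have "ieval ?q zeta = 0"
    using eq g by (simp add: hom_distribs char_poly_of_eval_one \<chi> \<psi> cdiff_conj_class)
  then have "ieval ?q (zeta ^ k) = 0" by (rule ieval_zeta_transfer[OF k])
  then have "\<chi> (g [^] k) - \<chi> ((g [^] t) [^] k) = of_int s * (\<psi> (g [^] k) - \<psi> ((g [^] t') [^] k))"
    using g by (simp add: hom_distribs char_poly_of_eval \<chi> \<psi>)
  moreover have "(g [^] a) [^] k = (g [^] k) [^] a" for a :: nat using g(1) by (simp add: nat_pow_pow mult.commute)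
  ultimately show ?thesis using g by (simp add: pw_conj_class cdiff_conj_class \<chi> \<psi>)
qed

text \<open>Equal squares give equality up to sign, an integer relation that survives the exponent
  \<open>k\<close>. Since \<open>k\<close> preserves one side and negates the other, the value is
  its own negative.\<close>

lemma cdiff_sign_conflict:
  assumes \<chi>: "\<chi> \<in> Irr G" and \<psi>: "\<psi> \<in> Irr G" and k: "coprime k N" and z: "z \<in> conj_classes G"
    and eq: "(cdiff \<chi> t z)\<^sup>2 = (cdiff \<psi> t' z)\<^sup>2"
    and \<chi>k: "cdiff \<chi> t (pw k z) = cdiff \<chi> t z" and \<psi>k: "cdiff \<psi> t' (pw k z) = - cdiff \<psi> t' z"
  shows "cdiff \<chi> t z = 0"
proof -
  have "\<exists>s. cdiff \<chi> t z = of_int s * cdiff \<psi> t' z"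
    using eq unfolding power2_eq_iff by (elim disjE; intro exI[of _ 1] exI[of _ "-1"]) simp_all
  then obtain s where s: "cdiff \<chi> t z = of_int s * cdiff \<psi> t' z" by blast
  then have "cdiff \<chi> t (pw k z) = of_int s * cdiff \<psi> t' (pw k z)" by (rule cdiff_transfer[OF \<chi> \<psi> k z])
  then have "cdiff \<chi> t z = - cdiff \<chi> t z" unfolding \<chi>k \<psi>k s by simp
  then show ?thesis by simp
qed

section \<open>The action on at most five irrational classes\<close>

lemma card_insert_insert:
  "finite F \<Longrightarrow> x \<notin> F \<Longrightarrow> y \<notin> insert x F \<Longrightarrow> card (insert y (insert x F)) = card F + 2"
  by simp

text \<open>As \<open>d\<close> is constant along \<open>c\<close> and separates \<open>z\<close>
  from \<open>pw l z\<close>, their orbits under \<open>c\<close> are disjoint, with at least two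
  classes each. Longer orbits would give six classes, and \<open>c\<close> would carry a fifth class
  to a sixth.\<close>

lemma irrational_classes_structure:
  assumes le: "card (cl_irrat G) \<le> 5" and c: "coprime c N" and l: "coprime l N"
    and cmov': "\<forall>K\<in>cl_irrat G. pw c K \<noteq> K"
    and z: "z \<in> cl_irrat G" and dc': "\<forall>K\<in>conj_classes G. d (pw c K) = d K" and dl: "d (pw l z) \<noteq> d z"
  shows "cl_irrat G = {z, pw c z, pw l z, pw c (pw l z)}" "pw c (pw c z) = z"
    "pw l (pw l z) = z \<or> pw l (pw l z) = pw c z" "pw c (pw l z) \<noteq> z"
proof -
  note cmov = bspec[OF cmov'] and dc = bspec[OF dc']
  note zc = cl_irrat_in[OF z]
  note cz = pw_irrat[OF z c] and lz = pw_irrat[OF z l]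
  note clz = pw_irrat[OF lz c]
  note czc = cl_irrat_in[OF cz] and lzc = cl_irrat_in[OF lz] and clzc = cl_irrat_in[OF clz]
  have dcz: "d (pw c z) = d z" "d (pw c (pw c z)) = d z"
    "d (pw c (pw l z)) = d (pw l z)" "d (pw c (pw c (pw l z))) = d (pw l z)"
    using dc zc czc lzc clzc by simp_all
  have m: "pw c z \<noteq> z" "pw c (pw l z) \<noteq> pw l z" using cmov z lz by simp_all
  have n: "pw l z \<noteq> z" "pw l z \<noteq> pw c z" "pw c (pw l z) \<noteq> z" "pw c (pw l z) \<noteq> pw c z"
    using dcz dl by metis+
  show "pw c (pw l z) \<noteq> z" by (rule n)
  let ?F = "{z, pw c z, pw l z, pw c (pw l z)}"
  have F: "card ?F = 4" using m n by (simp add: eq_commute)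
  have FY: "?F \<subseteq> cl_irrat G" using z cz lz clz by simp
  show cc: "pw c (pw c z) = z"
  proof (rule ccontr)
    assume ne: "pw c (pw c z) \<noteq> z"
    let ?x = "pw c (pw c z)" and ?y = "pw c (pw c (pw l z))"
    have x: "?x \<in> cl_irrat G" "?x \<noteq> pw c z" "?x \<noteq> pw l z" "?x \<noteq> pw c (pw l z)"
      using pw_irrat[OF cz c] cmov[OF cz] dcz dl by metis+
    \<comment> \<open>The exponents commute, so the orbit of \<open>pw l z\<close> under
      \<open>c\<close> is the \<open>l\<close>-image of that of \<open>z\<close> and is equally
      long.\<close>
    have eq: "?y = pw l ?x" using pw_comm[OF zc, of c l] pw_comm[OF czc, of c l] by simp
    have "?y \<noteq> pw l z"
      unfolding eq using ne pw_inj[OF cl_irrat_in[OF x(1)] zc l] by blast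
    then have y: "?y \<in> cl_irrat G" "?y \<noteq> z" "?y \<noteq> pw c z" "?y \<noteq> pw l z" "?y \<noteq> pw c (pw l z)" "?y \<noteq> ?x"
      using pw_irrat[OF clz c] cmov[OF clz] dcz dl by metis+
    have "?x \<notin> ?F" "?y \<notin> insert ?x ?F" using ne x y by simp_all
    then have "card (insert ?y (insert ?x ?F)) = card ?F + 2" by (intro card_insert_insert) simp
    moreover have "insert ?y (insert ?x ?F) \<subseteq> cl_irrat G" using FY x y by simp
    ultimately show False using card_le_of_cl_irrat[of "insert ?y (insert ?x ?F)"] le F by linarith
  qed
  have ccl: "pw c (pw c (pw l z)) = pw l z"
    using pw_comm[OF zc, of c l] pw_comm[OF czc, of c l] cc by simp
  show eqF: "cl_irrat G = ?F"
  proof (rule ccontr)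
    assume "cl_irrat G \<noteq> ?F"
    then obtain w where w: "w \<in> cl_irrat G" "w \<notin> ?F" using FY by blast
    note wc = cl_irrat_in[OF w(1)]
    have inj: "pw c w = pw c K \<Longrightarrow> K \<in> ?F \<Longrightarrow> False" for K
      using pw_inj[OF wc _ c, of K] w(2) cl_irrat_in FY by blast
    have "pw c w \<notin> ?F"
    proof
      assume "pw c w \<in> ?F"
      then have "pw c w = pw c (pw c z) \<or> pw c w = pw c z \<or> pw c w = pw c (pw c (pw l z)) \<or> pw c w = pw c (pw l z)"
        unfolding cc ccl by blast
      then show False using inj by blast
    qed
    then have "pw c w \<notin> insert w ?F" using cmov[OF w(1)] by simp
    with w(2) have "card (insert (pw c w) (insert w ?F)) = card ?F + 2" by (intro card_insert_insert) simp
    moreover have "insert (pw c w) (insert w ?F) \<subseteq> cl_irrat G" using FY w pw_irrat[OF w(1) c] by simp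
    ultimately show False using card_le_of_cl_irrat[of "insert (pw c w) (insert w ?F)"] le F by linarith
  qed
  have "pw l (pw l z) \<in> ?F" using pw_irrat[OF lz l] eqF by simp
  moreover have "pw l (pw l z) \<noteq> pw l z" using n(1) pw_inj[OF lzc zc l] by blast
  moreover have "pw l (pw l z) \<noteq> pw c (pw l z)"
    using n(2) pw_inj[OF lzc czc l] pw_comm[OF zc, of c l] by metis
  ultimately show "pw l (pw l z) = z \<or> pw l (pw l z) = pw c z" by blast
qed

lemma gal_eq_if_pw_eq:
  assumes \<chi>: "\<chi> \<in> Irr G" and x: "coprime x N" and y: "coprime y N"
    and eq: "\<And>K. K \<in> cl_irrat G \<Longrightarrow> pw x K = pw y K"
  shows "gal x \<chi> = gal y \<chi>"
proof (rule Irr_eqI)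
  fix K assume K: "K \<in> conj_classes G"
  have "pw x K = pw y K" using eq pw_rat[OF K] x y by (cases "K \<in> cl_irrat G") auto
  then show "cval (gal x \<chi>) K = cval (gal y \<chi>) K" using cval_pw[OF \<chi> x K] cval_pw[OF \<chi> y K] by simp
qed (use gal_Irr \<chi> x y in auto)

lemma card_fix_Irr_if_moving:
  assumes k: "coprime k N" and mov: "\<forall>K\<in>cl_irrat G. pw k K \<noteq> K"
  shows "card (fix_Irr k) = card (cl_rat G)"
proof -
  have "fix_cl k = cl_rat G"
  proof (rule Set.set_eqI)
    fix K
    have "K \<in> cl_rat G \<longleftrightarrow> K \<in> conj_classes G \<and> K \<notin> cl_irrat G" by (auto simp: cl_irrat_def cl_rat_def)
    then show "K \<in> fix_cl k \<longleftrightarrow> K \<in> cl_rat G" using mov pw_rat[of K k] k unfolding fix_cl_def by blast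
  qed
  then show ?thesis using brauer_permutation[OF k] by simp
qed

text \<open>In the Klein case the differences for \<alpha>, \<beta>, \<gamma> are multiplied under
  (\<open>c\<close>, \<open>l\<close>) by the signs (+,-), (-,+), (-,-). Any two patterns disagree
  at some exponent, and that exponent refutes equality of the squares.\<close>

lemma fix_Irr_moving_rational:
  assumes le: "card (cl_irrat G) \<le> 5" and c: "coprime c N"
    and cmov: "\<forall>K\<in>cl_irrat G. pw c K \<noteq> K"
    and \<alpha>: "\<alpha> \<in> fix_Irr c" and l: "coprime l N"
  shows "gal l \<alpha> = \<alpha>"
proof (rule ccontr)
  assume ne: "gal l \<alpha> \<noteq> \<alpha>"
  have \<alpha>I: "\<alpha> \<in> Irr G" and \<alpha>c: "gal c \<alpha> = \<alpha>" using \<alpha> by (simp_all add: fix_Irr_def)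
  obtain z where z: "z \<in> cl_irrat G" and dl: "cdiff \<alpha> l (pw l z) \<noteq> cdiff \<alpha> l z"
    using exists_cdiff_not_invariant[OF \<alpha>I l ne] .
  note zc = cl_irrat_in[OF z]
  have dc: "\<forall>K\<in>conj_classes G. cdiff \<alpha> l (pw c K) = cdiff \<alpha> l K"
    using cdiff_pw_fixed[OF \<alpha>I c \<alpha>c] by blast
  note str = irrational_classes_structure[OF le c l cmov z dc dl]
  have lz: "pw l z \<noteq> z" using dl by metis
  have pw1: "pw 1 K = K" if "K \<in> conj_classes G" for K
    using that by (elim conj_classesE) (simp add: pw_conj_class)
  have cases4: "K = pw 1 z \<or> K = pw c z \<or> K = pw l z \<or> K = pw (c * l) z" if "K \<in> cl_irrat G" for K
  proof -
    have "K \<in> {z, pw c z, pw l z, pw c (pw l z)}" using that unfolding str(1) .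
    then show ?thesis unfolding pw_pw[OF zc] pw1[OF zc] by (simp only: insert_iff empty_iff simp_thms)
  qed
  have orbit: "\<exists>s. coprime s N \<and> K = pw s z" if "K \<in> cl_irrat G" for K
    using cases4[OF that] c l coprime_1_left coprime_mult_left_iff by metis
  \<comment> \<open>The exponents commute and the orbit of \<open>z\<close> is all of
    \<open>cl_irrat G\<close>, so agreement at \<open>z\<close> is agreement everywhere.\<close>
  have same: "pw x K = pw y K" if xy: "pw x z = pw y z" and K: "K \<in> cl_irrat G" for x y K
  proof -
    obtain s where s: "K = pw s z" using orbit[OF K] by blast
    show ?thesis unfolding s using xy pw_comm[OF zc, of x s] pw_comm[OF zc, of y s] by simp
  qed
  have moves: "\<forall>K\<in>cl_irrat G. pw x K \<noteq> K" if "pw x z \<noteq> z" "coprime x N" for x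
  proof (intro ballI notI)
    fix K assume "K \<in> cl_irrat G"
    assume "pw x K = K"
    obtain s' where s': "coprime s' N" "K = pw s' z" using orbit \<open>K \<in> cl_irrat G\<close> by blast
    then have "pw s' (pw x z) = pw s' z" using \<open>pw x K = K\<close> pw_comm[OF zc, of x s'] by simp
    then show False using pw_inj[OF pw_in[OF zc] zc s'(1)] that(1) by blast
  qed
  have cl: "coprime (c * l) N" using c l by simp
  have clz: "pw (c * l) z \<noteq> z" using str(4) pw_pw[OF zc] by simp
  have r: "card (fix_Irr c) = card (cl_rat G)" "card (fix_Irr l) = card (cl_rat G)"
    "card (fix_Irr (c * l)) = card (cl_rat G)"
    using card_fix_Irr_if_moving[OF c cmov] card_fix_Irr_if_moving[OF l moves[OF lz l]]
      card_fix_Irr_if_moving[OF cl moves[OF clz cl]] by simp_all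
  have \<alpha>_not: "\<alpha> \<notin> fix_Irr l" "\<alpha> \<notin> fix_Irr (c * l)"
    using ne \<alpha>c by (simp_all add: fix_Irr_def mult.commute[of c l] gal_gal[symmetric])
  from str(3) show False
  proof
    \<comment> \<open>The cyclic case: characters fixed by \<open>l\<close> are then fixed by
      \<open>c\<close>, and equal counts make the two sets equal, although \<alpha> lies in only one
      of them.\<close>
    assume "pw l (pw l z) = pw c z"
    then have "pw (l * l) K = pw c K" if "K \<in> cl_irrat G" for K
      using same[OF _ that, of "l * l" c] pw_pw[OF zc] by simp
    then have ll: "gal l (gal l \<chi>) = gal c \<chi>" if "\<chi> \<in> Irr G" for \<chi>
      using gal_eq_if_pw_eq[OF that, of "l * l" c] l c by (simp add: gal_gal)
    have "fix_Irr l \<subseteq> fix_Irr c"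
    proof
      fix \<chi> assume "\<chi> \<in> fix_Irr l"
      then show "\<chi> \<in> fix_Irr c" using ll[of \<chi>] by (simp add: fix_Irr_def)
    qed
    then have "fix_Irr l = fix_Irr c" using card_subset_eq[OF finite_fix_Irr] r by metis
    then show False using \<alpha> \<alpha>_not by simp
  next
    assume ll: "pw l (pw l z) = z"
    \<comment> \<open>A set of fixed characters of the same size as \<open>fix_Irr c\<close> that
      misses \<alpha> cannot lie inside \<open>fix_Irr c\<close>.\<close>
    have not_sub: "\<exists>\<beta>\<in>fix_Irr k. gal c \<beta> \<noteq> \<beta>" if "card (fix_Irr k) = card (cl_rat G)" "\<alpha> \<notin> fix_Irr k" for k
    proof (rule ccontr)
      assume "\<not> ?thesis"
      then have "fix_Irr k \<subseteq> fix_Irr c" by (auto simp: fix_Irr_def)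
      then have "fix_Irr k = fix_Irr c" using card_subset_eq[OF finite_fix_Irr] r that by metis
      then show False using \<alpha> that by simp
    qed
    obtain \<beta> where \<beta>: "\<beta> \<in> Irr G" "gal l \<beta> = \<beta>" "gal c \<beta> \<noteq> \<beta>"
      using not_sub[OF r(2) \<alpha>_not(1)] by (auto simp: fix_Irr_def)
    obtain \<gamma> where \<gamma>: "\<gamma> \<in> Irr G" "gal (c * l) \<gamma> = \<gamma>" "gal c \<gamma> \<noteq> \<gamma>"
      using not_sub[OF r(3) \<alpha>_not(2)] by (auto simp: fix_Irr_def)
    have cc: "pw c (pw c K) = K" and llK: "pw l (pw l K) = K" if "K \<in> cl_irrat G" for K
      using same[OF _ that, of "c * c" 1] same[OF _ that, of "l * l" 1] str(2) ll
        pw_pw[OF zc] pw_pw[OF cl_irrat_in[OF that]] pw1[OF zc] pw1[OF cl_irrat_in[OF that]] by simp_all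
    have \<alpha>s: "cdiff \<alpha> l (pw c K) = cdiff \<alpha> l K" "cdiff \<alpha> l (pw l K) = - cdiff \<alpha> l K" if "K \<in> cl_irrat G" for K
      using dc cdiff_pw_involution llK[OF that] cl_irrat_in[OF that] by blast+
    have \<beta>s: "cdiff \<beta> c (pw l K) = cdiff \<beta> c K" "cdiff \<beta> c (pw c K) = - cdiff \<beta> c K" if "K \<in> cl_irrat G" for K
      using cdiff_pw_fixed[OF \<beta>(1) l \<beta>(2)] cdiff_pw_involution cc[OF that] cl_irrat_in[OF that] by blast+
    have \<gamma>c: "cdiff \<gamma> c (pw c K) = - cdiff \<gamma> c K" if "K \<in> cl_irrat G" for K
      using cdiff_pw_involution cc[OF that] cl_irrat_in[OF that] by blast
    have \<gamma>l: "cdiff \<gamma> c (pw l K) = - cdiff \<gamma> c K" if K: "K \<in> cl_irrat G" for K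
    proof -
      have "cdiff \<gamma> c K = cdiff \<gamma> c (pw (c * l) K)"
        using cdiff_pw_fixed[OF \<gamma>(1) cl \<gamma>(2) cl_irrat_in[OF K]] by simp
      also have "\<dots> = - cdiff \<gamma> c (pw l K)"
        using \<gamma>c[OF pw_irrat[OF K l]] pw_pw[OF cl_irrat_in[OF K]] by simp
      finally show ?thesis by simp
    qed
    have norm: "\<exists>\<eta>. (\<eta> = 1 \<or> \<eta> = -1) \<and> \<eta> * (cdiff \<chi> t z)\<^sup>2 * of_nat (card (\<Union>(cl_irrat G))) = 2 * of_nat N"
      if \<chi>: "\<chi> \<in> Irr G" "coprime t N" "gal t \<chi> \<noteq> \<chi>"
        and c1: "\<And>K. K \<in> cl_irrat G \<Longrightarrow> cdiff \<chi> t (pw c K) = \<epsilon> * cdiff \<chi> t K" and e1: "\<epsilon> = 1 \<or> \<epsilon> = -1"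
        and c2: "\<And>K. K \<in> cl_irrat G \<Longrightarrow> cdiff \<chi> t (pw l K) = \<epsilon>' * cdiff \<chi> t K" and e2: "\<epsilon>' = 1 \<or> \<epsilon>' = -1"
      for \<chi> t \<epsilon> \<epsilon>'
    proof -
      have c3: "cdiff \<chi> t (pw (c * l) K) = \<epsilon> * \<epsilon>' * cdiff \<chi> t K" if "K \<in> cl_irrat G" for K
        using c1[OF pw_irrat[OF that l]] c2[OF that] pw_pw[OF cl_irrat_in[OF that]] by simp
      have sq: "(cdiff \<chi> t K)\<^sup>2 = (cdiff \<chi> t z)\<^sup>2" if "K \<in> cl_irrat G" for K
      proof -
        have "cdiff \<chi> t K = cdiff \<chi> t z \<or> cdiff \<chi> t K = - cdiff \<chi> t z"
          using cases4[OF that] c1[OF z] c2[OF z] c3[OF z] e1 e2 pw1[OF zc] by (elim disjE) simp_all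
        then show ?thesis by (elim disjE) simp_all
      qed
      let ?j = "2 * N - 1"
      have j: "coprime ?j N"
      proof (rule coprimeI)
        fix a assume a: "a dvd ?j" "a dvd N"
        have "a dvd 2 * N - ?j" by (rule dvd_diff_nat[OF dvd_mult[OF a(2)] a(1)])
        moreover have "2 * N - ?j = 1" using N_pos by simp
        ultimately show "a dvd 1" by metis
      qed
      \<comment> \<open>Inversion acts as one of the four exponents, so its sign is 1, \<epsilon>,
        \<epsilon>' or their product.\<close>
      obtain s where s: "pw ?j z = pw s z" "s = 1 \<or> s = c \<or> s = l \<or> s = c * l"
        using cases4[OF pw_irrat[OF z j]] by blast
      have "\<exists>\<eta>. (\<eta> = 1 \<or> \<eta> = -1) \<and> (\<forall>K\<in>cl_irrat G. cdiff \<chi> t (pw s K) = \<eta> * cdiff \<chi> t K)"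
      proof -
        have c0: "cdiff \<chi> t (pw 1 K) = 1 * cdiff \<chi> t K" if "K \<in> cl_irrat G" for K
          using pw1[OF cl_irrat_in[OF that]] by simp
        have e3: "\<epsilon> * \<epsilon>' = 1 \<or> \<epsilon> * \<epsilon>' = -1" using e1 e2 by auto
        from s(2) show ?thesis
        proof (elim disjE)
          assume s: "s = 1"
          show ?thesis unfolding s by (intro exI[of _ 1] conjI ballI c0) simp_all
        next
          assume s: "s = c"
          show ?thesis unfolding s by (intro exI[of _ \<epsilon>] conjI ballI c1 e1)
        next
          assume s: "s = l"
          show ?thesis unfolding s by (intro exI[of _ \<epsilon>'] conjI ballI c2 e2)
        next
          assume s: "s = c * l"
          show ?thesis unfolding s by (intro exI[of _ "\<epsilon> * \<epsilon>'"] conjI ballI c3 e3)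
        qed
      qed
      then obtain \<eta> where \<eta>: "\<eta> = 1 \<or> \<eta> = -1" "\<And>K. K \<in> cl_irrat G \<Longrightarrow> cdiff \<chi> t (pw s K) = \<eta> * cdiff \<chi> t K" by blast
      have "\<eta> * (cdiff \<chi> t z)\<^sup>2 * of_nat (card (\<Union>(cl_irrat G))) = 2 * of_nat N"
      proof (rule cdiff_norm[OF \<chi>])
        show "(cdiff \<chi> t K)\<^sup>2 = (cdiff \<chi> t z)\<^sup>2" if "K \<in> cl_irrat G" for K by (rule sq[OF that])
      next
        fix K assume K: "K \<in> cl_irrat G"
        show "cdiff \<chi> t (pw ?j K) = \<eta> * cdiff \<chi> t K" unfolding same[OF s(1) K] by (rule \<eta>(2)[OF K])
      qed
      then show ?thesis using \<eta>(1) by blast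
    qed
    define M :: complex where "M = of_nat (card (\<Union>(cl_irrat G)))"
    obtain a where a: "a = 1 \<or> a = -1" "a * (cdiff \<alpha> l z)\<^sup>2 * M = 2 * of_nat N"
      using norm[OF \<alpha>I l ne, of 1 "-1"] \<alpha>s unfolding M_def by auto
    obtain b where b: "b = 1 \<or> b = -1" "b * (cdiff \<beta> c z)\<^sup>2 * M = 2 * of_nat N"
      using norm[OF \<beta>(1) c \<beta>(3), of "-1" 1] \<beta>s unfolding M_def by auto
    obtain e where e: "e = 1 \<or> e = -1" "e * (cdiff \<gamma> c z)\<^sup>2 * M = 2 * of_nat N"
      using norm[OF \<gamma>(1) c \<gamma>(3), of "-1" "-1"] \<gamma>c \<gamma>l unfolding M_def by auto
    have NZ: "2 * of_nat N \<noteq> (0 :: complex)" using N_pos by simp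
    have M0: "M \<noteq> 0" using a NZ by auto
    have nz: "cdiff \<alpha> l z \<noteq> 0" "cdiff \<beta> c z \<noteq> 0" using a b NZ by auto
    have eqI: "x\<^sup>2 = y\<^sup>2" if "s * x\<^sup>2 * M = 2 * of_nat N" "s * y\<^sup>2 * M = 2 * of_nat N" "s = 1 \<or> s = -1" for s x y :: complex
    proof -
      have "(s * M) * x\<^sup>2 = (s * M) * y\<^sup>2" using that(1,2) by (simp add: mult_ac)
      moreover have "s * M \<noteq> 0" using that(3) M0 by auto
      ultimately show ?thesis by simp
    qed
    \<comment> \<open>Three signs take only two values. Every pair has a separating exponent:
      \<open>c\<close> preserves the difference of \<alpha> and negates those of \<beta> and
      \<gamma>, while \<open>l\<close> preserves that of \<beta> and negates that of
      \<gamma>.\<close>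
    have "a = b \<or> a = e \<or> b = e" using a(1) b(1) e(1) by auto
    then show False
    proof (elim disjE)
      assume "a = b"
      then have "(cdiff \<alpha> l z)\<^sup>2 = (cdiff \<beta> c z)\<^sup>2" using eqI a b by blast
      then have "cdiff \<alpha> l z = 0" by (rule cdiff_sign_conflict[OF \<alpha>I \<beta>(1) c zc _ \<alpha>s(1)[OF z] \<beta>s(2)[OF z]])
      then show False using nz by simp
    next
      assume "a = e"
      then have "(cdiff \<alpha> l z)\<^sup>2 = (cdiff \<gamma> c z)\<^sup>2" using eqI a e by blast
      then have "cdiff \<alpha> l z = 0" by (rule cdiff_sign_conflict[OF \<alpha>I \<gamma>(1) c zc _ \<alpha>s(1)[OF z] \<gamma>c[OF z]])
      then show False using nz by simp
    next
      assume "b = e"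
      then have "(cdiff \<beta> c z)\<^sup>2 = (cdiff \<gamma> c z)\<^sup>2" using eqI b e by blast
      then have "cdiff \<beta> c z = 0" by (rule cdiff_sign_conflict[OF \<beta>(1) \<gamma>(1) l zc _ \<beta>s(1)[OF z] \<gamma>l[OF z]])
      then show False using nz by simp
    qed
  qed
qed

theorem card_cl_rat_eq_card_Irr_rat:
  assumes le: "card (cl_irrat G) \<le> 5"
  shows "card (cl_rat G) = card (Irr_rat G)"
proof -
  obtain c where c: "coprime c N" and mov: "\<forall>K\<in>cl_irrat G. pw c K \<noteq> K"
    using exists_pw_moving_all[OF le] by metis
  have "fix_Irr c = Irr_rat G"
  proof (intro equalityI subsetI)
    fix \<chi> assume \<chi>: "\<chi> \<in> fix_Irr c"
    then show "\<chi> \<in> Irr_rat G"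
      unfolding Irr_rat_iff using fix_Irr_moving_rational[OF le c mov \<chi>] by (simp add: fix_Irr_def)
  next
    fix \<chi> assume "\<chi> \<in> Irr_rat G"
    then show "\<chi> \<in> fix_Irr c" unfolding Irr_rat_iff using c by (simp add: fix_Irr_def)
  qed
  then show ?thesis using card_fix_Irr_if_moving[OF c mov] by simp
qed

end

theorem theoremA:
  fixes G :: "('a, 'b) monoid_scheme"
  assumes "group G" and "finite (carrier G)"
    and "card (cl_irrat G) \<le> 5"
  shows "card (cl_rat G) = card (Irr_rat G)"
proof -
  interpret finite_group G using assms(1,2) by (simp add: finite_group_def finite_group_axioms_def)
  show ?thesis by (rule card_cl_rat_eq_card_Irr_rat[OF assms(3)])
qed

end
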